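(* Let $h\in[1,n]$ and let $A=(a_{i,j}),C\in\Xi_{N,2r}$ with $C=E^\theta_{h+1,h}+\mathrm{diag}(\widehat\gamma)$ for some $\gamma\in\Lambda(n+1,r-1)$, and assume $\mathrm{ro}(C)=\widehat\lambda$, $\mathrm{co}(C)=\mathrm{ro}(A)=\widehat\mu$, $\mathrm{co}(A)=\widehat\nu$ with $\lambda,\mu,\nu\in\Lambda(n+1,r)$. Let $\varepsilon=\mathrm{sgn}(A)$. Assume $C\in\Xi^{\circ\circ\circ}$. Then $h<n$ and, for $A\in\Xi^{\circ\circ\bullet}\sqcup\Xi^{\circ\circ\circ}$, the following hold in $S^{D}_{\boldsymbol q}(n,r)$: $$\phi_{{}^{+}C^{+}}\,\phi_{{}^{+}A^{\varepsilon}}=\sum_{1\le p\le N}g'_{h,A,\overline p}\,\phi_{{}^{+}({}_hA_{\overline p})^{\varepsilon}},\qquad \phi_{{}^{-}C^{-}}\,\phi_{{}^{-}A^{-\varepsilon}}=\sum_{1\le p\le N}g'_{h,A,\overline p}\,\phi_{{}^{-}({}_hA_{\overline p})^{-\varepsilon}},$$ where (for $h<n$) $g'_{h,A,\overline p}=\boldsymbol q^{\sum_{j<p}a_{h+1,j}}[\![a_{h+1,p}+1]\!]$ if $a_{h,p}>0$, and $g'_{h,A,\overline p}=0$ (the corresponding term being zero) if $a_{h,p}=0$.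
   Context: Let $n\ge1$, $r\ge4$, $N=2n+1$, $[a,b]=\{x\in\mathbb Z:a\le x\le b\}$, $\mathcal A=\mathbb Z[\boldsymbol q]$ with $\boldsymbol q$ an indeterminate, $[\![m]\!]=(\boldsymbol q^m-1)/(\boldsymbol q-1)$. $W$ is the group of permutations $w$ of $[1,2r]$ with $w(i)+w(2r+1-i)=2r+1$ for all $i$ (type $B_r$), with Coxeter generators $s_i=(i,i+1)(2r-i,2r+1-i)$ ($1\le i<r$) and $s_r=(r,r+1)$. $H=H_{\boldsymbol q,1}$ is the $\mathcal A$-algebra generated by $T_1,\dots,T_r$ with relations $T_iT_j=T_jT_i$ ($|i-j|\ge2$), $T_jT_{j+1}T_j=T_{j+1}T_jT_{j+1}$ ($1\le j<r-1$), $T_{r-1}T_rT_{r-1}T_r=T_rT_{r-1}T_rT_{r-1}$, $T_i^2=(\boldsymbol q-1)T_i+\boldsymbol q$ ($i<r$), $T_r^2=1$; it has basis $\{T_w\}_{w\in W}$ defined via reduced expressions. $\Lambda(n+1,m)=\{\lambda\in\mathbb N^{n+1}:\sum\lambda_i=m\}$, $\widehat\lambda=(\lambda_1,\dots,\lambda_n,2\lambda_{n+1},\lambda_n,\dots,\lambda_1)$. For $\lambda\in\Lambda(n+1,r)$, $W_\lambda$ is generated by the $s_j$, $j\in[1,r]$, with $j\notin\{\lambda_1+\dots+\lambda_i:i\in[1,n]\}$. $\Xi_{N,2r}$ is the set of $N\times N$ matrices $A=(a_{i,j})$ over $\mathbb N$ with $a_{i,j}=a_{N+1-i,N+1-j}$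 and $\sum a_{i,j}=2r$; $\mathrm{ro}(A),\mathrm{co}(A)$ are the row sum and column sum vectors. Let $R_i^{\widehat\lambda}$ ($1\le i\le N$) be the consecutive intervals of lengths $\widehat\lambda_i$ partitioning $[1,2r]$. The map $(\lambda,d,\mu)\mapsto(|R_i^{\widehat\lambda}\cap dR_j^{\widehat\mu}|)_{i,j}$, with $\lambda,\mu\in\Lambda(n+1,r)$ and $d$ a minimal length representative of a $W_\lambda$-$W_\mu$ double coset, is a bijection onto $\Xi_{N,2r}$; if $A$ is the image of $(\lambda,d,\mu)$ write $d_A=d$ (then $\mathrm{ro}(A)=\widehat\lambda$, $\mathrm{co}(A)=\widehat\mu$). $\check W\le W$ is the subgroup of $w$ with $\#\{i\in[1,r]:w(i)>r\}$ even (type $D_r$), with Coxeter generators $s_1,\dots,s_{r-1},s_rs_{r-1}s_r$; $\check H\subset H$ is the subalgebra generated by $T_1,\dots,T_{r-1},T_rT_{r-1}T_r$, with basis $\{T_w\}_{w\in\check W}$. $\Lambda^{D}(n,r)$ consists of symbols $\lambda^\bullet$ ($\lambda\in\Lambda(n+1,r)$, $\lambda_{n+1}\ne0$) and $\lambda^+,\lambda^-$ ($\lambda_{n+1}=0$); $\check W_{\lambda^\bullet}=W_\lambda\cap\check W$, $\check W_{\lambda^+}=W_\lambda$, $\check W_{\lambda^-}=s_rW_\lambda s_r$; $\check x_\alpha=\sum_{w\in\check W_\alpha}T_w$; $S^{D}_{\boldsymbol q}(n,r)=\mathrm{End}_{\check H}(\bigoplus_{\alpha\in\Lambda^{D}(n,r)}\check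 x_\alpha\check H)$, product being composition (also written $*$). For $\alpha,\beta\in\Lambda^{D}(n,r)$ and $d$ the minimal length representative (for $\check W$) of a $\check W_\alpha$-$\check W_\beta$ double coset in $\check W$, $\phi^d_{\alpha,\beta}(\check x_\gamma h)=\delta_{\beta,\gamma}\sum_{w\in\check W_\alpha d\check W_\beta}T_wh$. $\mathrm{sgn}(A)\in\{+,-\}$ is $+$ iff $\sum_{i\in[1,n],\,j\in[n+2,N]}a_{i,j}$ is even; signs multiply as usual and $-\varepsilon$ is the opposite sign. For $A\in\Xi_{N,2r}$ with $a_{n+1,n+1}=0$ one has symbols ${}^{\varepsilon}A^{\varepsilon'}$ with $\varepsilon\varepsilon'=\mathrm{sgn}(A)$. With $\mathrm{ro}(A)=\widehat\lambda$, $\mathrm{co}(A)=\widehat\mu$, put $\lambda^{[\varepsilon]}=\lambda^\varepsilon$ if $\lambda_{n+1}=0$, $\lambda^{[\varepsilon]}=\lambda^\bullet$ otherwise (same for $\mu$), $s^{+}=1$, $s^{-}=s_r$. Then $\phi_{{}^{\varepsilon}A^{\varepsilon'}}=\phi^{d}_{\lambda^{[\varepsilon]},\mu^{[\varepsilon']}}$, $d$ the minimal representative of $\check W_{\lambda^{[\varepsilon]}}s^{\varepsilon}d_As^{\varepsilon'}\check W_{\mu^{[\varepsilon']}}$. With $\mathrm{ro}(A)=\widehat\lambda,\mathrm{co}(A)=\widehat\mu$: $\Xi^{\circ\circ\circ}$ is the set of $A\in\Xi_{N,2r}$ with $a_{n+1,n+1}=0$, $\lambda_{n+1}=0=\mu_{n+1}$;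 $\Xi^{\circ\circ\bullet}$ the set of those with $a_{n+1,n+1}=0$, $\lambda_{n+1}=0\ne\mu_{n+1}$. $E^\theta_{i,j}=E_{i,j}+E_{N+1-i,N+1-j}$ ($E_{i,j}$ matrix units), ${}_hA_{\overline p}=A-E^\theta_{h,p}+E^\theta_{h+1,p}$. *)

theory Defs
  imports
    "HOL-Algebra.Sym_Groups"
    "HOL-Algebra.Generated_Rings"
    "HOL-Algebra.QuotRing"
    "HOL-Algebra.Module"
    "HOL-Computational_Algebra.Polynomial"
    "HOL-Library.Poly_Mapping"
begin

text \<open>
  Vectors in \<open>\<nat>\<^sup>k\<close> and \<open>N \<times> N\<close> matrices over \<open>\<nat>\<close> are functions on \<^typ>\<open>nat\<close>, indexed from 1 and
  zero outside the index range, so that equality of functions is equality of vectors and matrices.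
  Throughout, \<open>N = 2n + 1\<close> and \<open>\<A> = \<int>[q]\<close> is \<^typ>\<open>int poly\<close>.
\<close>

definition qvar :: "int poly" where "qvar = [:0, 1:]"

definition qint :: "nat \<Rightarrow> int poly" where
  "qint m = (qvar ^ m - 1) div (qvar - 1)"


section \<open>The groups of types B and D\<close>

text \<open>Permutations of \<open>[1,2r]\<close> are functions fixing everything outside \<open>[1,2r]\<close>; the group product
  \<open>u v\<close> is \<^term>\<open>u \<circ> v\<close>.\<close>

definition WB :: "nat \<Rightarrow> (nat \<Rightarrow> nat) set" where
  "WB r = {w. w permutes {1..2*r} \<and> (\<forall>i\<in>{1..2*r}. w i + w (2*r + 1 - i) = 2*r + 1)}"

definition sB :: "nat \<Rightarrow> nat \<Rightarrow> (nat \<Rightarrow> nat)" where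
  "sB r i = (if i = r then transpose r (r + 1)
             else transpose i (i + 1) \<circ> transpose (2*r - i) (2*r + 1 - i))"

definition WD :: "nat \<Rightarrow> (nat \<Rightarrow> nat) set" where
  "WD r = {w \<in> WB r. even (card {i\<in>{1..r}. w i > r})}"

definition sD :: "nat \<Rightarrow> nat \<Rightarrow> (nat \<Rightarrow> nat)" where
  "sD r i = (if i = r then sB r r \<circ> sB r (r - 1) \<circ> sB r r else sB r i)"

definition word_prod :: "(nat \<Rightarrow> nat \<Rightarrow> nat) \<Rightarrow> nat list \<Rightarrow> (nat \<Rightarrow> nat)" where
  "word_prod s is = foldr (\<lambda>i w. s i \<circ> w) is id"

definition is_expr :: "nat \<Rightarrow> (nat \<Rightarrow> nat \<Rightarrow> nat) \<Rightarrow> (nat \<Rightarrow> nat) \<Rightarrow> nat list \<Rightarrow> bool" where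
  "is_expr r s w is \<longleftrightarrow> set is \<subseteq> {1..r} \<and> word_prod s is = w"

definition wlen :: "nat \<Rightarrow> (nat \<Rightarrow> nat \<Rightarrow> nat) \<Rightarrow> (nat \<Rightarrow> nat) \<Rightarrow> nat" where
  "wlen r s w = (LEAST k. \<exists>is. is_expr r s w is \<and> length is = k)"

definition reduced_expr :: "nat \<Rightarrow> (nat \<Rightarrow> nat \<Rightarrow> nat) \<Rightarrow> (nat \<Rightarrow> nat) \<Rightarrow> nat list \<Rightarrow> bool" where
  "reduced_expr r s w is \<longleftrightarrow> is_expr r s w is \<and> length is = wlen r s w"

definition dcoset :: "(nat \<Rightarrow> nat) set \<Rightarrow> (nat \<Rightarrow> nat) \<Rightarrow> (nat \<Rightarrow> nat) set \<Rightarrow> (nat \<Rightarrow> nat) set" where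
  "dcoset X d Y = {u \<circ> d \<circ> v | u v. u \<in> X \<and> v \<in> Y}"

definition is_min_in :: "nat \<Rightarrow> (nat \<Rightarrow> nat \<Rightarrow> nat) \<Rightarrow> (nat \<Rightarrow> nat) set \<Rightarrow> (nat \<Rightarrow> nat) \<Rightarrow> bool" where
  "is_min_in r s X d \<longleftrightarrow> d \<in> X \<and> (\<forall>x\<in>X. wlen r s d \<le> wlen r s x)"


section \<open>The Hecke algebra\<close>

text \<open>The free algebra on letters \<open>T\<^sub>i\<close> over \<open>\<int>[q]\<close> is the monoid algebra of the free monoid of words;
  the latter is a type of its own, written additively as required by the convolution product
  on \<^type>\<open>poly_mapping\<close>.\<close>

datatype fword = FW (letters: "nat list")

instantiation fword :: monoid_add
begin

definition zero_fword :: fword where "0 = FW []"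

definition plus_fword :: "fword \<Rightarrow> fword \<Rightarrow> fword" where
  "u + v = FW (letters u @ letters v)"

instance
  by standard (auto simp: zero_fword_def plus_fword_def)

end

type_synonym falg = "fword \<Rightarrow>\<^sub>0 int poly"

definition gen :: "nat \<Rightarrow> falg" where
  "gen i = Poly_Mapping.single (FW [i]) 1"

definition scal :: "int poly \<Rightarrow> falg" where
  "scal a = Poly_Mapping.single 0 a"

definition free_alg :: "nat \<Rightarrow> falg ring" where
  "free_alg r = \<lparr>carrier = {f. \<forall>w\<in>Poly_Mapping.keys f. set (letters w) \<subseteq> {1..r}},
                 mult = (*), one = 1, zero = 0, add = (+)\<rparr>"

definition hecke_rels :: "nat \<Rightarrow> falg set" where
  "hecke_rels r =
     {gen i * gen j - gen j * gen i | i j. i \<in> {1..r} \<and> j \<in> {1..r} \<and> \<bar>int i - int j\<bar> \<ge> 2}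
   \<union> {gen j * gen (j+1) * gen j - gen (j+1) * gen j * gen (j+1) | j. 1 \<le> j \<and> j < r - 1}
   \<union> {gen (r-1) * gen r * gen (r-1) * gen r - gen r * gen (r-1) * gen r * gen (r-1)}
   \<union> {gen i * gen i - (scal (qvar - 1) * gen i + scal qvar) | i. 1 \<le> i \<and> i < r}
   \<union> {gen r * gen r - 1}"

definition hecke_ideal :: "nat \<Rightarrow> falg set" where
  "hecke_ideal r = Idl\<^bsub>free_alg r\<^esub> (hecke_rels r)"

definition cls :: "nat \<Rightarrow> falg \<Rightarrow> falg set" where
  "cls r x = hecke_ideal r +>\<^bsub>free_alg r\<^esub> x"

text \<open>The \<open>\<int>[q]\<close>-algebra \<open>H\<close>: the quotient ring together with its scalar multiplication.\<close>

definition hecke :: "nat \<Rightarrow> (int poly, falg set) module" where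
  "hecke r = (let Q = free_alg r Quot hecke_ideal r in
     \<lparr>carrier = carrier Q, mult = mult Q, one = one Q, zero = zero Q, add = add Q,
      module.smult = (\<lambda>a X. cls r (scal a) \<otimes>\<^bsub>Q\<^esub> X)\<rparr>)"

text \<open>\<open>T\<^sub>w\<close> does not depend on the reduced expression, by the braid relations (Matsumoto), so an
  arbitrary one is chosen. For \<open>w\<close> in the group of type D this is also the element given by a reduced
  expression in the Coxeter generators of type D, since \<open>T\<^sub>r\<^sup>2 = 1\<close>.\<close>

definition Tw :: "nat \<Rightarrow> (nat \<Rightarrow> nat) \<Rightarrow> falg set" where
  "Tw r w = cls r (prod_list (map gen (SOME is. reduced_expr r (sB r) w is)))"

definition heckeD :: "nat \<Rightarrow> falg set set" where
  "heckeD r = generate_ring (hecke r)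
     (range (\<lambda>a. cls r (scal a)) \<union> (\<lambda>i. cls r (gen i)) ` {1..<r}
      \<union> {cls r (gen r * gen (r-1) * gen r)})"


section \<open>Compositions, matrices, and double cosets\<close>

definition Lam :: "nat \<Rightarrow> nat \<Rightarrow> (nat \<Rightarrow> nat) set" where
  "Lam k m = {l. (\<forall>i. i \<notin> {1..k} \<longrightarrow> l i = 0) \<and> (\<Sum>i\<in>{1..k}. l i) = m}"

definition hat :: "nat \<Rightarrow> (nat \<Rightarrow> nat) \<Rightarrow> (nat \<Rightarrow> nat)" where
  "hat n l = (\<lambda>i. if i \<in> {1..n} then l i
                  else if i = n + 1 then 2 * l (n + 1)
                  else if i \<in> {n+2..2*n+1} then l (2*n + 2 - i) else 0)"

definition Wpar :: "nat \<Rightarrow> nat \<Rightarrow> (nat \<Rightarrow> nat) \<Rightarrow> (nat \<Rightarrow> nat) set" where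
  "Wpar n r l = generate (sym_group (2*r))
     (sB r ` {j\<in>{1..r}. j \<notin> {\<Sum>k\<in>{1..i}. l k | i. i \<in> {1..n}}})"

definition Xi :: "nat \<Rightarrow> nat \<Rightarrow> (nat \<Rightarrow> nat \<Rightarrow> nat) set" where
  "Xi n r = {A. (\<forall>i j. i \<notin> {1..2*n+1} \<or> j \<notin> {1..2*n+1} \<longrightarrow> A i j = 0) \<and>
     (\<forall>i\<in>{1..2*n+1}. \<forall>j\<in>{1..2*n+1}. A i j = A (2*n + 2 - i) (2*n + 2 - j)) \<and>
     (\<Sum>i\<in>{1..2*n+1}. \<Sum>j\<in>{1..2*n+1}. A i j) = 2 * r}"

definition ro :: "nat \<Rightarrow> (nat \<Rightarrow> nat \<Rightarrow> nat) \<Rightarrow> (nat \<Rightarrow> nat)" where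
  "ro n A = (\<lambda>i. \<Sum>j\<in>{1..2*n+1}. A i j)"

definition co :: "nat \<Rightarrow> (nat \<Rightarrow> nat \<Rightarrow> nat) \<Rightarrow> (nat \<Rightarrow> nat)" where
  "co n A = (\<lambda>j. \<Sum>i\<in>{1..2*n+1}. A i j)"

definition block :: "(nat \<Rightarrow> nat) \<Rightarrow> nat \<Rightarrow> nat set" where
  "block v i = {x. (\<Sum>k\<in>{1..<i}. v k) < x \<and> x \<le> (\<Sum>k\<in>{1..i}. v k)}"

definition coset_mat :: "nat \<Rightarrow> (nat \<Rightarrow> nat) \<Rightarrow> (nat \<Rightarrow> nat) \<Rightarrow> (nat \<Rightarrow> nat) \<Rightarrow> (nat \<Rightarrow> nat \<Rightarrow> nat)" where
  "coset_mat n l d m = (\<lambda>i j. if i \<in> {1..2*n+1} \<and> j \<in> {1..2*n+1}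
                                then card (block (hat n l) i \<inter> d ` block (hat n m) j) else 0)"

definition dmat :: "nat \<Rightarrow> nat \<Rightarrow> (nat \<Rightarrow> nat \<Rightarrow> nat) \<Rightarrow> (nat \<Rightarrow> nat)" where
  "dmat n r A = (THE d. \<exists>l\<in>Lam (n+1) r. \<exists>m\<in>Lam (n+1) r. d \<in> WB r \<and>
     is_min_in r (sB r) (dcoset (Wpar n r l) d (Wpar n r m)) d \<and> A = coset_mat n l d m)"

definition Xi_ooo :: "nat \<Rightarrow> nat \<Rightarrow> (nat \<Rightarrow> nat \<Rightarrow> nat) set" where
  "Xi_ooo n r = {A \<in> Xi n r. A (n+1) (n+1) = 0 \<and>
     (\<exists>l\<in>Lam (n+1) r. \<exists>m\<in>Lam (n+1) r. ro n A = hat n l \<and> co n A = hat n m \<and>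
        l (n+1) = 0 \<and> m (n+1) = 0)}"

definition Xi_oob :: "nat \<Rightarrow> nat \<Rightarrow> (nat \<Rightarrow> nat \<Rightarrow> nat) set" where
  "Xi_oob n r = {A \<in> Xi n r. A (n+1) (n+1) = 0 \<and>
     (\<exists>l\<in>Lam (n+1) r. \<exists>m\<in>Lam (n+1) r. ro n A = hat n l \<and> co n A = hat n m \<and>
        l (n+1) = 0 \<and> m (n+1) \<noteq> 0)}"

definition E_unit :: "nat \<Rightarrow> nat \<Rightarrow> (nat \<Rightarrow> nat \<Rightarrow> nat)" where
  "E_unit i j = (\<lambda>k l. if k = i \<and> l = j then 1 else 0)"

definition E_theta :: "nat \<Rightarrow> nat \<Rightarrow> nat \<Rightarrow> (nat \<Rightarrow> nat \<Rightarrow> nat)" where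
  "E_theta n i j = (\<lambda>k l. E_unit i j k l + E_unit (2*n + 2 - i) (2*n + 2 - j) k l)"

definition diag_mat :: "(nat \<Rightarrow> nat) \<Rightarrow> (nat \<Rightarrow> nat \<Rightarrow> nat)" where
  "diag_mat v = (\<lambda>i j. if i = j then v i else 0)"

text \<open>The subtraction on \<^typ>\<open>nat\<close> is exact whenever \<open>h \<le> n\<close> and \<open>a\<^sub>h\<^sub>,\<^sub>p > 0\<close>.\<close>

definition shift_down :: "nat \<Rightarrow> nat \<Rightarrow> (nat \<Rightarrow> nat \<Rightarrow> nat) \<Rightarrow> nat \<Rightarrow> (nat \<Rightarrow> nat \<Rightarrow> nat)" where
  "shift_down n h A p = (\<lambda>i j. A i j - E_theta n h p i j + E_theta n (h+1) p i j)"


section \<open>The q-Schur algebra of type D\<close>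

datatype pm = Plus | Minus

instantiation pm :: uminus
begin

fun uminus_pm :: "pm \<Rightarrow> pm" where
  "- Plus = Minus"
| "- Minus = Plus"

instance ..

end

definition sgn_mat :: "nat \<Rightarrow> (nat \<Rightarrow> nat \<Rightarrow> nat) \<Rightarrow> pm" where
  "sgn_mat n A = (if even (\<Sum>i\<in>{1..n}. \<Sum>j\<in>{n+2..2*n+1}. A i j) then Plus else Minus)"

datatype dsym = Bullet "nat \<Rightarrow> nat" | Signed "nat \<Rightarrow> nat" pm

definition LamD :: "nat \<Rightarrow> nat \<Rightarrow> dsym set" where
  "LamD n r = {Bullet l | l. l \<in> Lam (n+1) r \<and> l (n+1) \<noteq> 0}
            \<union> {Signed l e | l e. l \<in> Lam (n+1) r \<and> l (n+1) = 0}"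

definition s_sign :: "nat \<Rightarrow> pm \<Rightarrow> (nat \<Rightarrow> nat)" where
  "s_sign r e = (case e of Plus \<Rightarrow> id | Minus \<Rightarrow> sB r r)"

fun WparD :: "nat \<Rightarrow> nat \<Rightarrow> dsym \<Rightarrow> (nat \<Rightarrow> nat) set" where
  "WparD n r (Bullet l) = Wpar n r l \<inter> WD r"
| "WparD n r (Signed l Plus) = Wpar n r l"
| "WparD n r (Signed l Minus) = (\<lambda>w. sB r r \<circ> w \<circ> sB r r) ` Wpar n r l"

definition Tsum :: "nat \<Rightarrow> (nat \<Rightarrow> nat) set \<Rightarrow> falg set" where
  "Tsum r X = (\<Oplus>\<^bsub>hecke r\<^esub>w\<in>X. Tw r w)"

definition xD :: "nat \<Rightarrow> nat \<Rightarrow> dsym \<Rightarrow> falg set" where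
  "xD n r a = Tsum r (WparD n r a)"

text \<open>The direct sum of the right ideals \<open>x\<^sub>\<alpha> H\<close> (\<open>H\<close> of type D) over the finite set \<open>\<Lambda>\<^sup>D(n,r)\<close>, as a product.\<close>

definition tensorD :: "nat \<Rightarrow> nat \<Rightarrow> (dsym \<Rightarrow> falg set) set" where
  "tensorD n r = (\<Pi>\<^sub>E a\<in>LamD n r. (\<lambda>h. xD n r a \<otimes>\<^bsub>hecke r\<^esub> h) ` heckeD r)"

definition inj_at :: "nat \<Rightarrow> nat \<Rightarrow> dsym \<Rightarrow> falg set \<Rightarrow> (dsym \<Rightarrow> falg set)" where
  "inj_at n r a X = (\<lambda>c\<in>LamD n r. if c = a then X else \<zero>\<^bsub>hecke r\<^esub>)"

definition vadd :: "nat \<Rightarrow> nat \<Rightarrow> (dsym \<Rightarrow> falg set) \<Rightarrow> (dsym \<Rightarrow> falg set) \<Rightarrow> (dsym \<Rightarrow> falg set)" where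
  "vadd n r u v = (\<lambda>a\<in>LamD n r. u a \<oplus>\<^bsub>hecke r\<^esub> v a)"

definition vact :: "nat \<Rightarrow> nat \<Rightarrow> (dsym \<Rightarrow> falg set) \<Rightarrow> falg set \<Rightarrow> (dsym \<Rightarrow> falg set)" where
  "vact n r v h = (\<lambda>a\<in>LamD n r. v a \<otimes>\<^bsub>hecke r\<^esub> h)"

definition SD :: "nat \<Rightarrow> nat \<Rightarrow> (int poly, (dsym \<Rightarrow> falg set) \<Rightarrow> (dsym \<Rightarrow> falg set)) module" where
  "SD n r = (let M = tensorD n r in
     \<lparr>carrier = {f \<in> M \<rightarrow>\<^sub>E M.
         (\<forall>u\<in>M. \<forall>v\<in>M. f (vadd n r u v) = vadd n r (f u) (f v)) \<and>
         (\<forall>v\<in>M. \<forall>h\<in>heckeD r. f (vact n r v h) = vact n r (f v) h)},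
      mult = (\<lambda>f g. compose M f g),
      one = (\<lambda>v\<in>M. v),
      zero = (\<lambda>v\<in>M. \<lambda>a\<in>LamD n r. \<zero>\<^bsub>hecke r\<^esub>),
      add = (\<lambda>f g. \<lambda>v\<in>M. vadd n r (f v) (g v)),
      module.smult = (\<lambda>c f. \<lambda>v\<in>M. \<lambda>a\<in>LamD n r. c \<odot>\<^bsub>hecke r\<^esub> f v a)\<rparr>)"

definition phi_d :: "nat \<Rightarrow> nat \<Rightarrow> dsym \<Rightarrow> dsym \<Rightarrow> (nat \<Rightarrow> nat)
    \<Rightarrow> (dsym \<Rightarrow> falg set) \<Rightarrow> (dsym \<Rightarrow> falg set)" where
  "phi_d n r a b d = (THE f. f \<in> carrier (SD n r) \<and>
     (\<forall>c\<in>LamD n r. \<forall>h\<in>heckeD r.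
        f (inj_at n r c (xD n r c \<otimes>\<^bsub>hecke r\<^esub> h)) =
        inj_at n r a (if c = b then Tsum r (dcoset (WparD n r a) d (WparD n r b)) \<otimes>\<^bsub>hecke r\<^esub> h
                      else \<zero>\<^bsub>hecke r\<^esub>)))"

definition sbracket :: "nat \<Rightarrow> (nat \<Rightarrow> nat) \<Rightarrow> pm \<Rightarrow> dsym" where
  "sbracket n l e = (if l (n+1) = 0 then Signed l e else Bullet l)"

definition unhat :: "nat \<Rightarrow> nat \<Rightarrow> (nat \<Rightarrow> nat) \<Rightarrow> (nat \<Rightarrow> nat)" where
  "unhat n r v = (THE l. l \<in> Lam (n+1) r \<and> hat n l = v)"

text \<open>\<^term>\<open>phi n r e A e'\<close> is \<open>\<phi>\<close> at the symbol with matrix \<open>A\<close>, left sign \<open>e\<close> and right sign \<open>e'\<close>.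
  It is meaningful only for actual symbols, i.e. when \<open>a\<^sub>n\<^sub>+\<^sub>1\<^sub>,\<^sub>n\<^sub>+\<^sub>1 = 0\<close> and the product of \<open>e\<close>
  and \<open>e'\<close> is the sign of \<open>A\<close>; only then does the double coset lie in the group of type D.\<close>

definition phi :: "nat \<Rightarrow> nat \<Rightarrow> pm \<Rightarrow> (nat \<Rightarrow> nat \<Rightarrow> nat) \<Rightarrow> pm
    \<Rightarrow> (dsym \<Rightarrow> falg set) \<Rightarrow> (dsym \<Rightarrow> falg set)" where
  "phi n r e A e' =
     (let a = sbracket n (unhat n r (ro n A)) e;
          b = sbracket n (unhat n r (co n A)) e'
      in phi_d n r a b (THE d. is_min_in r (sD r)
           (dcoset (WparD n r a) (s_sign r e \<circ> dmat n r A \<circ> s_sign r e') (WparD n r b)) d))"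

definition gcoef :: "nat \<Rightarrow> (nat \<Rightarrow> nat \<Rightarrow> nat) \<Rightarrow> nat \<Rightarrow> int poly" where
  "gcoef h A p = (if A h p > 0
     then qvar ^ (\<Sum>j\<in>{1..<p}. A (h+1) j) * qint (A (h+1) p + 1) else 0)"

text \<open>If \<open>a\<^sub>h\<^sub>,\<^sub>p = 0\<close>, the shifted matrix does not exist over \<open>\<nat>\<close> and the term is zero by convention.\<close>

definition gterm :: "nat \<Rightarrow> nat \<Rightarrow> nat \<Rightarrow> pm \<Rightarrow> (nat \<Rightarrow> nat \<Rightarrow> nat) \<Rightarrow> pm \<Rightarrow> nat
    \<Rightarrow> (dsym \<Rightarrow> falg set) \<Rightarrow> (dsym \<Rightarrow> falg set)" where
  "gterm n r h e A e' p = (if A h p > 0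
     then gcoef h A p \<odot>\<^bsub>SD n r\<^esub> phi n r e (shift_down n h A p) e' else \<zero>\<^bsub>SD n r\<^esub>)"

end

theory Submission
  imports Defs
begin

text \<open>
  As \<open>T\<^sub>r\<close> has parameter \<open>1\<close>, it is an involution, and \<open>T\<^sub>w T\<^sub>r = T\<^sub>w\<^sub>s\<^sub>r\<close> and \<open>T\<^sub>r T\<^sub>w = T\<^sub>s\<^sub>r\<^sub>w\<close> hold for all \<open>w\<close>.
  So a double coset sum of type D is the sum over the elements of one parity in a double coset of type
  B, multiplied by powers of \<open>T\<^sub>r\<close> on both sides that stand for the signs (\<open>TS_cosetD\<close>). The signs
  between two composable factors agree and cancel, and both formulas reduce to an identity in the Hecke
  algebra of type B: there is an element \<open>K\<close> such that, for either parity,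
    \<open>K \<cdot> \<Sum>{T\<^sub>w | w of this parity with matrix A for \<mu>} = \<Sum>\<^sub>p g\<^sub>p \<cdot> \<Sum>{T\<^sub>w | w of this parity with matrix A\<^sub>p for \<lambda>}\<close>,
  where \<open>A\<^sub>p\<close> is \<open>A\<close> with one unit moved from row \<open>h\<close> to row \<open>h+1\<close> in column \<open>p\<close> (\<open>row_move_formula\<close>).
  For diagonal \<open>A\<close> it says that \<open>K x\<^sub>\<mu>\<close> is the double coset sum of \<open>C\<close> (\<open>diag_formula\<close>), so that \<open>K\<close>
  represents \<open>\<phi>\<close> for \<open>C\<close>.

  To see the identity, attach to each position \<open>x\<close> its row label, the block of the row composition that
  contains \<open>x\<close>, and its column label for \<open>w\<close>, the block of the column composition that contains the
  preimage of \<open>x\<close> under \<open>w\<close>; the matrix counts the pairs of labels. Passing from \<open>\<mu>\<close> to \<open>\<lambda>\<close> changes the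
  row label of a single position \<open>x0\<close> and of its mirror image, so an element with matrix \<open>A\<close> for \<open>\<mu>\<close> has
  matrix \<open>A\<^sub>p\<close> for \<open>\<lambda>\<close>, where \<open>p\<close> is its column label at \<open>x0\<close>. Consider a coset \<open>W\<^sub>\<lambda> w\<close> of elements with
  matrix \<open>A\<^sub>p\<close>, where the inverse of \<open>w\<close> is increasing on the blocks of \<open>\<lambda>\<close>. The element \<open>v w\<close> has
  matrix \<open>A\<close> for \<open>\<mu>\<close> if and only if \<open>v\<close> sends to \<open>x0\<close> a position \<open>x0 + t\<close> of its block with column label
  \<open>p\<close>. These \<open>t\<close> form an interval that starts at the sum of the entries to the left of column
  \<open>p\<close> in row \<open>h+1\<close> of \<open>A\<close> and has one element more than the entry in column \<open>p\<close>. With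
  \<open>K\<close> the sum over the minimal representatives of the left cosets in \<open>W\<^sub>\<lambda>\<close> of the stabiliser of \<open>x0\<close>,
  the part with parameter \<open>t\<close> contributes \<open>q\<^sup>t\<close> times the sum over the whole coset (\<open>exists_K\<close>), and the
  powers of \<open>q\<close> add up to \<open>g\<^sub>p\<close> (\<open>coset_formula\<close>).

  Three things support this computation. Products of the \<open>T\<^sub>w\<close> are controlled by Matsumoto's theorem and
  by the description of lengths through inversions (\<open>matsumoto\<close>, \<open>wlenB\<close>, \<open>wlenD\<close>). Double cosets
  correspond to matrices: an element that is increasing on blocks on both sides is determined by its
  matrix (\<open>bi_incr_unique\<close>), every matrix with empty middle row occurs (\<open>cosetB_nonempty\<close>), and the
  parity of the minimal representative is the sign of the matrix (\<open>dmat_parity\<close>), which also makes the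
  element of least length of type D unique (\<open>min_lenD\<close>). Finally, \<open>\<phi>\<close> is left multiplication by any
  \<open>K\<close> that sends the generator to the double coset sum (\<open>phi_d_Op\<close>); composites and sums of such
  operators come from products and sums of the factors.
\<close>

section \<open>Signed permutations and their lengths\<close>

lemma WB_permutes: "w \<in> WB r \<Longrightarrow> w permutes {1..2*r}"
  by (simp add: WB_def)

lemma WB_mirror: "w \<in> WB r \<Longrightarrow> x \<in> {1..2*r} \<Longrightarrow> w (2*r+1-x) = 2*r+1 - w x"
  by (force simp: WB_def)

lemma WB_in: "w \<in> WB r \<Longrightarrow> w x \<in> {1..2*r} \<longleftrightarrow> x \<in> {1..2*r}"
  using WB_permutes permutes_in_image by fastforce

lemma WB_inj: "w \<in> WB r \<Longrightarrow> w x = w y \<longleftrightarrow> x = y"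
  using WB_permutes permutes_inj by (metis injD)

lemma WB_id: "id \<in> WB r"
  by (auto simp: WB_def permutes_id)

lemma WB_comp:
  assumes "u \<in> WB r" "v \<in> WB r"
  shows "u \<circ> v \<in> WB r"
proof -
  have "u (v i) + u (v (2*r+1-i)) = 2*r+1" if i: "i \<in> {1..2*r}" for i
    using assms(1) WB_in[OF assms(2), of i] i unfolding WB_mirror[OF assms(2) i]
    by (simp add: WB_def del: One_nat_def)
  thus ?thesis using permutes_compose[OF WB_permutes[OF assms(2)] WB_permutes[OF assms(1)]]
    by (simp add: WB_def del: One_nat_def)
qed

lemma WB_inv: "w \<in> WB r \<Longrightarrow> inv' w \<in> WB r"
proof -
  assume w: "w \<in> WB r"
  have p: "w permutes {1..2*r}" using w by (rule WB_permutes)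
  have "inv' w i + inv' w (2*r+1-i) = 2*r+1" if i: "i \<in> {1..2*r}" for i
  proof -
    define j where "j = inv' w i"
    have j: "w j = i" "j \<in> {1..2*r}"
      using permutes_in_image[OF permutes_inv[OF p], of i] i permutes_inverses[OF p] by (simp_all add: j_def)
    have "inv' w (2*r+1-i) = 2*r+1-j"
      using WB_mirror[OF w j(2)] j p by (metis permutes_inv_eq)
    thus ?thesis using j(2) by (simp add: j_def[symmetric])
  qed
  thus ?thesis using permutes_inv[OF p] by (auto simp: WB_def)
qed

lemma WB_inv_apply [simp]:
  assumes "w \<in> WB r"
  shows "inv' w (w x) = x" "w (inv' w x) = x" "inv' w \<circ> w = id" "w \<circ> inv' w = id" "inv' (inv' w) = w"
  using permutes_inverses[OF WB_permutes[OF assms]] permutes_inv_o[OF WB_permutes[OF assms]]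
    permutes_inv_inv[OF WB_permutes[OF assms]] by auto

lemma WB_inv_comp: "u \<in> WB r \<Longrightarrow> v \<in> WB r \<Longrightarrow> inv' (u \<circ> v) = inv' v \<circ> inv' u"
  by (meson WB_permutes bij_imp_bij_inv o_inv_distrib permutes_bij)

lemma WB_finite: "finite (WB r)"
  using finite_subset[OF _ finite_permutations[of "{1..2*r}"]] by (force simp: WB_def)

lemma sB_apply:
  assumes "i \<in> {1..r}"
  shows "sB r i x = (if x = i \<or> x = 2*r-i then x+1 else if x = i+1 \<or> x = 2*r+1-i then x-1 else x)"
proof (cases "i = r")
  case False
  then obtain k where k: "r = i + Suc k" using assms less_imp_Suc_add by fastforce
  have "2*r - i = i + 2*k + 2" "2*r+1-i = i + 2*k + 3" using k by auto
  thus ?thesis using False by (simp only: sB_def if_False o_def transpose_def) simp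
qed (auto simp: sB_def transpose_def)

lemma sB_simps:
  assumes "i \<in> {1..r}"
  shows "sB r i i = i+1" "sB r i (i+1) = i" "sB r i (2*r-i) = 2*r+1-i" "sB r i (2*r+1-i) = 2*r-i"
    "x \<notin> {i, i+1, 2*r-i, 2*r+1-i} \<Longrightarrow> sB r i x = x"
proof -
  have *: "2*r+1-i = Suc (2*r-i)" "2*r-i \<ge> i" "i \<ge> 1" using assms by auto
  have **: "Suc i \<noteq> 2*r-i" using *(2) by presburger
  show "sB r i i = i+1" "sB r i (2*r-i) = 2*r+1-i"
    "x \<notin> {i, i+1, 2*r-i, 2*r+1-i} \<Longrightarrow> sB r i x = x"
    unfolding sB_apply[OF assms] * by auto
  show "sB r i (i+1) = i" "sB r i (2*r+1-i) = 2*r-i"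
    unfolding sB_apply[OF assms] * using *(2,3) ** by auto
qed

lemma sB_invol: "i \<in> {1..r} \<Longrightarrow> sB r i (sB r i x) = x"
proof -
  assume i: "i \<in> {1..r}"
  consider "x = i" | "x = i+1" | "x = 2*r-i" | "x = 2*r+1-i" | "x \<notin> {i, i+1, 2*r-i, 2*r+1-i}"
    by blast
  thus ?thesis using sB_simps[OF i] by cases (simp_all del: One_nat_def)
qed

lemma sB_comp_sB: "i \<in> {1..r} \<Longrightarrow> sB r i \<circ> sB r i = id"
  by (auto simp: fun_eq_iff sB_invol)

lemma sB_comp_sB_left: "i \<in> {1..r} \<Longrightarrow> sB r i \<circ> (sB r i \<circ> w) = w"
  by (auto simp: fun_eq_iff sB_invol)

lemma sB_comp_sB_right: "i \<in> {1..r} \<Longrightarrow> w \<circ> sB r i \<circ> sB r i = w"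
  by (auto simp: fun_eq_iff sB_invol)

lemma sB_WB: "i \<in> {1..r} \<Longrightarrow> sB r i \<in> WB r"
proof -
  assume i: "i \<in> {1..r}"
  have "sB r i permutes {1..2*r}"
    using i by (auto simp: sB_def intro!: permutes_swap_id permutes_compose)
  moreover have "sB r i x + sB r i (2*r+1-x) = 2*r+1" if x: "x \<in> {1..2*r}" for x
  proof -
    consider "x = i" | "x = i+1" | "x = 2*r-i" | "x = 2*r+1-i" | "x \<notin> {i, i+1, 2*r-i, 2*r+1-i}"
      by blast
    thus ?thesis
    proof cases
      case 5
      hence "2*r+1-x \<notin> {i, i+1, 2*r-i, 2*r+1-i}" using i x by auto
      thus ?thesis using 5 sB_simps(5)[OF i] x by auto
    qed (use sB_simps[OF i] i in \<open>auto simp: Suc_diff_le numeral_2_eq_2\<close>)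
  qed
  ultimately show ?thesis by (simp add: WB_def)
qed

lemma sB_inv: "i \<in> {1..r} \<Longrightarrow> inv' (sB r i) = sB r i"
  by (rule inv_unique_comp) (auto simp: sB_comp_sB)

text \<open>The inversions of \<open>w\<close> as a permutation of \<open>[1,2r]\<close>, and the number of sign changes of \<open>w\<close>.
  The length of type B is half the sum of the two numbers, that of type D half their difference:
  mirroring pairs up the inversions other than the pairs \<open>(i, 2r+1-i)\<close>, and the latter are the sign
  changes, which contribute once to the length of type B and not at all to that of type D.\<close>

definition invs :: "nat \<Rightarrow> (nat \<Rightarrow> nat) \<Rightarrow> (nat \<times> nat) set" where
  "invs r w = {(i,j). 1 \<le> i \<and> i < j \<and> j \<le> 2*r \<and> w i > w j}"

definition neg :: "nat \<Rightarrow> (nat \<Rightarrow> nat) \<Rightarrow> nat" where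
  "neg r w = card {i\<in>{1..r}. w i > r}"

lemma finite_invs: "finite (invs r w)"
  by (rule finite_subset[of _ "{1..2*r}\<times>{1..2*r}"]) (auto simp: invs_def)

text \<open>An adjacent transposition at an ascent preserves the order of every other pair of positions, so it
  moves the old inversions injectively to the new ones and adds its own pair.\<close>

lemma card_invs_transpose:
  assumes "inj w" "1 \<le> k" "k < 2*r" "w k < w (k+1)"
  shows "card (invs r (w \<circ> transpose k (k+1))) = Suc (card (invs r w))"
proof -
  let ?t = "transpose k (k+1)"
  have e: "invs r (w \<circ> ?t) = insert (k,k+1) (map_prod ?t ?t ` invs r w)"
  proof (intro Set.set_eqI iffI)
    fix p assume p: "p \<in> invs r (w \<circ> ?t)"
    obtain i j where ij: "p = (i,j)" by force
    show "p \<in> insert (k,k+1) (map_prod ?t ?t ` invs r w)"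
    proof (cases "(i,j) = (k,k+1)")
      case False
      hence "(?t i, ?t j) \<in> invs r w" using p assms ij
        by (auto simp: invs_def transpose_def split: if_splits)
      hence "map_prod ?t ?t (?t i, ?t j) \<in> map_prod ?t ?t ` invs r w" by (rule imageI)
      thus ?thesis using ij by simp
    qed (use ij in auto)
  next
    fix p assume p: "p \<in> insert (k,k+1) (map_prod ?t ?t ` invs r w)"
    show "p \<in> invs r (w \<circ> ?t)"
    proof (cases "p = (k,k+1)")
      case True thus ?thesis using assms by (auto simp: invs_def)
    next
      case False
      then obtain i j where ij: "(i,j) \<in> invs r w" "p = (?t i, ?t j)" using p by auto
      have "(i,j) \<noteq> (k,k+1)" using ij(1) assms(4) by (auto simp: invs_def)
      thus ?thesis using ij assms by (auto simp: invs_def transpose_def)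
    qed
  qed
  have "inj ?t" by simp
  have "(k,k+1) \<notin> map_prod ?t ?t ` invs r w"
  proof
    assume "(k,k+1) \<in> map_prod ?t ?t ` invs r w"
    then obtain i j where "(i,j) \<in> invs r w" "?t i = k" "?t j = k+1" by auto
    hence "i = k+1" "j = k" by (metis transpose_apply_first transpose_involutory transpose_apply_second)+
    with \<open>(i,j) \<in> invs r w\<close> show False by (auto simp: invs_def)
  qed
  moreover have "card (map_prod ?t ?t ` invs r w) = card (invs r w)"
    using \<open>inj ?t\<close> by (intro card_image inj_on_subset[OF prod.inj_map]) auto
  ultimately show ?thesis unfolding e by (simp add: finite_invs)
qed

lemma WB_ascent_mirror:
  assumes w: "w \<in> WB r" and k: "k \<in> {1..r}"
  shows "w (2*r-k) < w (2*r+1-k) \<longleftrightarrow> w k < w (k+1)"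
proof -
  have "2*r - k = 2*r+1-(k+1)" using k by auto
  hence "w (2*r-k) = 2*r+1 - w (k+1)" "w (2*r+1-k) = 2*r+1 - w k"
    using WB_mirror[OF w, of k] WB_mirror[OF w, of "k+1"] k by auto
  moreover have "w k \<in> {1..2*r}" "w (k+1) \<in> {1..2*r}" using WB_in[OF w] k by auto
  ultimately show ?thesis by auto
qed

lemma card_invs_sB:
  assumes w: "w \<in> WB r" and k: "k \<in> {1..r}" and up: "w k < w (k+1)"
  shows "card (invs r (w \<circ> sB r k)) = card (invs r w) + (if k = r then 1 else 2)"
proof (cases "k = r")
  case True
  thus ?thesis using card_invs_transpose[of w k r] permutes_inj[OF WB_permutes[OF w]] k up
    by (auto simp: sB_def)
next
  case False
  let ?t = "transpose k (k+1)" and ?u = "transpose (2*r-k) (2*r-k+1)"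
  have i: "inj w" "inj (w \<circ> ?t)" using permutes_inj[OF WB_permutes[OF w]] by (auto intro: inj_compose)
  have e: "w \<circ> sB r k = (w \<circ> ?t) \<circ> ?u" using False k by (auto simp: sB_def fun_eq_iff Suc_diff_le)
  have "(w \<circ> ?t) (2*r-k) = w (2*r-k)" "(w \<circ> ?t) (2*r-k+1) = w (2*r-k+1)"
    using False k by (auto simp: transpose_def)
  hence "(w \<circ> ?t) (2*r-k) < (w \<circ> ?t) (2*r-k+1)"
    using WB_ascent_mirror[OF w k] up k by (simp add: Suc_diff_le)
  thus ?thesis unfolding e
    using card_invs_transpose[OF i(2), of "2*r-k" r] card_invs_transpose[OF i(1), of k r] k False up
    by auto
qed

lemma neg_sB_less:
  assumes k: "k \<in> {1..<r}" shows "neg r (w \<circ> sB r k) = neg r w"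
proof -
  let ?t = "transpose k (k+1)"
  have e: "sB r k i = ?t i" "?t i \<in> {1..r}" if "i \<in> {1..r}" for i
  proof -
    have "i \<noteq> 2*r-k" "i \<noteq> 2*r+1-k" using that k by auto
    thus "sB r k i = ?t i" using k by (simp add: sB_apply transpose_def)
    show "?t i \<in> {1..r}" using that k by (auto simp: transpose_def)
  qed
  have "{i\<in>{1..r}. (w \<circ> sB r k) i > r} = ?t ` {i\<in>{1..r}. w i > r}"
  proof (intro equalityI subsetI)
    fix x assume "x \<in> {i\<in>{1..r}. (w \<circ> sB r k) i > r}"
    hence "?t x \<in> {i\<in>{1..r}. w i > r}" using e[of x] by simp
    thus "x \<in> ?t ` {i\<in>{1..r}. w i > r}" by (metis image_eqI transpose_involutory)
  next
    fix x assume "x \<in> ?t ` {i\<in>{1..r}. w i > r}"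
    then obtain y where y: "x = ?t y" "y \<in> {1..r}" "w y > r" by auto
    thus "x \<in> {i\<in>{1..r}. (w \<circ> sB r k) i > r}" using e(1)[of x] e(2)[of y] by simp
  qed
  thus ?thesis unfolding neg_def by (simp add: card_image)
qed

lemma WB_r:
  assumes w: "w \<in> WB r" and "r \<ge> 1"
  shows "w r + w (r+1) = 2*r+1" "w r < w (r+1) \<longleftrightarrow> w r \<le> r"
proof -
  have "w (r+1) = 2*r+1 - w r" using WB_mirror[OF w, of r] assms(2) by (simp add: Suc_diff_le mult_2)
  moreover have "w r \<in> {1..2*r}" using WB_in[OF w] assms(2) by auto
  ultimately show "w r + w (r+1) = 2*r+1" "w r < w (r+1) \<longleftrightarrow> w r \<le> r" by auto
qed

lemma neg_sB_r:
  assumes w: "w \<in> WB r" and "r \<ge> 1" and up: "w r < w (r+1)"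
  shows "neg r (w \<circ> sB r r) = Suc (neg r w)"
proof -
  have "{i\<in>{1..r}. (w \<circ> sB r r) i > r} = insert r {i\<in>{1..r}. w i > r}"
    using assms WB_r[OF w] by (auto simp: sB_apply split: if_splits)
  moreover have "r \<notin> {i\<in>{1..r}. w i > r}" using WB_r[OF w] assms by auto
  ultimately show ?thesis unfolding neg_def by simp
qed

lemma card_invs_inv:
  assumes "w \<in> WB r" shows "card (invs r (inv' w)) = card (invs r w)"
proof -
  have *: "card (invs r (inv' w)) \<le> card (invs r w)" if w: "w \<in> WB r" for w
  proof (rule card_inj_on_le[where f="\<lambda>(i,j). (inv' w j, inv' w i)"])
    show "inj_on (\<lambda>(i,j). (inv' w j, inv' w i)) (invs r (inv' w))"
      using WB_inj[OF WB_inv[OF w]] by (simp add: inj_on_def split_paired_all)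
    show "(\<lambda>(i,j). (inv' w j, inv' w i)) ` invs r (inv' w) \<subseteq> invs r w"
    proof clarify
      fix i j assume "(i,j) \<in> invs r (inv' w)"
      hence ij: "i \<in> {1..2*r}" "j \<in> {1..2*r}" "i < j" "inv' w j < inv' w i" by (auto simp: invs_def)
      have "inv' w i \<in> {1..2*r}" "inv' w j \<in> {1..2*r}" using WB_in[OF WB_inv[OF w]] ij(1,2) by blast+
      thus "(inv' w j, inv' w i) \<in> invs r w" using ij WB_inv_apply(2)[OF w, of i] WB_inv_apply(2)[OF w, of j]
        by (simp add: invs_def)
    qed
  qed (rule finite_invs)
  from *[OF assms] *[OF WB_inv[OF assms]] show ?thesis using assms by simp
qed

lemma neg_inv:
  assumes w: "w \<in> WB r" shows "neg r (inv' w) = neg r w"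
proof -
  have *: "inv' w (2*r+1-x) = 2*r+1 - inv' w x" if "x \<in> {1..2*r}" for x
    using WB_mirror[OF WB_inv[OF w] that] .
  have m: "w (2*r+1-x) = 2*r+1 - w x" if "x \<in> {1..2*r}" for x
    using WB_mirror[OF w that] .
  have i: "w x \<in> {1..2*r}" "inv' w x \<in> {1..2*r}" if "x \<in> {1..2*r}" for x
    using that WB_in[OF w] WB_in[OF WB_inv[OF w]] by auto
  have "bij_betw (\<lambda>x. 2*r+1 - inv' w x) {i\<in>{1..r}. inv' w i > r} {i\<in>{1..r}. w i > r}"
  proof (rule bij_betwI[of _ _ _ "\<lambda>x. 2*r+1 - w x"])
    show "(\<lambda>x. 2 * r + 1 - inv' w x) \<in> {i \<in> {1..r}. r < inv' w i} \<rightarrow> {i \<in> {1..r}. r < w i}"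
    proof
      fix x assume x: "x \<in> {i \<in> {1..r}. r < inv' w i}"
      have "inv' w x \<in> {1..2*r}" using i(2)[of x] x by auto
      moreover have "w (2*r+1 - inv' w x) = 2*r+1-x" using m[OF calculation] w by simp
      ultimately show "2 * r + 1 - inv' w x \<in> {i \<in> {1..r}. r < w i}" using x by auto
    qed
    show "(\<lambda>x. 2 * r + 1 - w x) \<in> {i \<in> {1..r}. r < w i} \<rightarrow> {i \<in> {1..r}. r < inv' w i}"
    proof
      fix x assume x: "x \<in> {i \<in> {1..r}. r < w i}"
      have "w x \<in> {1..2*r}" using i(1)[of x] x by auto
      moreover have "inv' w (2*r+1 - w x) = 2*r+1-x" using *[OF calculation] w by simp
      ultimately show "2 * r + 1 - w x \<in> {i \<in> {1..r}. r < inv' w i}" using x by auto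
    qed
    show "2 * r + 1 - w (2 * r + 1 - inv' w x) = x" if "x \<in> {i \<in> {1..r}. r < inv' w i}" for x
      using m[of "inv' w x"] i(2)[of x] that w by auto
    show "2 * r + 1 - inv' w (2 * r + 1 - w x) = x" if "x \<in> {i \<in> {1..r}. r < w i}" for x
      using *[of "w x"] i(1)[of x] that w by auto
  qed
  thus ?thesis unfolding neg_def by (rule bij_betw_same_card)
qed

lemma neg_le_invs:
  assumes w: "w \<in> WB r" shows "neg r w \<le> card (invs r w)"
  unfolding neg_def
proof (rule card_inj_on_le[where f="\<lambda>i. (i, 2*r+1-i)"])
  show "(\<lambda>i. (i, 2*r+1-i)) ` {i\<in>{1..r}. w i > r} \<subseteq> invs r w"
    using WB_mirror[OF w] by (auto simp: invs_def)
qed (auto intro: inj_onI finite_invs)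

definition lenB :: "nat \<Rightarrow> (nat \<Rightarrow> nat) \<Rightarrow> nat" where
  "lenB r w = (card (invs r w) + neg r w) div 2"

definition lenD :: "nat \<Rightarrow> (nat \<Rightarrow> nat) \<Rightarrow> nat" where
  "lenD r w = (card (invs r w) - neg r w) div 2"

lemma lenB_inv: "w \<in> WB r \<Longrightarrow> lenB r (inv' w) = lenB r w"
  by (simp add: lenB_def card_invs_inv neg_inv)

lemma lenD_inv: "w \<in> WB r \<Longrightarrow> lenD r (inv' w) = lenD r w"
  by (simp add: lenD_def card_invs_inv neg_inv)

lemma lenB_up:
  assumes "w \<in> WB r" "k \<in> {1..r}" "w k < w (k+1)"
  shows "lenB r (w \<circ> sB r k) = Suc (lenB r w)"
  using card_invs_sB[OF assms] neg_sB_r[OF assms(1)] neg_sB_less[of k r w] assms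
  by (cases "k = r") (auto simp: lenB_def)

lemma WB_neq: "w \<in> WB r \<Longrightarrow> w k \<noteq> w (k+1)"
  using WB_inj by force

lemma ascent_sB:
  assumes "w \<in> WB r" "k \<in> {1..r}"
  shows "(w \<circ> sB r k) k < (w \<circ> sB r k) (k+1) \<longleftrightarrow> \<not> w k < w (k+1)"
  using sB_simps(1,2)[OF assms(2)] WB_neq[OF assms(1), of k] by auto

lemma lenB_down:
  assumes "w \<in> WB r" "k \<in> {1..r}" "\<not> w k < w (k+1)"
  shows "lenB r w = Suc (lenB r (w \<circ> sB r k))"
  using lenB_up[OF WB_comp[OF assms(1) sB_WB[OF assms(2)]] assms(2)] ascent_sB[OF assms(1,2)] assms(3)
  by (simp only: sB_comp_sB_right[OF assms(2)] simp_thms)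

lemma lenD_up:
  assumes "w \<in> WB r" "k \<in> {1..<r}" "w k < w (k+1)"
  shows "lenD r (w \<circ> sB r k) = Suc (lenD r w)"
  using card_invs_sB[OF assms(1) _ assms(3)] neg_sB_less[of k r w] neg_le_invs[OF assms(1)] assms
  by (auto simp: lenD_def)

lemma lenD_down:
  assumes "w \<in> WB r" "k \<in> {1..<r}" "\<not> w k < w (k+1)"
  shows "lenD r w = Suc (lenD r (w \<circ> sB r k))"
  using lenD_up[of "w \<circ> sB r k" r k] WB_comp[OF assms(1) sB_WB, of k] ascent_sB[OF assms(1), of k] assms
  by (auto simp: sB_comp_sB_right)

text \<open>Multiplication by \<open>s\<^sub>r\<close> keeps the length of type D: the inversion that it adds or removes is a sign
  change.\<close>

lemma lenD_sB_r:
  assumes w: "w \<in> WB r" and r: "r \<ge> 1"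
  shows "lenD r (w \<circ> sB r r) = lenD r w"
proof -
  have *: "lenD r (v \<circ> sB r r) = lenD r v" if v: "v \<in> WB r" "v r < v (r+1)" for v
    using card_invs_sB[OF v(1), of r] neg_sB_r[OF v(1) r v(2)] r v(2) by (auto simp: lenD_def)
  show ?thesis
  proof (cases "w r < w (r+1)")
    case False
    have "w \<circ> sB r r \<in> WB r" using WB_comp[OF w sB_WB] r by simp
    moreover have "(w \<circ> sB r r) r < (w \<circ> sB r r) (r+1)" using ascent_sB[OF w, of r] False r by simp
    ultimately have "lenD r (w \<circ> sB r r \<circ> sB r r) = lenD r (w \<circ> sB r r)" by (rule *)
    thus ?thesis using sB_comp_sB_right[of r r w] r by simp
  qed (use * w in auto)
qed

lemma lenD_sB_r_left:
  assumes w: "w \<in> WB r" and r: "r \<ge> 1"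
  shows "lenD r (sB r r \<circ> w) = lenD r w"
proof -
  have "lenD r (sB r r \<circ> w) = lenD r (inv' (sB r r \<circ> w))"
    using lenD_inv[OF WB_comp[OF sB_WB w]] r by simp
  also have "inv' (sB r r \<circ> w) = inv' w \<circ> sB r r"
    using WB_inv_comp[OF sB_WB w] sB_inv r by simp
  also have "lenD r \<dots> = lenD r w" using lenD_sB_r[OF WB_inv[OF w] r] lenD_inv[OF w] by simp
  finally show ?thesis .
qed

text \<open>Ascents are symmetric under mirroring, so an element without descents is increasing on all of
  \<open>[1,2r]\<close>.\<close>

lemma WB_increasing_id:
  assumes w: "w \<in> WB r" and up: "\<And>k. k \<in> {1..r} \<Longrightarrow> w k < w (k+1)"
  shows "w = id"
proof -
  have up': "w k < w (k+1)" if k: "k \<in> {1..<2*r}" for k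
  proof (cases "k \<le> r")
    case False
    have "2*r - (2*r-k) = k" "2*r+1-(2*r-k) = k+1" "2*r-k \<in> {1..r}" using k False by auto
    thus ?thesis using WB_ascent_mirror[OF w, of "2*r-k"] up[of "2*r-k"] by simp
  qed (use up k in auto)
  have ge: "w x \<ge> x" if "x \<le> 2*r" for x
    using that
  proof (induction x)
    case (Suc x)
    show ?case
    proof (cases "x = 0")
      case True
      thus ?thesis using WB_in[OF w, of "Suc 0"] Suc by auto
    next
      case False
      thus ?thesis using up'[of x] Suc by auto
    qed
  qed simp
  have "w x = x" for x
  proof (cases "x \<in> {1..2*r}")
    case True
    have "w x \<ge> x" using ge True by auto
    moreover have "w (2*r+1-x) \<ge> 2*r+1-x" using True by (intro ge) auto
    ultimately show ?thesis using WB_mirror[OF w True] WB_in[OF w, of x] True by auto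
  next
    case False
    thus ?thesis using permutes_not_in[OF WB_permutes[OF w]] by auto
  qed
  thus ?thesis by (auto simp: fun_eq_iff)
qed

text \<open>The bound on the increase makes the function a lower bound for the length of every word, and following
  descents produces a word of that length.\<close>

lemma wlen_eqI:
  fixes f :: "(nat \<Rightarrow> nat) \<Rightarrow> nat"
  assumes id: "id \<in> W" "f id = 0"
    and closed: "\<And>w i. w \<in> W \<Longrightarrow> i \<in> {1..r} \<Longrightarrow> w \<circ> s i \<in> W"
    and step: "\<And>w i. w \<in> W \<Longrightarrow> i \<in> {1..r} \<Longrightarrow> f (w \<circ> s i) \<le> Suc (f w)"
    and desc: "\<And>w. w \<in> W \<Longrightarrow> w \<noteq> id \<Longrightarrow> \<exists>i\<in>{1..r}. f w = Suc (f (w \<circ> s i))"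
    and invol: "\<And>i. i \<in> {1..r} \<Longrightarrow> s i \<circ> s i = id"
    and w: "w \<in> W"
  shows "wlen r s w = f w" "\<exists>ws. reduced_expr r s w ws"
proof -
  have wp: "word_prod s (ws @ [i]) = word_prod s ws \<circ> s i" for ws i
    by (induction ws) (auto simp: word_prod_def)
  have ub: "\<exists>ws. is_expr r s w ws \<and> length ws = f w" using w
  proof (induction "f w" arbitrary: w)
    case 0
    hence "w = id" using desc by fastforce
    thus ?case using id by (intro exI[of _ "[]"]) (simp add: is_expr_def word_prod_def id_def)
  next
    case (Suc m)
    have "w \<noteq> id" using Suc id by auto
    then obtain i where i: "i \<in> {1..r}" "f w = Suc (f (w \<circ> s i))" using desc Suc by blast
    then obtain ws where ws: "is_expr r s (w \<circ> s i) ws" "length ws = f (w \<circ> s i)"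
      using Suc.hyps(1)[of "w \<circ> s i"] Suc.hyps(2) closed[OF Suc.prems i(1)] by auto
    have "w \<circ> s i \<circ> s i = w" using invol[OF i(1)] by (simp add: o_assoc[symmetric])
    hence "is_expr r s w (ws @ [i])" using ws i by (auto simp: is_expr_def wp)
    thus ?case using ws i by (intro exI[of _ "ws @ [i]"]) auto
  qed
  have lb: "word_prod s ws \<in> W \<and> f (word_prod s ws) \<le> length ws" if "set ws \<subseteq> {1..r}" for ws
    using that
  proof (induction ws rule: rev_induct)
    case Nil thus ?case using id by (simp add: word_prod_def id_def)
  next
    case (snoc i ws)
    hence "word_prod s ws \<in> W" "f (word_prod s ws) \<le> length ws" "i \<in> {1..r}" by auto
    hence "word_prod s ws \<circ> s i \<in> W" "f (word_prod s ws \<circ> s i) \<le> Suc (length ws)"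
      using closed[of "word_prod s ws" i] step[of "word_prod s ws" i] by linarith+
    thus ?case unfolding wp length_append_singleton by (rule conjI)
  qed
  show "wlen r s w = f w" unfolding wlen_def
  proof (rule Least_equality)
    show "f w \<le> k" if "\<exists>ws. is_expr r s w ws \<and> length ws = k" for k
      using lb that by (auto simp: is_expr_def)
  qed (rule ub)
  thus "\<exists>ws. reduced_expr r s w ws" using ub by (auto simp: reduced_expr_def)
qed

lemma lenB_le:
  assumes "w \<in> WB r" "k \<in> {1..r}" shows "lenB r (w \<circ> sB r k) \<le> Suc (lenB r w)"
  using lenB_up[OF assms] lenB_down[OF assms] by (cases "w k < w (k+1)") auto

lemma invs_id: "invs r id = {}" and neg_id: "neg r id = 0"
  by (auto simp: invs_def neg_def)

lemma wlenB:
  assumes "w \<in> WB r"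
  shows "wlen r (sB r) w = lenB r w" "\<exists>is. reduced_expr r (sB r) w is"
proof -
  note * = WB_id _ WB_comp[OF _ sB_WB] lenB_le _ sB_comp_sB assms
  have "\<exists>i\<in>{1..r}. lenB r w = Suc (lenB r (w \<circ> sB r i))" if "w \<in> WB r" "w \<noteq> id" for w
    using WB_increasing_id[OF that(1)] that lenB_down[OF that(1)] by blast
  moreover have "lenB r id = 0" by (simp add: lenB_def invs_id neg_id)
  ultimately show "wlen r (sB r) w = lenB r w" "\<exists>is. reduced_expr r (sB r) w is"
    using wlen_eqI[of "WB r" "lenB r" r "sB r", OF *] by blast+
qed

text \<open>Among the generators only \<open>s\<^sub>r\<close> changes the parity of the number of sign changes, and it does so at
  every element; hence this parity is a homomorphism.\<close>

lemma neg_parity: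
  assumes "u \<in> WB r" "v \<in> WB r" "r \<ge> 1"
  shows "even (neg r (u \<circ> v)) \<longleftrightarrow> (even (neg r u) \<longleftrightarrow> even (neg r v))"
proof -
  have s: "even (neg r (w \<circ> sB r k)) \<longleftrightarrow> (even (neg r w) \<longleftrightarrow> k \<noteq> r)"
    if w: "w \<in> WB r" and k: "k \<in> {1..r}" for w k
  proof (cases "k = r")
    case True
    have "w \<circ> sB r r \<in> WB r" using WB_comp[OF w sB_WB] assms by simp
    thus ?thesis using neg_sB_r[OF w assms(3)] neg_sB_r[of "w \<circ> sB r r" r] ascent_sB[OF w k] True assms(3)
      sB_comp_sB_right[of r r w]
      by (cases "w r < w (r+1)") auto
  qed (use neg_sB_less[of k r w] k in auto)
  show ?thesis using assms(2)
  proof (induction "lenB r v" arbitrary: v rule: less_induct)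
    case less
    show ?case
    proof (cases "v = id")
      case False
      then obtain k where k: "k \<in> {1..r}" "\<not> v k < v (k+1)"
        using WB_increasing_id[OF less.prems] by blast
      define v' where "v' = v \<circ> sB r k"
      have v': "v' \<in> WB r" "lenB r v' < lenB r v"
        using lenB_down[OF less.prems k] WB_comp[OF less.prems sB_WB[OF k(1)]] by (auto simp: v'_def)
      have v: "v = v' \<circ> sB r k" unfolding v'_def by (rule sB_comp_sB_right[OF k(1), symmetric])
      have "u \<circ> v = (u \<circ> v') \<circ> sB r k" by (simp add: v o_assoc)
      thus ?thesis using s[OF v'(1) k(1)] s[OF WB_comp[OF assms(1) v'(1)] k(1)] less.hyps[OF v'(2,1)] v
        by auto
    qed (simp add: neg_id)
  qed
qed

lemma WD_iff: "w \<in> WD r \<longleftrightarrow> w \<in> WB r \<and> even (neg r w)"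
  by (simp add: WD_def neg_def)

lemma neg_sB:
  assumes "k \<in> {1..r}" shows "even (neg r (sB r k)) \<longleftrightarrow> k \<noteq> r"
proof (cases "k = r")
  case True
  thus ?thesis using neg_sB_r[OF WB_id, of r] neg_id[of r] assms by simp
qed (use neg_sB_less[of k r id] neg_id[of r] assms in auto)

lemma WD_comp: "r \<ge> 1 \<Longrightarrow> u \<in> WD r \<Longrightarrow> v \<in> WD r \<Longrightarrow> u \<circ> v \<in> WD r"
  by (simp add: WD_iff WB_comp neg_parity)

lemma WD_id: "id \<in> WD r"
  by (simp add: WD_iff WB_id neg_id)

lemma sD_less: "k \<in> {1..<r} \<Longrightarrow> sD r k = sB r k" and sD_r: "sD r r = sB r r \<circ> sB r (r-1) \<circ> sB r r"
  by (auto simp: sD_def)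

lemma sD_WD:
  assumes "k \<in> {1..r}" "r \<ge> 2" shows "sD r k \<in> WD r"
  using assms neg_sB[of k r] neg_sB[of r r] neg_sB[of "r-1" r]
  by (cases "k = r") (auto simp: sD_def WD_iff sB_WB WB_comp neg_parity)

text \<open>For type D, the last generator exchanges the roles of \<open>r\<close> and \<open>r+1\<close> in the last generator of
  the symmetric group.\<close>

lemma lenD_sD_r:
  assumes w: "w \<in> WB r" and r: "r \<ge> 2"
  shows "w (r-1) < w (r+1) \<Longrightarrow> lenD r (w \<circ> sD r r) = Suc (lenD r w)"
    "\<not> w (r-1) < w (r+1) \<Longrightarrow> lenD r w = Suc (lenD r (w \<circ> sD r r))"
proof -
  let ?v = "w \<circ> sB r r"
  have r': "r - 1 + 1 = r" "r \<in> {1..r}" "r - 1 \<in> {1..<r}" "r - 1 \<in> {1..r}" "r \<ge> 1" using r by auto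
  have v: "?v \<in> WB r" using WB_comp[OF w sB_WB[OF r'(2)]] .
  have l: "lenD r ?v = lenD r w" using lenD_sB_r[OF w] r by simp
  have l': "lenD r (w \<circ> sD r r) = lenD r (?v \<circ> sB r (r-1))"
    using lenD_sB_r[OF WB_comp[OF v sB_WB[OF r'(4)]] r'(5)] by (simp add: sD_r o_assoc)
  have "r - 1 \<noteq> r" "r - 1 \<noteq> r + 1" using r by auto
  hence "?v (r-1) = w (r-1)" using sB_apply[OF r'(2), of "r-1"] by (simp del: One_nat_def)
  moreover have "?v (r-1+1) = w (r+1)" using r'(2) sB_simps(1)[OF r'(2)] unfolding r'(1) by simp
  ultimately show "w (r-1) < w (r+1) \<Longrightarrow> lenD r (w \<circ> sD r r) = Suc (lenD r w)"
    "\<not> w (r-1) < w (r+1) \<Longrightarrow> lenD r w = Suc (lenD r (w \<circ> sD r r))"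
    using lenD_up[OF v r'(3)] lenD_down[OF v r'(3)] unfolding l l' by auto
qed

lemma wlenD:
  assumes w: "w \<in> WD r" and r: "r \<ge> 2"
  shows "wlen r (sD r) w = lenD r w"
proof (rule wlen_eqI[of "WD r" "lenD r" r "sD r"])
  fix w i assume w: "w \<in> WD r" and i: "i \<in> {1..r}"
  have w': "w \<in> WB r" using w WD_iff by auto
  show "w \<circ> sD r i \<in> WD r" using WD_comp[OF _ w sD_WD] i r by auto
  show "lenD r (w \<circ> sD r i) \<le> Suc (lenD r w)"
  proof (cases "i = r")
    case True
    thus ?thesis using lenD_sD_r[OF w' r] by (cases "w (r-1) < w (r+1)") auto
  next
    case False
    thus ?thesis using lenD_up[OF w', of i] lenD_down[OF w', of i] i
      by (cases "w i < w (i+1)") (auto simp: sD_less)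
  qed
next
  fix w assume w: "w \<in> WD r" and ne: "w \<noteq> id"
  have w': "w \<in> WB r" using w WD_iff by auto
  show "\<exists>i\<in>{1..r}. lenD r w = Suc (lenD r (w \<circ> sD r i))"
  proof (rule ccontr)
    assume n: "\<not> ?thesis"
    have up: "w i < w (i+1)" if "i \<in> {1..<r}" for i
    proof (rule ccontr)
      assume "\<not> w i < w (i+1)"
      hence "lenD r w = Suc (lenD r (w \<circ> sD r i))" using lenD_down[OF w' that] sD_less[OF that] by simp
      with n that show False by auto
    qed
    have up_r: "w (r-1) < w (r+1)"
      using lenD_sD_r(2)[OF w' r] n r by fastforce
    \<comment> \<open>If also \<open>w r < w (r+1)\<close>, then \<open>w\<close> is trivial. Otherwise \<open>w s\<^sub>r\<close> is increasing, so \<open>w = s\<^sub>r\<close>,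
      which is not in the group of type D.\<close>
    show False
    proof (cases "w r < w (r+1)")
      case True
      hence "w k < w (k+1)" if "k \<in> {1..r}" for k using up[of k] that by (cases "k = r") auto
      thus False using WB_increasing_id[OF w'] ne by blast
    next
      case False
      define v where "v = w \<circ> sB r r"
      have r1: "r \<in> {1..r}" using r by auto
      have v: "v \<in> WB r" using WB_comp[OF w' sB_WB[OF r1]] by (simp add: v_def)
      have lt: "v k = w k" if "k < r" for k using that r by (simp add: v_def sB_apply)
      have vr: "v r = w (r+1)" using sB_simps(1)[OF r1] by (simp add: v_def)
      have "v k < v (k+1)" if k: "k \<in> {1..r}" for k
      proof -
        consider "k = r" | "k = r-1" "k < r" | "k + 1 < r" using k by force
        thus ?thesis
        proof cases
          case 1 thus ?thesis using ascent_sB[OF w' r1] False by (simp add: v_def)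
        next
          case 2
          hence "k + 1 = r" by simp
          thus ?thesis using lt[of k] vr up_r 2 by simp
        next
          case 3 thus ?thesis using lt up[of k] k by auto
        qed
      qed
      hence "v = id" using WB_increasing_id[OF v] by blast
      hence "w = sB r r" using sB_comp_sB_right[OF r1, of w] by (simp add: v_def)
      thus False using w neg_sB[OF r1] by (simp add: WD_iff)
    qed
  qed
next
  fix i assume i: "i \<in> {1..r}"
  have "r \<in> {1..r}" "r-1 \<in> {1..r}" using r by auto
  thus "sD r i \<circ> sD r i = id" using sB_comp_sB[OF i]
    by (auto simp: sD_def sB_invol fun_eq_iff)
qed (use w in \<open>auto simp: WD_id lenD_def invs_id\<close>)

section \<open>Congruences in the free algebra\<close>

text \<open>All computations take place in the free algebra, whose sums and products are those of a type
  class, up to congruence modulo the ideal of the Hecke relations. Membership in the algebra on the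
  letters \<open>1,\<dots>,r\<close> is part of the congruence, which makes it compatible with products.\<close>

definition FA :: "nat \<Rightarrow> falg set" where
  "FA r = carrier (free_alg r)"

definition heq :: "nat \<Rightarrow> falg \<Rightarrow> falg \<Rightarrow> bool" where
  "heq r x y \<longleftrightarrow> x \<in> FA r \<and> y \<in> FA r \<and> x - y \<in> hecke_ideal r"

lemma FA_iff: "f \<in> FA r \<longleftrightarrow> (\<forall>w\<in>Poly_Mapping.keys f. set (letters w) \<subseteq> {1..r})"
  by (simp add: FA_def free_alg_def)

lemma FA_zero: "0 \<in> FA r" and FA_one: "1 \<in> FA r"
  by (auto simp: FA_iff zero_fword_def)

lemma FA_add: "x \<in> FA r \<Longrightarrow> y \<in> FA r \<Longrightarrow> x + y \<in> FA r"
  using Poly_Mapping.keys_add[of x y] by (auto simp: FA_iff)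

lemma FA_uminus: "x \<in> FA r \<Longrightarrow> - x \<in> FA r"
  by (simp add: FA_iff)

lemma FA_diff: "x \<in> FA r \<Longrightarrow> y \<in> FA r \<Longrightarrow> x - y \<in> FA r"
  using FA_add[OF _ FA_uminus] by fastforce

lemma FA_mult: "x \<in> FA r \<Longrightarrow> y \<in> FA r \<Longrightarrow> x * y \<in> FA r"
  using Poly_Mapping.keys_mult[of x y] by (fastforce simp: FA_iff plus_fword_def)

lemma FA_sum: "(\<And>i. i \<in> I \<Longrightarrow> f i \<in> FA r) \<Longrightarrow> sum f I \<in> FA r"
  by (induction I rule: infinite_finite_induct) (auto simp: FA_zero FA_add)

lemma FA_gen: "i \<in> {1..r} \<Longrightarrow> gen i \<in> FA r"
  by (auto simp: FA_iff gen_def)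

lemma FA_scal: "scal a \<in> FA r"
  by (auto simp: FA_iff scal_def zero_fword_def)

lemmas FA_intros = FA_zero FA_one FA_add FA_uminus FA_diff FA_mult FA_sum FA_gen FA_scal

lemma scal_add: "scal (a + b) = scal a + scal b"
  by (simp add: scal_def single_add)

lemma scal_mult: "scal (a * b) = scal a * scal b"
  by (simp add: scal_def mult_single)

lemma scal_one: "scal 1 = 1"
  by (simp add: scal_def)

lemma scal_zero: "scal 0 = 0"
  by (simp add: scal_def)

lemma scal_minus: "scal (a - b) = scal a - scal b"
  by (simp add: scal_def single_diff)

lemma scal_sum: "scal (sum f I) = (\<Sum>i\<in>I. scal (f i))"
  by (induction I rule: infinite_finite_induct) (auto simp: scal_zero scal_add)

lemma scal_central: "scal a * x = x * scal a"
proof -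
  have "x = (\<Sum>k\<in>Poly_Mapping.keys x. Poly_Mapping.single k (Poly_Mapping.lookup x k))"
    by (rule poly_mapping_eqI) (simp add: lookup_sum lookup_single when_def in_keys_iff)
  also have "scal a * \<dots> = \<dots> * scal a"
    by (simp add: scal_def sum_distrib_left sum_distrib_right mult_single mult.commute)
  finally show ?thesis by simp
qed

lemma free_alg_ops:
  "carrier (free_alg r) = FA r" "x \<oplus>\<^bsub>free_alg r\<^esub> y = x + y" "x \<otimes>\<^bsub>free_alg r\<^esub> y = x * y"
  "\<zero>\<^bsub>free_alg r\<^esub> = 0" "\<one>\<^bsub>free_alg r\<^esub> = 1"
  by (simp add: FA_def) (simp_all add: free_alg_def)

lemma ring_free_alg: "ring (free_alg r)"
proof (rule ringI)
  show "abelian_group (free_alg r)"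
  proof (rule abelian_groupI)
    fix x assume "x \<in> carrier (free_alg r)"
    thus "\<exists>y\<in>carrier (free_alg r). y \<oplus>\<^bsub>free_alg r\<^esub> x = \<zero>\<^bsub>free_alg r\<^esub>"
      by (intro bexI[of _ "- x"]) (simp_all add: free_alg_ops FA_uminus)
  qed (simp_all add: free_alg_ops FA_add FA_zero algebra_simps)
  show "monoid (free_alg r)"
    by (rule monoidI) (simp_all add: free_alg_ops FA_mult FA_one algebra_simps)
qed (simp_all add: free_alg_ops algebra_simps)

lemma hecke_rels_carrier: "r \<ge> 2 \<Longrightarrow> hecke_rels r \<subseteq> FA r"
  unfolding hecke_rels_def by (auto intro!: FA_intros)

lemma ideal_hecke: "r \<ge> 2 \<Longrightarrow> ideal (hecke_ideal r) (free_alg r)"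
  unfolding hecke_ideal_def using hecke_rels_carrier
  by (intro ring.genideal_ideal[OF ring_free_alg]) (auto simp: FA_def)

lemma hecke_ideal_simps:
  assumes r: "r \<ge> 2"
  shows "0 \<in> hecke_ideal r"
    "x \<in> hecke_ideal r \<Longrightarrow> y \<in> hecke_ideal r \<Longrightarrow> x + y \<in> hecke_ideal r"
    "x \<in> hecke_ideal r \<Longrightarrow> a \<in> FA r \<Longrightarrow> a * x \<in> hecke_ideal r"
    "x \<in> hecke_ideal r \<Longrightarrow> a \<in> FA r \<Longrightarrow> x * a \<in> hecke_ideal r"
    "x \<in> hecke_ideal r \<Longrightarrow> - x \<in> hecke_ideal r"
    "x \<in> hecke_ideal r \<Longrightarrow> x \<in> FA r"
    "x \<in> hecke_rels r \<Longrightarrow> x \<in> hecke_ideal r"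
proof -
  interpret ideal "hecke_ideal r" "free_alg r" using ideal_hecke[OF r] .
  note s = free_alg_ops
  show "0 \<in> hecke_ideal r" using additive_subgroup.zero_closed[OF additive_subgroup_axioms] by (simp add: s)
  show "x \<in> hecke_ideal r \<Longrightarrow> y \<in> hecke_ideal r \<Longrightarrow> x + y \<in> hecke_ideal r"
    using additive_subgroup.a_closed[OF additive_subgroup_axioms, of x y] by (simp add: s)
  show m: "x \<in> hecke_ideal r \<Longrightarrow> a \<in> FA r \<Longrightarrow> a * x \<in> hecke_ideal r" for a
    using I_l_closed[of x a] by (simp add: s)
  show "x \<in> hecke_ideal r \<Longrightarrow> a \<in> FA r \<Longrightarrow> x * a \<in> hecke_ideal r"
    using I_r_closed[of x a] by (simp add: s)
  show "x \<in> hecke_ideal r \<Longrightarrow> - x \<in> hecke_ideal r"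
    using m[of "-1"] FA_uminus[OF FA_one, of r] by simp
  show "x \<in> hecke_ideal r \<Longrightarrow> x \<in> FA r" using a_Hcarr by (simp add: FA_def)
  show "x \<in> hecke_rels r \<Longrightarrow> x \<in> hecke_ideal r"
    unfolding hecke_ideal_def using ring.genideal_self[OF ring_free_alg] hecke_rels_carrier[OF r]
    by (auto simp: FA_def)
qed

lemma heq_refl: "r \<ge> 2 \<Longrightarrow> x \<in> FA r \<Longrightarrow> heq r x x"
  by (simp add: heq_def hecke_ideal_simps)

lemma heq_sym: "r \<ge> 2 \<Longrightarrow> heq r x y \<Longrightarrow> heq r y x"
  using hecke_ideal_simps(5)[of r "x - y"] by (simp add: heq_def)

lemma heq_trans:
  assumes "r \<ge> 2" "heq r x y" "heq r y z" shows "heq r x z"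
  using hecke_ideal_simps(2)[OF assms(1), of "x - y" "y - z"] assms by (simp add: heq_def)

lemma heq_add:
  assumes "r \<ge> 2" "heq r x x'" "heq r y y'" shows "heq r (x + y) (x' + y')"
  using hecke_ideal_simps(2)[OF assms(1), of "x - x'" "y - y'"] assms
  by (simp add: heq_def FA_add algebra_simps)

lemma heq_mult:
  assumes r: "r \<ge> 2" and x: "heq r x x'" and y: "heq r y y'" shows "heq r (x * y) (x' * y')"
proof -
  have "x * y - x' * y' = (x - x') * y + x' * (y - y')" by (simp add: algebra_simps)
  also have "\<dots> \<in> hecke_ideal r"
    using x y by (intro hecke_ideal_simps(2-4)[OF r]) (auto simp: heq_def)
  finally show ?thesis using x y by (simp add: heq_def FA_mult)
qed

lemma heq_mult_left: "r \<ge> 2 \<Longrightarrow> a \<in> FA r \<Longrightarrow> heq r x y \<Longrightarrow> heq r (a * x) (a * y)"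
  and heq_mult_right: "r \<ge> 2 \<Longrightarrow> a \<in> FA r \<Longrightarrow> heq r x y \<Longrightarrow> heq r (x * a) (y * a)"
  by (auto intro: heq_mult heq_refl)

lemma heq_sum:
  assumes "r \<ge> 2" "\<And>i. i \<in> I \<Longrightarrow> heq r (f i) (g i)" shows "heq r (sum f I) (sum g I)"
  using assms(2)
  by (induction I rule: infinite_finite_induct) (auto intro: heq_add assms(1) heq_refl FA_zero)

lemma heq_FA: "heq r x y \<Longrightarrow> x \<in> FA r" "heq r x y \<Longrightarrow> y \<in> FA r"
  by (auto simp: heq_def)

lemma heq_rel: "r \<ge> 2 \<Longrightarrow> x - y \<in> hecke_rels r \<Longrightarrow> x \<in> FA r \<Longrightarrow> y \<in> FA r \<Longrightarrow> heq r x y"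
  by (simp add: heq_def hecke_ideal_simps)

lemma heq_commute:
  assumes "r \<ge> 2" "i \<in> {1..r}" "j \<in> {1..r}" "i + 2 \<le> j"
  shows "heq r (gen j * gen i) (gen i * gen j)"
proof (rule heq_rel)
  have "\<bar>int j - int i\<bar> \<ge> 2" using assms by auto
  thus "gen j * gen i - gen i * gen j \<in> hecke_rels r"
    unfolding hecke_rels_def using assms by blast
qed (use assms in \<open>auto intro!: FA_intros\<close>)

lemma heq_braid:
  assumes "r \<ge> 2" "1 \<le> j" "j < r - 1"
  shows "heq r (gen j * gen (j+1) * gen j) (gen (j+1) * gen j * gen (j+1))"
proof (rule heq_rel)
  show "gen j * gen (j+1) * gen j - gen (j+1) * gen j * gen (j+1) \<in> hecke_rels r"
    unfolding hecke_rels_def using assms by blast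
qed (use assms in \<open>auto intro!: FA_intros\<close>)

lemma heq_braid4:
  assumes "r \<ge> 2"
  shows "heq r (gen (r-1) * gen r * gen (r-1) * gen r) (gen r * gen (r-1) * gen r * gen (r-1))"
proof (rule heq_rel)
  show "gen (r-1) * gen r * gen (r-1) * gen r - gen r * gen (r-1) * gen r * gen (r-1) \<in> hecke_rels r"
    unfolding hecke_rels_def by blast
qed (use assms in \<open>auto intro!: FA_intros\<close>)

lemma heq_quadratic:
  assumes "r \<ge> 2" "i \<in> {1..<r}"
  shows "heq r (gen i * gen i) (scal (qvar - 1) * gen i + scal qvar)"
proof (rule heq_rel)
  have "1 \<le> i" "i < r" using assms by auto
  thus "gen i * gen i - (scal (qvar - 1) * gen i + scal qvar) \<in> hecke_rels r"
    unfolding hecke_rels_def by blast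
qed (use assms in \<open>auto intro!: FA_intros\<close>)

lemma heq_r:
  assumes "r \<ge> 2"
  shows "heq r (gen r * gen r) 1"
proof (rule heq_rel)
  show "gen r * gen r - 1 \<in> hecke_rels r"
    unfolding hecke_rels_def by blast
qed (use assms in \<open>auto intro!: FA_intros\<close>)

section \<open>The Hecke algebra as a ring\<close>

lemma cls_image: "cls r x = (\<lambda>h. h + x) ` hecke_ideal r"
  by (auto simp: cls_def a_r_coset_def r_coset_def free_alg_def)

lemma cls_eq_iff:
  assumes r: "r \<ge> 2" and "x \<in> FA r" "y \<in> FA r"
  shows "cls r x = cls r y \<longleftrightarrow> heq r x y"
proof
  assume "cls r x = cls r y"
  moreover have "x \<in> cls r x" unfolding cls_image using hecke_ideal_simps(1)[OF r] by force
  ultimately show "heq r x y" using assms by (auto simp: cls_image heq_def)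
next
  assume h: "heq r x y"
  have *: "cls r x \<subseteq> cls r y" if "heq r x y" for x y
  proof
    fix z assume "z \<in> cls r x"
    then obtain h where "h \<in> hecke_ideal r" "z = h + x" by (auto simp: cls_image)
    moreover have "h + (x - y) \<in> hecke_ideal r"
      using hecke_ideal_simps(2)[OF r] calculation that by (auto simp: heq_def)
    ultimately show "z \<in> cls r y" unfolding cls_image by (intro image_eqI[of _ _ "h + (x - y)"]) auto
  qed
  show "cls r x = cls r y" using *[OF h] *[OF heq_sym[OF r h]] by blast
qed

lemma hecke_carrier: "carrier (hecke r) = cls r ` FA r"
  by (auto simp: hecke_def FactRing_def A_RCOSETS_def RCOSETS_def cls_def FA_def a_r_coset_def)

lemma hecke_add:
  assumes r: "r \<ge> 2" and "x \<in> FA r" "y \<in> FA r"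
  shows "cls r x \<oplus>\<^bsub>hecke r\<^esub> cls r y = cls r (x + y)"
  using abelian_subgroup.a_rcos_sum[OF abelian_subgroupI3[OF ideal.axioms(1)[OF ideal_hecke[OF r]] ring.is_abelian_group[OF ring_free_alg]], of x y] assms
  by (simp add: hecke_def Let_def FactRing_def cls_def free_alg_ops)

lemma hecke_mult:
  assumes r: "r \<ge> 2" and "x \<in> FA r" "y \<in> FA r"
  shows "cls r x \<otimes>\<^bsub>hecke r\<^esub> cls r y = cls r (x * y)"
  using ideal.rcoset_mult_add[OF ideal_hecke[OF r], of x y] assms
  by (simp add: hecke_def Let_def FactRing_def cls_def free_alg_ops)

lemma hecke_one: "\<one>\<^bsub>hecke r\<^esub> = cls r 1"
  by (simp add: hecke_def Let_def FactRing_def cls_def free_alg_ops)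

lemma hecke_zero: "\<zero>\<^bsub>hecke r\<^esub> = cls r 0"
  by (simp add: hecke_def Let_def FactRing_def cls_image)

lemma hecke_smult:
  assumes "r \<ge> 2" "x \<in> FA r"
  shows "a \<odot>\<^bsub>hecke r\<^esub> cls r x = cls r (scal a * x)"
proof -
  have "a \<odot>\<^bsub>hecke r\<^esub> X = cls r (scal a) \<otimes>\<^bsub>hecke r\<^esub> X" for X
    by (simp add: hecke_def Let_def)
  thus ?thesis using hecke_mult[OF assms(1) FA_scal assms(2)] by simp
qed

lemma ring_hecke:
  assumes r: "r \<ge> 2" shows "ring (hecke r)"
proof (rule ringI)
  note s = hecke_carrier hecke_add[OF r] hecke_mult[OF r] hecke_zero hecke_one FA_add FA_mult FA_zero FA_one
  show "abelian_group (hecke r)"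
  proof (rule abelian_groupI)
    fix x assume "x \<in> carrier (hecke r)"
    then obtain a where "a \<in> FA r" "x = cls r a" by (auto simp: s)
    thus "\<exists>y\<in>carrier (hecke r). y \<oplus>\<^bsub>hecke r\<^esub> x = \<zero>\<^bsub>hecke r\<^esub>"
      using FA_uminus[of a r] by (intro bexI[of _ "cls r (- a)"]) (auto simp: s)
  qed (auto simp: s algebra_simps)
  show "monoid (hecke r)" by (rule monoidI) (auto simp: s algebra_simps)
qed (auto simp: hecke_carrier hecke_add[OF r] hecke_mult[OF r] FA_add FA_mult algebra_simps)

lemma hecke_finsum:
  assumes r: "r \<ge> 2" and f: "\<And>i. i \<in> I \<Longrightarrow> f i \<in> FA r" and "finite I"
  shows "(\<Oplus>\<^bsub>hecke r\<^esub>i\<in>I. cls r (f i)) = cls r (sum f I)"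
proof -
  interpret ring "hecke r" by (rule ring_hecke[OF r])
  show ?thesis using \<open>finite I\<close> f
    by (induction I) (auto simp: hecke_zero hecke_add[OF r] hecke_carrier FA_sum)
qed

section \<open>Matsumoto's theorem and multiplication of basis elements\<close>

lemmas invs_neg_id [simp] = invs_id invs_id[unfolded id_def] neg_id neg_id[unfolded id_def]

lemma word_prod_Nil: "word_prod s [] = id" and word_prod_Cons: "word_prod s (i # ws) = s i \<circ> word_prod s ws"
  by (simp_all add: word_prod_def)

lemma word_prod_append: "word_prod s (us @ vs) = word_prod s us \<circ> word_prod s vs"
  by (induction us) (simp_all add: word_prod_Nil word_prod_Cons o_assoc)

lemma word_prod_snoc: "word_prod s (ws @ [i]) = word_prod s ws \<circ> s i"
  by (simp only: word_prod_append word_prod_Cons word_prod_Nil comp_id)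

definition gw :: "nat list \<Rightarrow> falg" where
  "gw ws = prod_list (map gen ws)"

lemma gw_append: "gw (us @ vs) = gw us * gw vs" and gw_Cons: "gw (i # us) = gen i * gw us" and gw_Nil: "gw [] = 1"
  by (simp_all add: gw_def)

lemma gw_FA: "set ws \<subseteq> {1..r} \<Longrightarrow> gw ws \<in> FA r"
  by (induction ws) (auto simp: gw_Nil gw_Cons intro!: FA_intros)

lemma word_prod_WB: "set ws \<subseteq> {1..r} \<Longrightarrow> word_prod (sB r) ws \<in> WB r"
  by (induction ws) (simp_all add: word_prod_Nil word_prod_Cons WB_id WB_comp sB_WB)

lemma lenB_word_le: "set ws \<subseteq> {1..r} \<Longrightarrow> lenB r (word_prod (sB r) ws) \<le> length ws"
proof (induction ws rule: rev_induct)
  case Nil thus ?case by (simp add: word_prod_Nil lenB_def invs_id neg_id)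
next
  case (snoc i ws)
  hence s: "set ws \<subseteq> {1..r}" "i \<in> {1..r}" by auto
  show ?case unfolding word_prod_snoc length_append_singleton
    using snoc.IH[OF s(1)] lenB_le[OF word_prod_WB[OF s(1)] s(2)] by linarith
qed

lemma WB_eqI:
  assumes u: "u \<in> WB r" and v: "v \<in> WB r" and e: "\<And>x. x \<in> {1..r} \<Longrightarrow> u x = v x"
  shows "u = v"
proof
  fix x
  consider "x \<in> {1..r}" | "x \<in> {r+1..2*r}" | "x \<notin> {1..2*r}" by fastforce
  thus "u x = v x"
  proof cases
    case 2
    hence x: "2*r+1-x \<in> {1..r}" "2*r+1-x \<in> {1..2*r}" "2*r+1-(2*r+1-x) = x" by auto
    show ?thesis using WB_mirror[OF u x(2)] WB_mirror[OF v x(2)] e[OF x(1)] unfolding x(3) by simp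
  next
    case 3
    thus ?thesis using permutes_not_in[OF WB_permutes[OF u]] permutes_not_in[OF WB_permutes[OF v]] by auto
  qed (use e in auto)
qed

lemma sB_half: "k < r \<Longrightarrow> 1 \<le> k \<Longrightarrow> x \<le> r \<Longrightarrow> sB r k x = transpose k (k+1) x"
  using sB_apply[of k r x] by (auto simp: transpose_def)

text \<open>Each rank two parabolic subgroup contributes a braid word: if \<open>w\<close> has both descents \<open>i\<close> and
  \<open>j\<close>, then the longest element of the dihedral group they generate is a right factor of \<open>w\<close>, and the
  lengths add.\<close>

lemma braid_factor:
  assumes r: "r \<ge> 2" and w: "w \<in> WB r" and ij: "i \<in> {1..r}" "j \<in> {1..r}" "i < j"
    and d: "\<not> w i < w (i+1)" "\<not> w j < w (j+1)"
  shows "\<exists>p q v. set p \<subseteq> {1..r} \<and> set q \<subseteq> {1..r} \<and> length p = length q \<and> v \<in> WB r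
    \<and> w = v \<circ> word_prod (sB r) (p @ [i]) \<and> w = v \<circ> word_prod (sB r) (q @ [j])
    \<and> heq r (gw (p @ [i])) (gw (q @ [j])) \<and> lenB r w = lenB r v + length p + 1"
proof -
  have di: "w (i+1) < w i" and dj: "w (j+1) < w j" using d WB_neq[OF w] by (meson linorder_neqE_nat)+
  note W = WB_comp sB_WB
  define w1 where "w1 = w \<circ> sB r i"
  have w1: "w1 \<in> WB r" "lenB r w = Suc (lenB r w1)" "w1 \<circ> sB r i = w"
    using W w ij lenB_down[OF w ij(1) d(1)] by (auto simp: w1_def sB_comp_sB_right)
  have w1v: "w1 i = w (i+1)" "w1 (i+1) = w i" using sB_simps[OF ij(1)] by (simp_all add: w1_def)
  consider "i + 2 \<le> j" | "j = i + 1" "j < r" | "j = i + 1" "j = r" using ij by force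
  thus ?thesis
  proof cases
    case 1
    define v where "v = w1 \<circ> sB r j"
    have "w1 j = w j" "w1 (j+1) = w (j+1)"
    proof -
      have "j \<notin> {i,i+1,2*r-i,2*r+1-i}" "j+1 \<notin> {i,i+1,2*r-i,2*r+1-i}" using 1 ij by auto
      thus "w1 j = w j" "w1 (j+1) = w (j+1)" using sB_simps(5)[OF ij(1)] by (simp_all add: w1_def)
    qed
    hence v: "v \<in> WB r" "lenB r w1 = Suc (lenB r v)" "v \<circ> sB r j = w1"
      using W w1 ij lenB_down[OF w1(1) ij(2)] dj by (auto simp: v_def sB_comp_sB_right)
    have "sB r j \<circ> sB r i = sB r i \<circ> sB r j"
    proof (rule WB_eqI[of _ r])
      fix x assume x: "x \<in> {1..r}"
      show "(sB r j \<circ> sB r i) x = (sB r i \<circ> sB r j) x"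
      proof (cases "j = r")
        case True
        have "sB r r x = (if x = r then r+1 else x)" using x by (auto simp: sB_apply)
        moreover have "sB r r y = y" if "y < r" for y using that ij by (auto simp: sB_apply)
        moreover have "sB r i x = transpose i (i+1) x" using sB_half x 1 True ij by auto
        moreover have "sB r i (r+1) = r+1" using sB_apply[of i r "r+1"] 1 ij True by auto
        ultimately show ?thesis using True x 1 by (auto simp: transpose_def)
      next
        case False
        have *: "sB r i y = transpose i (i+1) y" "sB r j y = transpose j (j+1) y" if "y \<le> r" for y
          using sB_half that ij False by auto
        have "transpose i (i+1) x \<le> r" "transpose j (j+1) x \<le> r"
          using x ij False by (auto simp: transpose_def)
        thus ?thesis using x 1 by (auto simp: * transpose_def)
      qed
    qed (use W ij in auto)
    hence e: "word_prod (sB r) [j,i] = word_prod (sB r) [i,j]" by (simp add: word_prod_Cons word_prod_Nil)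
    have "w = v \<circ> word_prod (sB r) [j,i]" using v(3) w1(3) by (simp add: word_prod_Cons word_prod_Nil o_assoc)
    thus ?thesis using heq_commute[OF r ij(1,2) 1] v w1 ij e
      by (intro exI[of _ "[j]"] exI[of _ "[i]"] exI[of _ v]) (auto simp: gw_Cons gw_Nil)
  next
    case 2
    have i1: "i+1 \<in> {1..r}" using 2 ij by auto
    have "sB r i (i+2) = i+2" using 2 ij by (auto simp: sB_apply)
    hence w1v': "w1 (i+2) = w (i+2)" by (simp add: w1_def)
    have dj': "w (i+2) < w (i+1)" using dj 2 by simp
    define w2 where "w2 = w1 \<circ> sB r (i+1)"
    have w2: "w2 \<in> WB r" "lenB r w1 = Suc (lenB r w2)" "w2 \<circ> sB r (i+1) = w1"
      using WB_comp[of w1 r "sB r (i+1)"] w1 i1 lenB_down[OF w1(1) i1] w1v w1v' di dj'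
        sB_comp_sB_right[OF i1, of w1] by (auto simp: w2_def sB_WB)
    have "sB r (i+1) i = i" "sB r (i+1) (i+1) = i+2" using 2 ij by (auto simp: sB_apply)
    hence w2v: "w2 i = w (i+1)" "w2 (i+1) = w (i+2)" using w1v w1v' by (simp_all add: w2_def)
    define v where "v = w2 \<circ> sB r i"
    have v: "v \<in> WB r" "lenB r w2 = Suc (lenB r v)" "v \<circ> sB r i = w2"
      using W w2 ij lenB_down[OF w2(1) ij(1)] w2v dj' by (auto simp: v_def sB_comp_sB_right)
    have "sB r i \<circ> (sB r (i+1) \<circ> sB r i) = sB r (i+1) \<circ> (sB r i \<circ> sB r (i+1))"
    proof (rule WB_eqI[of _ r])
      fix x assume x: "x \<in> {1..r}"
      have *: "sB r i y = transpose i (i+1) y" "sB r (i+1) y = transpose (i+1) (i+2) y" if "y \<le> r" for y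
        using sB_half[of i r y] sB_half[of "i+1" r y] that ij 2 by auto
      have si: "sB r i i = i+1" "sB r i (i+1) = i" "sB r i (i+2) = i+2"
        and sj: "sB r (i+1) i = i" "sB r (i+1) (i+1) = i+2" "sB r (i+1) (i+2) = i+1"
        using 2 *[of i] *[of "i+1"] *[of "i+2"] by (auto simp: transpose_def)
      consider "x = i" | "x = i+1" | "x = i+2" | "x \<notin> {i,i+1,i+2}" by blast
      thus "(sB r i \<circ> (sB r (i+1) \<circ> sB r i)) x = (sB r (i+1) \<circ> (sB r i \<circ> sB r (i+1))) x"
      proof cases
        case 4
        hence "sB r i x = x" "sB r (i+1) x = x" using x *[of x] by (auto simp: transpose_def)
        thus ?thesis by (simp only: o_apply)
      qed (simp_all only: o_apply si sj)
    qed (use W ij i1 in auto)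
    hence e: "word_prod (sB r) [i,i+1,i] = word_prod (sB r) [i+1,i,i+1]"
      by (simp add: word_prod_Cons word_prod_Nil)
    have we: "w = v \<circ> word_prod (sB r) [i,i+1,i]"
      using v(3) w2(3) w1(3) by (simp add: word_prod_Cons word_prod_Nil o_assoc)
    have "heq r (gw [i,i+1,i]) (gw [i+1,i,i+1])" using heq_braid[OF r, of i] 2 ij
      by (simp add: gw_Cons gw_Nil mult.assoc)
    thus ?thesis using v w2 w1 ij e we 2
      by (intro exI[of _ "[i,i+1]"] exI[of _ "[i+1,i]"] exI[of _ v]) auto
  next
    case 3
    have i1: "r \<in> {1..r}" and ir: "i + 1 = r" "i + 2 = r + 1" and r1: "r - 1 = i" using 3 ij by auto
    have p: "2*r - i = r+1" "2*r+1-i = r+2" "2*r-r = r" "2*r+1-r = r+1" using ir by auto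
    have si: "sB r i i = r" "sB r i r = i" "sB r i (r+1) = r+2" "sB r i (r+2) = r+1"
      "\<And>x. x \<notin> {i,r,r+1,r+2} \<Longrightarrow> sB r i x = x"
      using sB_simps[OF ij(1)] unfolding p ir by auto
    have sr: "sB r r r = r+1" "sB r r (r+1) = r" "\<And>x. x \<notin> {r,r+1} \<Longrightarrow> sB r r x = x"
      using sB_simps[OF i1] unfolding p by auto
    have ne: "i \<noteq> r" "i \<noteq> r+1" "i \<noteq> r+2" using ir by auto
    have sr': "sB r r i = i" "sB r r (r+2) = r+2" using sr(3) ne by auto
    have dj': "w (r+1) < w r" "w r < w i" using dj di 3 ir by auto
    have "w r = 2*r+1 - w (r+1)" "w i = 2*r+1 - w (r+2)"
      using WB_mirror[OF w, of "r+1"] WB_mirror[OF w, of "r+2"] ir ij by auto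
    hence d3: "w (r+2) < w (r+1)" using dj' by auto
    have w1v: "w1 i = w r" "w1 r = w i" "w1 (r+1) = w (r+2)" "w1 (r+2) = w (r+1)"
      by (simp_all only: w1_def si o_apply)
    define w2 where "w2 = w1 \<circ> sB r r"
    have w2: "w2 \<in> WB r" "lenB r w1 = Suc (lenB r w2)" "w2 \<circ> sB r r = w1"
      using WB_comp[of w1 r "sB r r"] w1 i1 lenB_down[OF w1(1) i1] w1v dj' d3
      by (auto simp: w2_def sB_comp_sB_right[OF i1] sB_WB)
    have w2v: "w2 i = w r" "w2 r = w (r+2)" "w2 (r+1) = w i" "w2 (r+2) = w (r+1)"
      using w1v by (simp_all only: w2_def sr sr' o_apply)
    define w3 where "w3 = w2 \<circ> sB r i"
    have w3: "w3 \<in> WB r" "lenB r w2 = Suc (lenB r w3)" "w3 \<circ> sB r i = w2"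
      using WB_comp[of w2 r "sB r i"] w2 ij lenB_down[OF w2(1) ij(1)] w2v dj' d3 ir
      by (auto simp: w3_def sB_comp_sB_right[OF ij(1)] sB_WB)
    have w3v: "w3 r = w r" "w3 (r+1) = w (r+1)" using w2v by (simp_all only: w3_def si o_apply)
    define v where "v = w3 \<circ> sB r r"
    have v: "v \<in> WB r" "lenB r w3 = Suc (lenB r v)" "v \<circ> sB r r = w3"
      using WB_comp[of w3 r "sB r r"] w3 i1 lenB_down[OF w3(1) i1] w3v dj' d3
      by (auto simp: v_def sB_comp_sB_right[OF i1] sB_WB)
    have "sB r r \<circ> (sB r i \<circ> (sB r r \<circ> sB r i)) = sB r i \<circ> (sB r r \<circ> (sB r i \<circ> sB r r))"
    proof
      fix x
      consider "x = i" | "x = r" | "x = r+1" | "x = r+2" | "x \<notin> {i,r,r+1,r+2}" by blast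
      thus "(sB r r \<circ> (sB r i \<circ> (sB r r \<circ> sB r i))) x = (sB r i \<circ> (sB r r \<circ> (sB r i \<circ> sB r r))) x"
        by cases (simp_all add: si sr sr' del: One_nat_def add_2_eq_Suc' add_Suc_right)
    qed
    hence e: "word_prod (sB r) [r,i,r,i] = word_prod (sB r) [i,r,i,r]"
      by (simp add: word_prod_Cons word_prod_Nil)
    have we: "w = v \<circ> word_prod (sB r) [r,i,r,i]"
      using v(3) w3(3) w2(3) w1(3) by (simp add: word_prod_Cons word_prod_Nil o_assoc)
    have "heq r (gw [r,i,r,i]) (gw [i,r,i,r])" using heq_sym[OF r heq_braid4[OF r]] unfolding r1
      by (simp add: gw_Cons gw_Nil mult.assoc)
    thus ?thesis using v w3 w2 w1 ij e we 3
      by (intro exI[of _ "[r,i,r]"] exI[of _ "[i,r,i]"] exI[of _ v]) auto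
  qed
qed

text \<open>Two reduced words with different last letters are compared through the reduced words that end
  in the two sides of the braid relation for these letters.\<close>

lemma matsumoto:
  assumes r: "r \<ge> 2"
  shows "set us \<subseteq> {1..r} \<Longrightarrow> set vs \<subseteq> {1..r} \<Longrightarrow> word_prod (sB r) us = word_prod (sB r) vs
    \<Longrightarrow> length us = lenB r (word_prod (sB r) us) \<Longrightarrow> length vs = length us \<Longrightarrow> heq r (gw us) (gw vs)"
proof (induction "length us" arbitrary: us vs)
  case 0
  thus ?case using heq_refl[OF r FA_one] by (simp add: gw_Nil)
next
  case (Suc n)
  obtain as i where as: "us = as @ [i]" using Suc.hyps(2) by (metis append_butlast_last_id list.size(3) nat.simps(3))
  obtain bs j where bs: "vs = bs @ [j]" using Suc.hyps(2) Suc.prems(5) by (metis append_butlast_last_id list.size(3) nat.simps(3))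
  define w where "w = word_prod (sB r) us"
  have wi: "w = word_prod (sB r) as \<circ> sB r i" and wj: "w = word_prod (sB r) bs \<circ> sB r j"
    using Suc.prems(3) unfolding w_def as bs word_prod_snoc by simp_all
  have sets: "set as \<subseteq> {1..r}" "set bs \<subseteq> {1..r}" and ij: "i \<in> {1..r}" "j \<in> {1..r}" using Suc.prems as bs by auto
  have len: "length as = n" "length bs = n" "lenB r w = Suc n" using Suc as bs by (auto simp: w_def)
  have w: "w \<in> WB r" using word_prod_WB Suc.prems by (simp add: w_def)
  have ai: "word_prod (sB r) as = w \<circ> sB r i" and bj: "word_prod (sB r) bs = w \<circ> sB r j"
    using sB_comp_sB_right[OF ij(1), of "word_prod (sB r) as"]
      sB_comp_sB_right[OF ij(2), of "word_prod (sB r) bs"] wi wj by simp_all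
  have desc: "\<not> w k < w (k+1) \<and> lenB r (w \<circ> sB r k) = n"
    if "set cs \<subseteq> {1..r}" "length cs = n" "word_prod (sB r) cs = w \<circ> sB r k" "k \<in> {1..r}" for cs k
  proof -
    have "lenB r (w \<circ> sB r k) \<le> n" using lenB_word_le[OF that(1)] that(2,3) by simp
    thus ?thesis using lenB_up[OF w that(4)] lenB_down[OF w that(4)] len(3)
      by (cases "w k < w (k+1)") auto
  qed
  have di: "\<not> w i < w (i+1)" "lenB r (w \<circ> sB r i) = n" and dj: "\<not> w j < w (j+1)" "lenB r (w \<circ> sB r j) = n"
    using desc[OF sets(1) len(1) ai ij(1)] desc[OF sets(2) len(2) bj ij(2)] by auto
  have step: "heq r (gw (cs @ [k])) (gw ks * gw (p @ [k]))"
    if "set cs \<subseteq> {1..r}" "length cs = n" "word_prod (sB r) cs = w \<circ> sB r k" "k \<in> {1..r}"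
      "lenB r (w \<circ> sB r k) = n" "set p \<subseteq> {1..r}" "set ks \<subseteq> {1..r}" "length ks + length p = n"
      "w = word_prod (sB r) ks \<circ> word_prod (sB r) (p @ [k])" for cs k ks p
  proof -
    have "word_prod (sB r) (ks @ p) = w \<circ> sB r k"
      using that(9) sB_comp_sB_right[OF that(4), of "word_prod (sB r) (ks @ p)"]
      unfolding word_prod_snoc unfolding word_prod_append o_assoc by simp
    hence "heq r (gw cs) (gw (ks @ p))" using Suc.hyps(1)[of cs "ks @ p"] that by auto
    hence "heq r (gw cs * gen k) (gw (ks @ p) * gen k)" by (intro heq_mult_right r FA_gen that)
    thus ?thesis by (simp add: gw_append gw_Cons gw_Nil mult.assoc)
  qed
  show ?case
  proof (cases "i = j")
    case True
    have "heq r (gw as) (gw bs)" using Suc.hyps(1)[of as bs] sets len ai bj True di by auto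
    hence "heq r (gw as * gen i) (gw bs * gen i)" by (intro heq_mult_right r FA_gen ij)
    thus ?thesis using as bs True by (simp add: gw_append gw_Cons gw_Nil)
  next
    case False
    have "\<exists>p q v. set p \<subseteq> {1..r} \<and> set q \<subseteq> {1..r} \<and> length p = length q \<and> v \<in> WB r
      \<and> w = v \<circ> word_prod (sB r) (p @ [i]) \<and> w = v \<circ> word_prod (sB r) (q @ [j])
      \<and> heq r (gw (p @ [i])) (gw (q @ [j])) \<and> lenB r w = lenB r v + length p + 1"
    proof (cases "i < j")
      case True thus ?thesis using braid_factor[OF r w ij True di(1) dj(1)] by blast
    next
      case i: False
      hence "j < i" using False by simp
      from braid_factor[OF r w ij(2,1) this dj(1) di(1)] heq_sym[OF r] show ?thesis by metis
    qed
    then obtain p q v where pq: "set p \<subseteq> {1..r}" "set q \<subseteq> {1..r}" "length p = length q" "v \<in> WB r"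
      "w = v \<circ> word_prod (sB r) (p @ [i])" "w = v \<circ> word_prod (sB r) (q @ [j])"
      "heq r (gw (p @ [i])) (gw (q @ [j]))" "lenB r w = lenB r v + length p + 1" by blast
    obtain ks where ks: "set ks \<subseteq> {1..r}" "word_prod (sB r) ks = v" "length ks = lenB r v"
      using wlenB[OF pq(4)] by (auto simp: reduced_expr_def is_expr_def)
    have "heq r (gw us) (gw ks * gw (p @ [i]))" unfolding as
      using step[OF sets(1) len(1) ai ij(1) di(2) pq(1) ks(1)] pq ks len by auto
    moreover have "heq r (gw vs) (gw ks * gw (q @ [j]))" unfolding bs
      using step[OF sets(2) len(2) bj ij(2) dj(2) pq(2) ks(1)] pq ks len by auto
    moreover have "heq r (gw ks * gw (p @ [i])) (gw ks * gw (q @ [j]))"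
      by (intro heq_mult_left r gw_FA ks pq)
    ultimately show ?thesis using heq_trans[OF r] heq_sym[OF r] by blast
  qed
qed

definition tw :: "nat \<Rightarrow> (nat \<Rightarrow> nat) \<Rightarrow> falg" where
  "tw r w = gw (SOME ws. reduced_expr r (sB r) w ws)"

lemma Tw_tw: "Tw r w = cls r (tw r w)"
  by (simp add: Tw_def tw_def gw_def)

lemma tw_reduced:
  assumes r: "r \<ge> 2" and w: "w \<in> WB r"
  obtains ws where "set ws \<subseteq> {1..r}" "word_prod (sB r) ws = w" "length ws = lenB r w" "tw r w = gw ws"
proof -
  have "reduced_expr r (sB r) w (SOME ws. reduced_expr r (sB r) w ws)"
    using wlenB(2)[OF w] by (rule someI_ex)
  thus ?thesis using that wlenB(1)[OF w] by (auto simp: tw_def reduced_expr_def is_expr_def)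
qed

lemma tw_FA: "r \<ge> 2 \<Longrightarrow> w \<in> WB r \<Longrightarrow> tw r w \<in> FA r"
  by (metis tw_reduced gw_FA)

text \<open>The arbitrary choice of a reduced word is immaterial up to congruence.\<close>

lemma tw_eq_gw:
  assumes r: "r \<ge> 2" and "set ws \<subseteq> {1..r}" "length ws = lenB r (word_prod (sB r) ws)"
  shows "heq r (tw r (word_prod (sB r) ws)) (gw ws)"
proof -
  obtain us where "set us \<subseteq> {1..r}" "word_prod (sB r) us = word_prod (sB r) ws"
    "length us = lenB r (word_prod (sB r) ws)" "tw r (word_prod (sB r) ws) = gw us"
    by (rule tw_reduced[OF r word_prod_WB[OF assms(2)]])
  thus ?thesis using matsumoto[OF r, of us ws] assms by simp
qed

lemma tw_id: "r \<ge> 2 \<Longrightarrow> heq r (tw r id) 1"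
  using tw_eq_gw[of r "[]"] by (simp add: word_prod_Nil gw_Nil lenB_def invs_id neg_id)

lemma tw_right:
  assumes r: "r \<ge> 2" and w: "w \<in> WB r" and k: "k \<in> {1..r}" and up: "w k < w (k+1)"
  shows "heq r (tw r w * gen k) (tw r (w \<circ> sB r k))"
proof -
  obtain ws where ws: "set ws \<subseteq> {1..r}" "word_prod (sB r) ws = w" "length ws = lenB r w" "tw r w = gw ws"
    by (rule tw_reduced[OF r w])
  have e: "word_prod (sB r) (ws @ [k]) = w \<circ> sB r k" by (simp only: word_prod_snoc ws)
  show ?thesis using tw_eq_gw[OF r, of "ws @ [k]"] ws lenB_up[OF w k up] k heq_sym[OF r]
    unfolding e by (simp add: gw_append gw_Cons gw_Nil)
qed

lemma lenB_up_left:
  assumes w: "w \<in> WB r" and k: "k \<in> {1..r}" and up: "inv' w k < inv' w (k+1)"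
  shows "lenB r (sB r k \<circ> w) = Suc (lenB r w)"
proof -
  have "lenB r (sB r k \<circ> w) = lenB r (inv' w \<circ> sB r k)"
    using lenB_inv[OF WB_comp[OF sB_WB[OF k] w]] WB_inv_comp[OF sB_WB[OF k] w] sB_inv[OF k] by simp
  thus ?thesis using lenB_up[OF WB_inv[OF w] k up] lenB_inv[OF w] by simp
qed

lemma tw_left:
  assumes r: "r \<ge> 2" and w: "w \<in> WB r" and k: "k \<in> {1..r}" and up: "inv' w k < inv' w (k+1)"
  shows "heq r (gen k * tw r w) (tw r (sB r k \<circ> w))"
proof -
  obtain ws where ws: "set ws \<subseteq> {1..r}" "word_prod (sB r) ws = w" "length ws = lenB r w" "tw r w = gw ws"
    by (rule tw_reduced[OF r w])
  have e: "word_prod (sB r) (k # ws) = sB r k \<circ> w" by (simp add: word_prod_Cons ws)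
  show ?thesis using tw_eq_gw[OF r, of "k # ws"] ws lenB_up_left[OF w k up] k heq_sym[OF r]
    unfolding e by (simp add: gw_Cons)
qed

text \<open>As \<open>T\<^sub>r\<close> is an involution, multiplication by it never needs a condition on lengths.\<close>

lemma tw_r_right:
  assumes r: "r \<ge> 2" and w: "w \<in> WB r"
  shows "heq r (tw r w * gen r) (tw r (w \<circ> sB r r))"
proof (cases "w r < w (r+1)")
  case False
  have k: "r \<in> {1..r}" using r by auto
  define v where "v = w \<circ> sB r r"
  have v: "v \<in> WB r" "v r < v (r+1)" "v \<circ> sB r r = w"
    unfolding v_def using WB_comp[OF w sB_WB[OF k]] ascent_sB[OF w k] False sB_comp_sB_right[OF k, of w]
    by blast+
  have "heq r (tw r v * gen r) (tw r w)" using tw_right[OF r v(1) k v(2)] v(3) by simp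
  hence "heq r (tw r v * gen r * gen r) (tw r w * gen r)" using r by (intro heq_mult_right FA_gen) auto
  moreover have "heq r (tw r v * gen r * gen r) (tw r v)"
    using heq_mult_left[OF r tw_FA[OF r v(1)] heq_r[OF r]] by (simp add: mult.assoc)
  ultimately have "heq r (tw r w * gen r) (tw r v)" by (metis heq_trans[OF r] heq_sym[OF r])
  thus ?thesis unfolding v_def .
qed (use tw_right[OF r w] r in auto)

lemma tw_r_left:
  assumes r: "r \<ge> 2" and w: "w \<in> WB r"
  shows "heq r (gen r * tw r w) (tw r (sB r r \<circ> w))"
proof (cases "inv' w r < inv' w (r+1)")
  case False
  have k: "r \<in> {1..r}" using r by auto
  define v where "v = sB r r \<circ> w"
  have iv: "inv' v = inv' w \<circ> sB r r" using WB_inv_comp[OF sB_WB[OF k] w] sB_inv[OF k] by (simp add: v_def)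
  have v: "v \<in> WB r" "inv' v r < inv' v (r+1)" "sB r r \<circ> v = w"
    unfolding iv unfolding v_def
    using WB_comp[OF sB_WB[OF k] w] ascent_sB[OF WB_inv[OF w] k] False sB_comp_sB_left[OF k, of w]
    by blast+
  have "heq r (gen r * tw r v) (tw r w)" using tw_left[OF r v(1) k v(2)] v(3) by simp
  hence "heq r (gen r * (gen r * tw r v)) (gen r * tw r w)" using r by (intro heq_mult_left FA_gen) auto
  moreover have "heq r (gen r * (gen r * tw r v)) (tw r v)"
    using heq_mult_right[OF r tw_FA[OF r v(1)] heq_r[OF r]] by (simp add: mult.assoc)
  ultimately have "heq r (gen r * tw r w) (tw r v)" by (metis heq_trans[OF r] heq_sym[OF r])
  thus ?thesis unfolding v_def .
qed (use tw_left[OF r w] r in auto)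

section \<open>The subalgebra of type D\<close>

lemma heckeD_subset:
  assumes r: "r \<ge> 2" shows "heckeD r \<subseteq> carrier (hecke r)"
  unfolding heckeD_def
  by (rule ring.generate_ring_incl[OF ring_hecke[OF r]])
    (use r in \<open>auto simp: hecke_carrier intro!: imageI FA_intros\<close>)

lemma heckeD_FA: "r \<ge> 2 \<Longrightarrow> h \<in> heckeD r \<Longrightarrow> \<exists>x\<in>FA r. h = cls r x"
  using heckeD_subset[of r] by (auto simp: hecke_carrier)

lemma heckeD_add: "h \<in> heckeD r \<Longrightarrow> h' \<in> heckeD r \<Longrightarrow> h \<oplus>\<^bsub>hecke r\<^esub> h' \<in> heckeD r"
  and heckeD_mult: "h \<in> heckeD r \<Longrightarrow> h' \<in> heckeD r \<Longrightarrow> h \<otimes>\<^bsub>hecke r\<^esub> h' \<in> heckeD r"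
  and heckeD_scal: "cls r (scal a) \<in> heckeD r"
  unfolding heckeD_def by (auto intro: generate_ring.intros)

lemma heckeD_zero: "cls r 0 \<in> heckeD r" and heckeD_one: "cls r 1 \<in> heckeD r"
  using heckeD_scal[of r 0] heckeD_scal[of r 1] by (simp_all add: scal_zero scal_one)

text \<open>Moving the letters \<open>T\<^sub>r\<close> of a word to the right conjugates the letters in between, and pairs of
  letters \<open>T\<^sub>r\<close> cancel.\<close>

lemma gw_heckeD:
  assumes r: "r \<ge> 2" and ws: "set ws \<subseteq> {1..r}"
  shows "\<exists>x\<in>FA r. cls r x \<in> heckeD r \<and>
    heq r (gw ws) (if even (neg r (word_prod (sB r) ws)) then x else x * gen r)"
  using ws
proof (induction ws rule: rev_induct)
  case Nil
  thus ?case using heckeD_one[of r] FA_one[of r] heq_refl[OF r FA_one]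
    by (intro bexI[of _ 1]) (auto simp: word_prod_Nil neg_id gw_Nil)
next
  case (snoc k ws)
  let ?e = "even (neg r (word_prod (sB r) ws))"
  have k: "k \<in> {1..r}" "set ws \<subseteq> {1..r}" "gen r \<in> FA r" "gen k \<in> FA r" using snoc.prems r by (auto intro!: FA_gen)
  from snoc.IH k obtain x where x: "x \<in> FA r" "cls r x \<in> heckeD r"
    "heq r (gw ws) (if ?e then x else x * gen r)" by blast
  have par: "even (neg r (word_prod (sB r) (ws @ [k]))) \<longleftrightarrow> (?e \<longleftrightarrow> k \<noteq> r)"
    using neg_parity[OF word_prod_WB[OF k(2)] sB_WB[OF k(1)]] neg_sB[OF k(1)] r
    unfolding word_prod_snoc by simp
  have g: "heq r (gw (ws @ [k])) ((if ?e then x else x * gen r) * gen k)"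
    using heq_mult_right[OF r k(4) x(3)] by (simp add: gw_append gw_Cons gw_Nil)
  have cancel: "heq r (y * gen r * gen r) y" if "y \<in> FA r" for y
    using heq_mult_left[OF r that heq_r[OF r]] by (simp add: mult.assoc)
  have mem: "cls r (x * y) \<in> heckeD r" if "y \<in> FA r" "cls r y \<in> heckeD r" for y
    using heckeD_mult[OF x(2) that(2)] hecke_mult[OF r x(1) that(1)] by simp
  show ?case
  proof (cases "k = r")
    case True
    show ?thesis
    proof (cases ?e)
      case e: True
      show ?thesis using x g by (intro bexI[of _ x]) (use e True par in auto)
    next
      case e: False
      have "heq r (gw (ws @ [k])) x" using heq_trans[OF r g, of x] cancel[OF x(1)] True e by simp
      thus ?thesis using x by (intro bexI[of _ x]) (use e True par in auto)
    qed
  next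
    case False
    hence k': "k \<in> {1..<r}" using k by auto
    show ?thesis
    proof (cases ?e)
      case e: True
      have "cls r (gen k) \<in> heckeD r" unfolding heckeD_def using k' by (auto intro: generate_ring.incl)
      thus ?thesis using g e False par k mem[of "gen k"] x FA_mult
        by (intro bexI[of _ "x * gen k"]) auto
    next
      case e: False
      \<comment> \<open>The conjugate \<open>T\<^sub>r T\<^sub>k T\<^sub>r\<close> is the last generator of the subalgebra for \<open>k = r-1\<close>, and \<open>T\<^sub>k\<close>
        otherwise.\<close>
      let ?c = "gen r * gen k * gen r"
      have c: "?c \<in> FA r" using k by (intro FA_mult)
      have "cls r ?c \<in> heckeD r"
      proof (cases "k = r - 1")
        case True
        thus ?thesis unfolding heckeD_def by (auto intro: generate_ring.incl)
      next
        case kr: False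
        have "heq r (gen r * gen k * gen r) (gen k * gen r * gen r)"
          using heq_commute[OF r k(1), of r] k' kr r by (intro heq_mult_right[OF r k(3)]) auto
        hence "heq r ?c (gen k)" using heq_trans[OF r _ cancel[OF k(4)]] by blast
        hence "cls r ?c = cls r (gen k)" using cls_eq_iff[OF r c k(4)] by blast
        thus ?thesis unfolding heckeD_def using k' by (auto intro: generate_ring.incl)
      qed
      hence "cls r (x * ?c) \<in> heckeD r" using mem c by blast
      moreover have "heq r (gw (ws @ [k])) (x * ?c * gen r)"
        using heq_trans[OF r g] heq_sym[OF r cancel[of "x * gen r * gen k"]] x(1) k e
        by (simp add: mult.assoc FA_mult)
      ultimately show ?thesis using x c by (intro bexI[of _ "x * ?c"]) (use False e par FA_mult in auto)
    qed
  qed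
qed

lemma tw_heckeD:
  assumes r: "r \<ge> 2" and w: "w \<in> WD r"
  shows "cls r (tw r w) \<in> heckeD r"
proof -
  have w': "w \<in> WB r" "even (neg r w)" using w by (auto simp: WD_iff)
  obtain ws where ws: "set ws \<subseteq> {1..r}" "word_prod (sB r) ws = w" "tw r w = gw ws"
    by (rule tw_reduced[OF r w'(1)])
  then obtain x where "x \<in> FA r" "cls r x \<in> heckeD r" "heq r (tw r w) x"
    using gw_heckeD[OF r ws(1)] w' by auto
  thus ?thesis using cls_eq_iff[OF r tw_FA[OF r w'(1)]] by metis
qed

definition TS :: "nat \<Rightarrow> (nat \<Rightarrow> nat) set \<Rightarrow> falg" where
  "TS r X = (\<Sum>w\<in>X. tw r w)"

lemma TS_FA: "r \<ge> 2 \<Longrightarrow> X \<subseteq> WB r \<Longrightarrow> TS r X \<in> FA r"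
  unfolding TS_def by (intro FA_sum tw_FA) auto

lemma Tsum_TS:
  assumes "r \<ge> 2" "X \<subseteq> WB r" shows "Tsum r X = cls r (TS r X)"
  unfolding Tsum_def TS_def Tw_tw using assms finite_subset[OF assms(2) WB_finite]
  by (intro hecke_finsum) (auto intro: tw_FA)

lemma TS_Un: "X \<subseteq> WB r \<Longrightarrow> Y \<subseteq> WB r \<Longrightarrow> X \<inter> Y = {} \<Longrightarrow> TS r (X \<union> Y) = TS r X + TS r Y"
  unfolding TS_def by (intro sum.union_disjoint) (auto intro: finite_subset[OF _ WB_finite])

lemma TS_translate_left:
  assumes r: "r \<ge> 2" and a: "a \<in> FA r" and u: "u \<in> WB r"
    and h: "\<And>w. w \<in> X \<Longrightarrow> heq r (a * tw r w) (tw r (u \<circ> w))"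
  shows "heq r (a * TS r X) (TS r ((\<lambda>w. u \<circ> w) ` X))"
proof -
  have "inj_on (\<lambda>w. u \<circ> w) X" using WB_inj[OF u] by (auto simp: inj_on_def fun_eq_iff)
  hence "TS r ((\<lambda>w. u \<circ> w) ` X) = (\<Sum>w\<in>X. tw r (u \<circ> w))" unfolding TS_def by (simp add: sum.reindex)
  thus ?thesis unfolding TS_def sum_distrib_left using heq_sum[OF r h] by simp
qed

lemma TS_translate_right:
  assumes r: "r \<ge> 2" and a: "a \<in> FA r" and u: "u \<in> WB r"
    and h: "\<And>w. w \<in> X \<Longrightarrow> heq r (tw r w * a) (tw r (w \<circ> u))"
  shows "heq r (TS r X * a) (TS r ((\<lambda>w. w \<circ> u) ` X))"
proof -
  have "inj_on (\<lambda>w. w \<circ> u) X"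
    by (rule inj_onI) (metis WB_inv_apply(4)[OF u] comp_id o_assoc)
  hence "TS r ((\<lambda>w. w \<circ> u) ` X) = (\<Sum>w\<in>X. tw r (w \<circ> u))" unfolding TS_def by (simp add: sum.reindex)
  thus ?thesis unfolding TS_def sum_distrib_right using heq_sum[OF r h] by simp
qed

section \<open>Stabilisers of monotone labellings\<close>

text \<open>A composition is represented by the labelling of \<open>[1,2r]\<close> that gives each point the index of its
  block. Parabolic subgroups become stabilisers, and minimal coset representatives become the elements
  increasing on the fibres.\<close>

definition labelling :: "nat \<Rightarrow> nat \<Rightarrow> (nat \<Rightarrow> nat) \<Rightarrow> bool" where
  "labelling r c \<rho> \<longleftrightarrow> (\<forall>x y. 1 \<le> x \<and> x \<le> y \<and> y \<le> 2*r \<longrightarrow> \<rho> x \<le> \<rho> y)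
     \<and> (\<forall>x\<in>{1..2*r}. \<rho> x + \<rho> (2*r+1-x) = c)"

definition stab :: "nat \<Rightarrow> (nat \<Rightarrow> nat) \<Rightarrow> (nat \<Rightarrow> nat) set" where
  "stab r \<rho> = {w \<in> WB r. \<forall>x\<in>{1..2*r}. \<rho> (w x) = \<rho> x}"

definition incr :: "nat \<Rightarrow> (nat \<Rightarrow> nat) \<Rightarrow> (nat \<Rightarrow> nat) \<Rightarrow> bool" where
  "incr r \<rho> w \<longleftrightarrow> (\<forall>k\<in>{1..r}. \<rho> k = \<rho> (k+1) \<longrightarrow> w k < w (k+1))"

lemma stab_WB: "stab r \<rho> \<subseteq> WB r"
  by (auto simp: stab_def)

lemma stab_apply: "v \<in> stab r \<rho> \<Longrightarrow> x \<in> {1..2*r} \<Longrightarrow> \<rho> (v x) = \<rho> x"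
  by (auto simp: stab_def)

lemma stab_id: "id \<in> stab r \<rho>"
  using WB_id by (auto simp: stab_def)

lemma stab_comp: "u \<in> stab r \<rho> \<Longrightarrow> v \<in> stab r \<rho> \<Longrightarrow> u \<circ> v \<in> stab r \<rho>"
  using WB_in by (simp add: stab_def WB_comp del: atLeastAtMost_iff)

lemma stab_inv:
  assumes u: "u \<in> stab r \<rho>" shows "inv' u \<in> stab r \<rho>"
proof -
  have w: "u \<in> WB r" using u stab_WB by auto
  have "\<rho> (inv' u x) = \<rho> x" if "x \<in> {1..2*r}" for x
    using stab_apply[OF u, of "inv' u x"] WB_in[OF WB_inv[OF w]] that WB_inv_apply(2)[OF w, of x] by simp
  thus ?thesis using WB_inv[OF w] by (simp add: stab_def)
qed

lemma labelling_mono: "labelling r c \<rho> \<Longrightarrow> 1 \<le> x \<Longrightarrow> x \<le> y \<Longrightarrow> y \<le> 2*r \<Longrightarrow> \<rho> x \<le> \<rho> y"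
  by (auto simp: labelling_def)

lemma labelling_mirror: "labelling r c \<rho> \<Longrightarrow> x \<in> {1..2*r} \<Longrightarrow> \<rho> x + \<rho> (2*r+1-x) = c"
  unfolding labelling_def by blast

lemma labelling_step_mirror:
  assumes l: "labelling r c \<rho>" and k: "k \<in> {1..r}"
  shows "\<rho> (2*r-k) = \<rho> (2*r+1-k) \<longleftrightarrow> \<rho> k = \<rho> (k+1)"
proof -
  have "\<rho> k + \<rho> (2*r+1-k) = c" "\<rho> (k+1) + \<rho> (2*r-k) = c"
    using labelling_mirror[OF l, of k] labelling_mirror[OF l, of "k+1"] k by auto
  thus ?thesis by linarith
qed

lemma sB_stab:
  assumes l: "labelling r c \<rho>" and k: "k \<in> {1..r}" "\<rho> k = \<rho> (k+1)"
  shows "sB r k \<in> stab r \<rho>"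
proof -
  have "\<rho> (sB r k x) = \<rho> x" for x
  proof -
    consider "x = k" | "x = k+1" | "x = 2*r-k" | "x = 2*r+1-k" | "x \<notin> {k, k+1, 2*r-k, 2*r+1-k}" by blast
    thus ?thesis using sB_simps[OF k(1)] k(2) labelling_step_mirror[OF l k(1)] by cases simp_all
  qed
  thus ?thesis using sB_WB[OF k(1)] by (simp add: stab_def)
qed

lemma incr_full:
  assumes l: "labelling r c \<rho>" and w: "w \<in> WB r" and i: "incr r \<rho> w"
    and xy: "1 \<le> x" "x < y" "y \<le> 2*r" "\<rho> x = \<rho> y"
  shows "w x < w y"
proof -
  have adj: "w k < w (k+1)" if k: "1 \<le> k" "k < 2*r" "\<rho> k = \<rho> (k+1)" for k
  proof (cases "k \<le> r")
    case True thus ?thesis using i k by (auto simp: incr_def)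
  next
    case False
    have e: "2*r - (2*r-k) = k" "2*r+1-(2*r-k) = k+1" and m: "2*r-k \<in> {1..r}" using k False by auto
    show ?thesis using WB_ascent_mirror[OF w m] labelling_step_mirror[OF l m] i k m
      unfolding e incr_def by blast
  qed
  have "z \<le> y \<Longrightarrow> w x < w z" if "Suc x \<le> z" for z
    using that
  proof (induction z rule: dec_induct)
    case base
    have "\<rho> x = \<rho> (x+1)"
      using labelling_mono[OF l, of x "x+1"] labelling_mono[OF l, of "x+1" y] xy base by auto
    thus ?case using adj[of x] xy base by simp
  next
    case (step z)
    have "\<rho> z = \<rho> (z+1)"
      using labelling_mono[OF l, of z "z+1"] labelling_mono[OF l, of "z+1" y]
        labelling_mono[OF l, of x z] xy step by auto
    thus ?case using adj[of z] step xy by simp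
  qed
  thus ?thesis using xy by simp
qed

lemma stab_incr_id:
  assumes l: "labelling r c \<rho>" and v: "v \<in> stab r \<rho>" and i: "incr r \<rho> v"
  shows "v = id"
proof (rule WB_increasing_id)
  show w: "v \<in> WB r" using v stab_WB by auto
  fix k assume k: "k \<in> {1..r}"
  show "v k < v (k+1)"
  proof (cases "\<rho> k = \<rho> (k+1)")
    case False
    have kk: "k \<in> {1..2*r}" "k+1 \<in> {1..2*r}" using k by auto
    have "\<rho> k < \<rho> (k+1)" using labelling_mono[OF l, of k "k+1"] k False by auto
    hence "\<rho> (v k) < \<rho> (v (k+1))" using stab_apply[OF v] kk by simp
    moreover have "v k \<in> {1..2*r}" "v (k+1) \<in> {1..2*r}" using WB_in[OF w] kk by blast+
    ultimately show ?thesis using labelling_mono[OF l, of "v (k+1)" "v k"] by (meson atLeastAtMost_iff leD leI)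
  qed (use i k in \<open>auto simp: incr_def\<close>)
qed

lemma stab_descent:
  assumes "labelling r c \<rho>" "v \<in> stab r \<rho>" "v \<noteq> id"
  obtains k where "k \<in> {1..r}" "\<rho> k = \<rho> (k+1)" "\<not> v k < v (k+1)"
  using stab_incr_id[OF assms(1,2)] assms(3) unfolding incr_def by blast

text \<open>An element that keeps the blocks and is increasing on each of them is trivial. Hence a nontrivial
  element of the stabiliser has a descent inside a block, and removing it stays in the stabiliser; this
  is induction along reduced words in the parabolic generators.\<close>

lemma stab_induct [consumes 2, case_names id step]:
  assumes l: "labelling r c \<rho>" and v: "v \<in> stab r \<rho>"
    and id: "P id"
    and step: "\<And>v k. v \<in> stab r \<rho> \<Longrightarrow> k \<in> {1..r} \<Longrightarrow> \<rho> k = \<rho> (k+1) \<Longrightarrow> v k < v (k+1) \<Longrightarrow> P v \<Longrightarrow> P (v \<circ> sB r k)"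
  shows "P v"
  using v
proof (induction "lenB r v" arbitrary: v rule: less_induct)
  case less
  show ?case
  proof (cases "v = id")
    case False
    then obtain k where k: "k \<in> {1..r}" "\<rho> k = \<rho> (k+1)" "\<not> v k < v (k+1)"
      using stab_descent[OF l less.prems] by blast
    have w: "v \<in> WB r" using less.prems stab_WB by auto
    define v' where "v' = v \<circ> sB r k"
    have v': "v' \<in> stab r \<rho>" "v' k < v' (k+1)" "lenB r v' < lenB r v" "v' \<circ> sB r k = v"
      using stab_comp[OF less.prems sB_stab[OF l k(1,2)]] ascent_sB[OF w k(1)] k lenB_down[OF w k(1,3)]
        sB_comp_sB_right[OF k(1), of v] by (simp_all add: v'_def)
    show ?thesis using step[OF v'(1) k(1,2) v'(2)] less.hyps[OF v'(3,1)] v'(4) by simp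
  qed (simp add: id)
qed

lemma stab_generate:
  assumes l: "labelling r c \<rho>"
  shows "generate (sym_group (2*r)) (sB r ` {k\<in>{1..r}. \<rho> k = \<rho> (k+1)}) = stab r \<rho>" (is "?G = _")
proof (intro equalityI subsetI)
  fix v assume "v \<in> ?G"
  thus "v \<in> stab r \<rho>"
  proof induction
    case one show ?case unfolding sym_group_one by (rule stab_id)
  next
    case (incl h) thus ?case using sB_stab[OF l] by auto
  next
    case (inv h)
    then obtain k where k: "k \<in> {1..r}" "\<rho> k = \<rho> (k+1)" "h = sB r k" by auto
    have "h permutes {1..2*r}" using k WB_permutes[OF sB_WB] by auto
    thus ?case using sB_stab[OF l k(1,2)] k sB_inv by (simp add: sym_group_inv_equality sym_group_carrier)
  next
    case (eng u v) show ?case unfolding sym_group_mult by (rule stab_comp[OF eng.IH])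
  qed
next
  fix v assume "v \<in> stab r \<rho>"
  with l show "v \<in> ?G"
  proof (induction rule: stab_induct)
    case id show ?case using generate.one[of "sym_group (2*r)"] unfolding sym_group_one .
  next
    case (step v k)
    hence "sB r k \<in> ?G" by (intro generate.incl) auto
    from generate.eng[OF step(5) this] show ?case unfolding sym_group_mult .
  qed
qed

text \<open>If \<open>u\<close> is increasing on blocks, then an ascent of \<open>v\<close> inside a block is an ascent of \<open>u v\<close>, because \<open>v\<close>
  keeps the block.\<close>

lemma tw_stab_right:
  assumes r: "r \<ge> 2" and l: "labelling r c \<rho>" and u: "u \<in> WB r" "incr r \<rho> u" and v: "v \<in> stab r \<rho>"
  shows "heq r (tw r u * tw r v) (tw r (u \<circ> v))"
  using l v
proof (induction rule: stab_induct)
  case id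
  show ?case using heq_mult_left[OF r tw_FA[OF r u(1)] tw_id[OF r]] by (simp only: comp_id mult_1_right)
next
  case (step v k)
  have w: "v \<in> WB r" and k: "k \<in> {1..2*r}" "k+1 \<in> {1..2*r}" using step stab_WB by auto
  have vk: "v k \<in> {1..2*r}" "v (k+1) \<in> {1..2*r}" using WB_in[OF w] k by blast+
  have "\<rho> (v k) = \<rho> (v (k+1))" using stab_apply[OF step(1)] step(3) k by simp
  hence up: "(u \<circ> v) k < (u \<circ> v) (k+1)" using incr_full[OF l u, of "v k" "v (k+1)"] step(4) vk by simp
  have "heq r (tw r u * tw r (v \<circ> sB r k)) (tw r u * (tw r v * gen k))"
    by (rule heq_mult_left[OF r tw_FA[OF r u(1)] heq_sym[OF r tw_right[OF r w step(2,4)]]])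
  moreover have "heq r (tw r u * tw r v * gen k) (tw r (u \<circ> v) * gen k)"
    by (intro heq_mult_right r FA_gen step)
  moreover have "heq r (tw r (u \<circ> v) * gen k) (tw r (u \<circ> v \<circ> sB r k))"
    by (intro tw_right r WB_comp u w step up)
  ultimately show ?case unfolding o_assoc mult.assoc using heq_trans[OF r] by blast
qed

lemma incr_inv_sB:
  assumes "k \<in> {1..r}" "v \<in> WB r" shows "inv' (sB r k \<circ> v) = inv' v \<circ> sB r k"
  using WB_inv_comp[OF sB_WB assms(2)] sB_inv assms(1) by simp

lemma tw_stab_left:
  assumes r: "r \<ge> 2" and l: "labelling r c \<rho>" and u: "u \<in> WB r" "incr r \<rho> (inv' u)" and v: "v \<in> stab r \<rho>"
  shows "heq r (tw r v * tw r u) (tw r (v \<circ> u))"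
proof -
  have "heq r (tw r (inv' v) * tw r u) (tw r (inv' v \<circ> u))" if v: "v \<in> stab r \<rho>" for v
    using l v
  proof (induction rule: stab_induct)
    case id
    show ?case using heq_mult_right[OF r tw_FA[OF r u(1)] tw_id[OF r]] by (simp only: inv_id id_comp mult_1_left)
  next
    case (step v k)
    have w: "v \<in> WB r" and k: "k \<in> {1..2*r}" "k+1 \<in> {1..2*r}" using step stab_WB by auto
    have vk: "v k \<in> {1..2*r}" "v (k+1) \<in> {1..2*r}" using WB_in[OF w] k by blast+
    have iv: "inv' (v \<circ> sB r k) = sB r k \<circ> inv' v"
      using WB_inv_comp[OF w sB_WB[OF step(2)]] sB_inv[OF step(2)] by simp
    have iu: "inv' (inv' v \<circ> u) = inv' u \<circ> v" using WB_inv_comp[OF WB_inv[OF w] u(1)] w by simp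
    have "\<rho> (v k) = \<rho> (v (k+1))" using stab_apply[OF step(1)] step(3) k by simp
    hence up: "inv' (inv' v \<circ> u) k < inv' (inv' v \<circ> u) (k+1)"
      using incr_full[OF l WB_inv[OF u(1)] u(2), of "v k" "v (k+1)"] step(4) vk unfolding iu by simp
    have up': "inv' (inv' v) k < inv' (inv' v) (k+1)" using step(4) w by simp
    have "heq r (tw r (sB r k \<circ> inv' v) * tw r u) (gen k * tw r (inv' v) * tw r u)"
      by (rule heq_mult_right[OF r tw_FA[OF r u(1)] heq_sym[OF r tw_left[OF r WB_inv[OF w] step(2) up']]])
    moreover have "heq r (gen k * (tw r (inv' v) * tw r u)) (gen k * tw r (inv' v \<circ> u))"
      by (intro heq_mult_left r FA_gen step)
    moreover have "heq r (gen k * tw r (inv' v \<circ> u)) (tw r (sB r k \<circ> (inv' v \<circ> u)))"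
      by (intro tw_left r WB_comp WB_inv u w step up)
    ultimately show ?case unfolding iv o_assoc mult.assoc using heq_trans[OF r] by blast
  qed
  from this[OF stab_inv[OF v]] show ?thesis unfolding WB_inv_apply(5)[OF subsetD[OF stab_WB v]] .
qed

section \<open>Decomposition into cosets\<close>

text \<open>Induction over the cosets contained in a union of cosets, which are split off one at a time.\<close>

lemma peel_right:
  assumes "X \<subseteq> WB r" "\<And>x y. x \<in> X \<Longrightarrow> y \<in> Y \<Longrightarrow> x \<circ> y \<in> X"
    and grp: "Y \<subseteq> WB r \<and> id \<in> Y \<and> (\<forall>x\<in>Y. \<forall>y\<in>Y. x \<circ> y \<in> Y) \<and> (\<forall>x\<in>Y. inv' x \<in> Y)"
    and empty: "P {}"
    and coset: "\<And>x Z. x \<in> WB r \<Longrightarrow> Z \<subseteq> WB r \<Longrightarrow> (\<And>x y. x \<in> Z \<Longrightarrow> y \<in> Y \<Longrightarrow> x \<circ> y \<in> Z)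
      \<Longrightarrow> (\<lambda>y. x \<circ> y) ` Y \<inter> Z = {} \<Longrightarrow> P Z \<Longrightarrow> P ((\<lambda>y. x \<circ> y) ` Y \<union> Z)"
  shows "P X"
  using assms(1,2)
proof (induction "card X" arbitrary: X rule: less_induct)
  case less
  show ?case
  proof (cases "X = {}")
    case False
    then obtain x where x: "x \<in> X" by blast
    let ?C = "(\<lambda>y. x \<circ> y) ` Y"
    have C: "?C \<subseteq> X" "x \<in> ?C" using x less.prems(2) grp by (auto intro!: image_eqI[of _ _ id])
    have fin: "finite X" using less.prems(1) WB_finite by (rule finite_subset)
    have xw: "x \<in> WB r" using x less.prems by auto
    have cl: "z \<circ> y \<in> X - ?C" if z: "z \<in> X - ?C" and y: "y \<in> Y" for z y
    proof -
      have "z \<circ> y \<notin> ?C"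
      proof
        assume "z \<circ> y \<in> ?C"
        then obtain y' where y': "y' \<in> Y" "z \<circ> y = x \<circ> y'" by auto
        have "z = z \<circ> y \<circ> inv' y" using WB_inv_apply(4)[of y r] y grp by (auto simp: o_assoc[symmetric])
        also have "\<dots> = x \<circ> (y' \<circ> inv' y)" by (simp add: y'(2) o_assoc)
        finally have "z \<in> ?C" using y' y grp by (intro image_eqI[of _ _ "y' \<circ> inv' y"]) auto
        thus False using z by simp
      qed
      thus ?thesis using less.prems(2) z y by simp
    qed
    have "card (X - ?C) < card X" using fin C x by (intro psubset_card_mono) auto
    hence "P (X - ?C)" using less.hyps[of "X - ?C"] less.prems(1) cl by blast
    hence "P (?C \<union> (X - ?C))" using coset[OF xw, of "X - ?C"] less.prems(1) cl by blast
    thus ?thesis using C by (simp add: Un_absorb1)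
  qed (simp add: empty)
qed

lemma peel_left:
  assumes X: "X \<subseteq> WB r" "\<And>x y. x \<in> X \<Longrightarrow> y \<in> Y \<Longrightarrow> y \<circ> x \<in> X"
    and grp: "Y \<subseteq> WB r \<and> id \<in> Y \<and> (\<forall>x\<in>Y. \<forall>y\<in>Y. x \<circ> y \<in> Y) \<and> (\<forall>x\<in>Y. inv' x \<in> Y)"
    and empty: "P {}"
    and coset: "\<And>x Z. x \<in> WB r \<Longrightarrow> Z \<subseteq> WB r \<Longrightarrow> (\<And>x y. x \<in> Z \<Longrightarrow> y \<in> Y \<Longrightarrow> y \<circ> x \<in> Z)
      \<Longrightarrow> (\<lambda>y. y \<circ> x) ` Y \<inter> Z = {} \<Longrightarrow> P Z \<Longrightarrow> P ((\<lambda>y. y \<circ> x) ` Y \<union> Z)"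
  shows "P X"
  using assms(1,2)
proof (induction "card X" arbitrary: X rule: less_induct)
  case less
  show ?case
  proof (cases "X = {}")
    case False
    then obtain x where x: "x \<in> X" by blast
    let ?C = "(\<lambda>y. y \<circ> x) ` Y"
    have C: "?C \<subseteq> X" "x \<in> ?C" using x less.prems(2) grp by (auto intro!: image_eqI[of _ _ id])
    have fin: "finite X" using less.prems(1) WB_finite by (rule finite_subset)
    have xw: "x \<in> WB r" using x less.prems by auto
    have cl: "y \<circ> z \<in> X - ?C" if z: "z \<in> X - ?C" and y: "y \<in> Y" for z y
    proof -
      have "y \<circ> z \<notin> ?C"
      proof
        assume "y \<circ> z \<in> ?C"
        then obtain y' where y': "y' \<in> Y" "y \<circ> z = y' \<circ> x" by auto
        have "z = inv' y \<circ> (y \<circ> z)" using WB_inv_apply(3)[of y r] y grp by (auto simp: o_assoc)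
        also have "\<dots> = (inv' y \<circ> y') \<circ> x" by (simp add: y'(2) o_assoc)
        finally have "z \<in> ?C" using y' y grp by (intro image_eqI[of _ _ "inv' y \<circ> y'"]) auto
        thus False using z by simp
      qed
      thus ?thesis using less.prems(2) z y by simp
    qed
    have "card (X - ?C) < card X" using fin C x by (intro psubset_card_mono) auto
    hence "P (X - ?C)" using less.hyps[of "X - ?C"] less.prems(1) cl by blast
    hence "P (?C \<union> (X - ?C))" using coset[OF xw, of "X - ?C"] less.prems(1) cl by blast
    thus ?thesis using C by (simp add: Un_absorb1)
  qed (simp add: empty)
qed

lemma coset_rebase_right:
  assumes grp: "Y \<subseteq> WB r \<and> id \<in> Y \<and> (\<forall>x\<in>Y. \<forall>y\<in>Y. x \<circ> y \<in> Y) \<and> (\<forall>x\<in>Y. inv' x \<in> Y)"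
    and v: "v \<in> Y"
  shows "(\<lambda>y. (x \<circ> v) \<circ> y) ` Y = (\<lambda>y. x \<circ> y) ` Y"
proof (intro equalityI subsetI)
  fix z assume "z \<in> (\<lambda>y. x \<circ> v \<circ> y) ` Y"
  then obtain y where "y \<in> Y" "z = x \<circ> (v \<circ> y)" by (auto simp: o_assoc)
  thus "z \<in> (\<lambda>y. x \<circ> y) ` Y" using grp v by blast
next
  fix z assume "z \<in> (\<lambda>y. x \<circ> y) ` Y"
  then obtain y where y: "y \<in> Y" "z = x \<circ> y" by auto
  have "v \<in> WB r" using grp v by auto
  from WB_inv_apply(4)[OF this] have "z = x \<circ> v \<circ> (inv' v \<circ> y)" unfolding y(2)
    by (metis comp_id o_assoc)
  moreover have "inv' v \<circ> y \<in> Y" using grp v y by blast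
  ultimately show "z \<in> (\<lambda>y. x \<circ> v \<circ> y) ` Y" by (rule image_eqI)
qed

lemma coset_rebase_left:
  assumes grp: "Y \<subseteq> WB r \<and> id \<in> Y \<and> (\<forall>x\<in>Y. \<forall>y\<in>Y. x \<circ> y \<in> Y) \<and> (\<forall>x\<in>Y. inv' x \<in> Y)"
    and v: "v \<in> Y"
  shows "(\<lambda>y. y \<circ> (v \<circ> x)) ` Y = (\<lambda>y. y \<circ> x) ` Y"
proof (intro equalityI subsetI)
  fix z assume "z \<in> (\<lambda>y. y \<circ> (v \<circ> x)) ` Y"
  then obtain y where "y \<in> Y" "z = (y \<circ> v) \<circ> x" by (auto simp: o_assoc)
  thus "z \<in> (\<lambda>y. y \<circ> x) ` Y" using grp v by blast
next
  fix z assume "z \<in> (\<lambda>y. y \<circ> x) ` Y"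
  then obtain y where y: "y \<in> Y" "z = y \<circ> x" by auto
  have "v \<in> WB r" using grp v by auto
  from WB_inv_apply(3)[OF this] have "z = (y \<circ> inv' v) \<circ> (v \<circ> x)" unfolding y(2)
    by (metis comp_id o_assoc)
  moreover have "y \<circ> inv' v \<in> Y" using grp v y by blast
  ultimately show "z \<in> (\<lambda>y. y \<circ> (v \<circ> x)) ` Y" by (rule image_eqI)
qed

text \<open>The sum over a coset \<open>x Y\<close> is \<open>T\<^sub>u\<close> times the sum over \<open>Y\<close>, where \<open>u\<close> is a representative with which the
  elements of \<open>Y\<close> have multiplicative basis elements; the factors of several cosets are added.\<close>

lemma right_factor:
  assumes r: "r \<ge> 2"
    and grp: "Y \<subseteq> WB r \<and> id \<in> Y \<and> (\<forall>x\<in>Y. \<forall>y\<in>Y. x \<circ> y \<in> Y) \<and> (\<forall>x\<in>Y. inv' x \<in> Y)"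
    and rep: "\<And>x. x \<in> WB r \<Longrightarrow> \<exists>v\<in>Y. \<forall>y\<in>Y. heq r (tw r (x \<circ> v) * tw r y) (tw r (x \<circ> v \<circ> y))"
    and X: "X \<subseteq> WB r" "\<And>x y. x \<in> X \<Longrightarrow> y \<in> Y \<Longrightarrow> x \<circ> y \<in> X"
  shows "\<exists>K\<in>FA r. heq r (K * TS r Y) (TS r X)"
proof (rule peel_right[where Y = Y and X = X and P = "\<lambda>X. \<exists>K\<in>FA r. heq r (K * TS r Y) (TS r X)"])
  show "\<exists>K\<in>FA r. heq r (K * TS r Y) (TS r {})" by (intro bexI[of _ 0] FA_zero) (simp add: TS_def heq_refl[OF r FA_zero])
next
  fix x Z
  assume coset: "x \<in> WB r" "Z \<subseteq> WB r" "\<And>x y. x \<in> Z \<Longrightarrow> y \<in> Y \<Longrightarrow> x \<circ> y \<in> Z"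
    "(\<lambda>y. x \<circ> y) ` Y \<inter> Z = {}" "\<exists>K\<in>FA r. heq r (K * TS r Y) (TS r Z)"
  from coset(5) obtain K where K: "K \<in> FA r" "heq r (K * TS r Y) (TS r Z)" by blast
  obtain v where v: "v \<in> Y" "\<forall>y\<in>Y. heq r (tw r (x \<circ> v) * tw r y) (tw r (x \<circ> v \<circ> y))"
    using rep[OF coset(1)] by blast
  have u: "x \<circ> v \<in> WB r" using coset(1) v grp WB_comp by blast
  have "heq r (tw r (x \<circ> v) * TS r Y) (TS r ((\<lambda>y. (x \<circ> v) \<circ> y) ` Y))"
    using v(2) by (intro TS_translate_left[OF r tw_FA[OF r u] u]) auto
  hence 1: "heq r (tw r (x \<circ> v) * TS r Y) (TS r ((\<lambda>y. x \<circ> y) ` Y))"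
    unfolding coset_rebase_right[OF grp v(1)] .
  have "(\<lambda>y. x \<circ> y) ` Y \<subseteq> WB r" using coset(1) grp WB_comp by blast
  hence "TS r ((\<lambda>y. x \<circ> y) ` Y \<union> Z) = TS r ((\<lambda>y. x \<circ> y) ` Y) + TS r Z"
    using TS_Un coset by blast
  moreover have "heq r ((tw r (x \<circ> v) + K) * TS r Y) (TS r ((\<lambda>y. x \<circ> y) ` Y) + TS r Z)"
    unfolding distrib_right by (rule heq_add[OF r 1 K(2)])
  ultimately show "\<exists>K\<in>FA r. heq r (K * TS r Y) (TS r ((\<lambda>y. x \<circ> y) ` Y \<union> Z))"
    using FA_add[OF tw_FA[OF r u] K(1)] by auto
qed (use X grp in blast)+

text \<open>For the other side the cofactor is required to lie in the subalgebra of type D, which is the case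
  when the set consists of elements of type D.\<close>

lemma left_factor:
  assumes r: "r \<ge> 2"
    and grp: "Y \<subseteq> WB r \<and> id \<in> Y \<and> (\<forall>x\<in>Y. \<forall>y\<in>Y. x \<circ> y \<in> Y) \<and> (\<forall>x\<in>Y. inv' x \<in> Y)"
    and YD: "Y \<subseteq> WD r"
    and rep: "\<And>x. x \<in> WB r \<Longrightarrow> \<exists>v\<in>Y. \<forall>y\<in>Y. heq r (tw r y * tw r (v \<circ> x)) (tw r (y \<circ> (v \<circ> x)))"
    and X: "X \<subseteq> WB r" "\<And>x y. x \<in> X \<Longrightarrow> y \<in> Y \<Longrightarrow> y \<circ> x \<in> X"
  shows "X \<subseteq> WD r \<longrightarrow> (\<exists>K\<in>FA r. cls r K \<in> heckeD r \<and> heq r (TS r Y * K) (TS r X))"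
proof (rule peel_left[where Y = Y and X = X and P = "\<lambda>X. X \<subseteq> WD r \<longrightarrow> (\<exists>K\<in>FA r. cls r K \<in> heckeD r \<and> heq r (TS r Y * K) (TS r X))"])
  show "{} \<subseteq> WD r \<longrightarrow> (\<exists>K\<in>FA r. cls r K \<in> heckeD r \<and> heq r (TS r Y * K) (TS r {}))" by (intro impI bexI[of _ 0] FA_zero) (simp add: TS_def heq_refl[OF r FA_zero] heckeD_zero)
next
  fix x Z
  assume coset: "x \<in> WB r" "Z \<subseteq> WB r" "\<And>x y. x \<in> Z \<Longrightarrow> y \<in> Y \<Longrightarrow> y \<circ> x \<in> Z"
    "(\<lambda>y. y \<circ> x) ` Y \<inter> Z = {}" "Z \<subseteq> WD r \<longrightarrow> (\<exists>K\<in>FA r. cls r K \<in> heckeD r \<and> heq r (TS r Y * K) (TS r Z))"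
  show "(\<lambda>y. y \<circ> x) ` Y \<union> Z \<subseteq> WD r \<longrightarrow> (\<exists>K\<in>FA r. cls r K \<in> heckeD r \<and> heq r (TS r Y * K) (TS r ((\<lambda>y. y \<circ> x) ` Y \<union> Z)))"
  proof
    assume D: "(\<lambda>y. y \<circ> x) ` Y \<union> Z \<subseteq> WD r"
    with coset(5) obtain K where K: "K \<in> FA r" "cls r K \<in> heckeD r" "heq r (TS r Y * K) (TS r Z)" by blast
    obtain v where v: "v \<in> Y" "\<forall>y\<in>Y. heq r (tw r y * tw r (v \<circ> x)) (tw r (y \<circ> (v \<circ> x)))"
      using rep[OF coset(1)] by blast
    have u: "v \<circ> x \<in> WB r" using coset(1) v grp WB_comp by blast
    have uD: "v \<circ> x \<in> WD r" using D v by blast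
    have "heq r (TS r Y * tw r (v \<circ> x)) (TS r ((\<lambda>y. y \<circ> (v \<circ> x)) ` Y))"
      using v(2) by (intro TS_translate_right[OF r tw_FA[OF r u] u]) auto
    hence 1: "heq r (TS r Y * tw r (v \<circ> x)) (TS r ((\<lambda>y. y \<circ> x) ` Y))"
      unfolding coset_rebase_left[OF grp v(1)] .
    have "(\<lambda>y. y \<circ> x) ` Y \<subseteq> WB r" using coset(1) grp WB_comp by blast
    hence "TS r ((\<lambda>y. y \<circ> x) ` Y \<union> Z) = TS r ((\<lambda>y. y \<circ> x) ` Y) + TS r Z"
      using TS_Un coset by blast
    moreover have "heq r (TS r Y * (tw r (v \<circ> x) + K)) (TS r ((\<lambda>y. y \<circ> x) ` Y) + TS r Z)"
      unfolding distrib_left by (rule heq_add[OF r 1 K(3)])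
    moreover have "cls r (tw r (v \<circ> x) + K) \<in> heckeD r"
      using heckeD_add[OF tw_heckeD[OF r uD] K(2)] hecke_add[OF r tw_FA[OF r u] K(1)] by simp
    ultimately show "\<exists>K\<in>FA r. cls r K \<in> heckeD r \<and> heq r (TS r Y * K) (TS r ((\<lambda>y. y \<circ> x) ` Y \<union> Z))"
      using FA_add[OF tw_FA[OF r u] K(1)] by auto
  qed
qed (use X grp in blast)+

text \<open>An element of least length in a union of cosets has no descent inside a block, since the descent
  could be removed within the coset.\<close>

lemma min_incr:
  assumes l: "labelling r c \<rho>" and d: "d \<in> X" "X \<subseteq> WB r" and min: "\<And>x. x \<in> X \<Longrightarrow> lenB r d \<le> lenB r x"
    and cl: "\<And>x v. x \<in> X \<Longrightarrow> v \<in> stab r \<rho> \<Longrightarrow> x \<circ> v \<in> X"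
  shows "incr r \<rho> d"
  unfolding incr_def
proof (intro ballI impI)
  fix k assume k: "k \<in> {1..r}" "\<rho> k = \<rho> (k+1)"
  show "d k < d (k+1)"
    using lenB_down[of d r k] d k min[OF cl[OF d(1) sB_stab[OF l k]]] by fastforce
qed

lemma min_incr_inv:
  assumes l: "labelling r c \<rho>" and d: "d \<in> X" "X \<subseteq> WB r" and min: "\<And>x. x \<in> X \<Longrightarrow> lenB r d \<le> lenB r x"
    and cl: "\<And>x v. x \<in> X \<Longrightarrow> v \<in> stab r \<rho> \<Longrightarrow> v \<circ> x \<in> X"
  shows "incr r \<rho> (inv' d)"
  unfolding incr_def
proof (intro ballI impI)
  fix k assume k: "k \<in> {1..r}" "\<rho> k = \<rho> (k+1)"
  have dw: "d \<in> WB r" using d by auto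
  have "lenB r (sB r k \<circ> d) = lenB r (inv' d \<circ> sB r k)"
    using lenB_inv[OF WB_comp[OF sB_WB[OF k(1)] dw]] incr_inv_sB[OF k(1) dw] by simp
  thus "inv' d k < inv' d (k+1)"
    using lenB_down[OF WB_inv[OF dw] k(1)] lenB_inv[OF dw] min[OF cl[OF d(1) sB_stab[OF l k]]] by fastforce
qed

lemma exists_min_length:
  assumes "X \<noteq> {}" obtains d where "d \<in> X" "\<And>x. x \<in> X \<Longrightarrow> (f :: (nat \<Rightarrow> nat) \<Rightarrow> nat) d \<le> f x"
  using ex_has_least_nat[of "\<lambda>x. x \<in> X" _ f] assms by blast

lemma exists_incr_right:
  assumes l: "labelling r c \<rho>" and w: "w \<in> WB r"
  shows "\<exists>v\<in>stab r \<rho>. incr r \<rho> (w \<circ> v)"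
proof -
  let ?X = "(\<lambda>v. w \<circ> v) ` stab r \<rho>"
  have X: "?X \<noteq> {}" "?X \<subseteq> WB r" using stab_id stab_WB w WB_comp by (blast, blast)
  obtain d where d: "d \<in> ?X" "\<And>x. x \<in> ?X \<Longrightarrow> lenB r d \<le> lenB r x"
    using exists_min_length[OF X(1)] by blast
  have cl: "x \<circ> v \<in> ?X" if x: "x \<in> ?X" and v: "v \<in> stab r \<rho>" for x v
  proof -
    obtain u where "u \<in> stab r \<rho>" "x = w \<circ> u" using x by blast
    thus ?thesis using stab_comp[OF _ v] by (intro image_eqI[of _ _ "u \<circ> v"]) (auto simp: o_assoc)
  qed
  have "incr r \<rho> d" by (rule min_incr[OF l d(1) X(2) d(2) cl])
  thus ?thesis using d by auto
qed

lemma exists_incr_left: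
  assumes l: "labelling r c \<rho>" and w: "w \<in> WB r"
  shows "\<exists>v\<in>stab r \<rho>. incr r \<rho> (inv' (v \<circ> w))"
proof -
  obtain v where v: "v \<in> stab r \<rho>" "incr r \<rho> (inv' w \<circ> v)" using exists_incr_right[OF l WB_inv[OF w]] by blast
  have vw: "v \<in> WB r" using v stab_WB by auto
  have "inv' (inv' v \<circ> w) = inv' w \<circ> v" using WB_inv_comp[OF WB_inv[OF vw] w] vw by simp
  thus ?thesis using v stab_inv[OF v(1)] by metis
qed

lemma stab_grp: "stab r \<rho> \<subseteq> WB r \<and> id \<in> stab r \<rho> \<and> (\<forall>x\<in>stab r \<rho>. \<forall>y\<in>stab r \<rho>. x \<circ> y \<in> stab r \<rho>)
   \<and> (\<forall>x\<in>stab r \<rho>. inv' x \<in> stab r \<rho>)"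
  using stab_WB stab_id stab_comp stab_inv by blast

section \<open>The labelling of a composition\<close>

definition ps :: "nat \<Rightarrow> (nat \<Rightarrow> nat) \<Rightarrow> nat \<Rightarrow> nat" where
  "ps n l i = (\<Sum>k\<in>{1..i}. hat n l k)"

definition lab :: "nat \<Rightarrow> (nat \<Rightarrow> nat) \<Rightarrow> nat \<Rightarrow> nat" where
  "lab n l x = (LEAST i. x \<le> ps n l i)"

lemma ps_0: "ps n l 0 = 0" and ps_Suc: "ps n l (Suc i) = ps n l i + hat n l (Suc i)"
  by (simp_all add: ps_def)

lemma ps_mono: "i \<le> j \<Longrightarrow> ps n l i \<le> ps n l j"
  unfolding ps_def by (intro sum_mono2) auto

lemma ps_low: "i \<le> n \<Longrightarrow> ps n l i = (\<Sum>k\<in>{1..i}. l k)"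
  unfolding ps_def by (intro sum.cong) (auto simp: hat_def)

lemma hat_sym: "k \<in> {1..2*n+1} \<Longrightarrow> hat n l (2*n+2-k) = hat n l k"
  by (auto simp: hat_def)

lemma ps_mirror:
  assumes "i \<le> 2*n+1" shows "ps n l (2*n+1-i) + ps n l i = ps n l (2*n+1)"
proof -
  have "ps n l i = (\<Sum>k\<in>{2*n+2-i..2*n+1}. hat n l k)" unfolding ps_def
    by (rule sum.reindex_bij_witness[of _ "\<lambda>k. 2*n+2-k" "\<lambda>k. 2*n+2-k"]) (use assms hat_sym[of _ n l] in auto)
  moreover have "ps n l (2*n+1) = ps n l (2*n+1-i) + (\<Sum>k\<in>{2*n+2-i..2*n+1}. hat n l k)"
  proof -
    have "{1..2*n+1} = {1..2*n+1-i} \<union> {2*n+2-i..2*n+1}" using assms by auto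
    moreover have "{1..2*n+1-i} \<inter> {2*n+2-i..2*n+1} = {}" by auto
    ultimately show ?thesis unfolding ps_def by (simp only: sum.union_disjoint finite_atLeastAtMost)
  qed
  ultimately show ?thesis by simp
qed

lemma ps_half:
  assumes "l \<in> Lam (n+1) r"
  shows "ps n l n + l (n+1) = r" "ps n l (n+1) = r + l (n+1)" "ps n l (2*n+1) = 2*r"
proof -
  show a: "ps n l n + l (n+1) = r" using assms by (simp add: ps_low Lam_def)
  have "ps n l (n+1) = ps n l n + 2 * l (n+1)" by (simp add: ps_Suc hat_def)
  thus b: "ps n l (n+1) = r + l (n+1)" using a by simp
  show "ps n l (2*n+1) = 2*r" using ps_mirror[of n n l] a b by simp
qed

lemma lab_le_iff:
  assumes l: "l \<in> Lam (n+1) r" and x: "x \<le> 2*r"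
  shows "lab n l x \<le> i \<longleftrightarrow> x \<le> ps n l i"
proof
  assume "lab n l x \<le> i"
  moreover have "x \<le> ps n l (lab n l x)" unfolding lab_def
    by (rule LeastI[of _ "2*n+1"]) (use x ps_half(3)[OF l] in simp)
  ultimately show "x \<le> ps n l i" using ps_mono by (meson le_trans)
next
  assume "x \<le> ps n l i"
  thus "lab n l x \<le> i" unfolding lab_def by (rule Least_le)
qed

lemma lab_range:
  assumes l: "l \<in> Lam (n+1) r" and x: "x \<in> {1..2*r}"
  shows "lab n l x \<in> {1..2*n+1}"
  using lab_le_iff[OF l, of x 0] lab_le_iff[OF l, of x "2*n+1"] ps_half(3)[OF l] x by (auto simp: ps_0)

lemma lab_mirror:
  assumes l: "l \<in> Lam (n+1) r" and x: "x \<in> {1..2*r}"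
  shows "lab n l x + lab n l (2*r+1-x) = 2*n+2"
proof -
  have x': "2*r+1-x \<in> {1..2*r}" "2*r+1-x \<le> 2*r" "x \<le> 2*r" using x by auto
  have *: "lab n l (2*r+1-x) \<le> i \<longleftrightarrow> 2*n+2 - lab n l x \<le> i" if i: "i \<le> 2*n+1" for i
  proof -
    have "lab n l (2*r+1-x) \<le> i \<longleftrightarrow> 2*r+1-x \<le> ps n l i" by (rule lab_le_iff[OF l x'(2)])
    also have "\<dots> \<longleftrightarrow> \<not> x \<le> ps n l (2*n+1-i)" using ps_mirror[OF i, of l] ps_half(3)[OF l] x by auto
    also have "\<dots> \<longleftrightarrow> \<not> lab n l x \<le> 2*n+1-i" using lab_le_iff[OF l x'(3)] by simp
    also have "\<dots> \<longleftrightarrow> 2*n+2 - lab n l x \<le> i" using i lab_range[OF l x] by auto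
    finally show ?thesis .
  qed
  have r: "lab n l x \<in> {1..2*n+1}" "lab n l (2*r+1-x) \<in> {1..2*n+1}" using lab_range[OF l] x x' by blast+
  have "lab n l (2*r+1-x) = 2*n+2 - lab n l x"
    using *[of "lab n l (2*r+1-x)"] *[of "2*n+2 - lab n l x"] r by (intro antisym) auto
  thus ?thesis using r by auto
qed

lemma lab_labelling: "l \<in> Lam (n+1) r \<Longrightarrow> labelling r (2*n+2) (lab n l)"
  unfolding labelling_def
proof (intro conjI allI impI ballI)
  fix x y assume l: "l \<in> Lam (n+1) r" and xy: "1 \<le> x \<and> x \<le> y \<and> y \<le> 2*r"
  thus "lab n l x \<le> lab n l y" using lab_le_iff[OF l, of y "lab n l y"] lab_le_iff[OF l, of x "lab n l y"] by auto
qed (rule lab_mirror)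

lemma block_iff:
  assumes l: "l \<in> Lam (n+1) r" and i: "i \<in> {1..2*n+1}"
  shows "x \<in> block (hat n l) i \<longleftrightarrow> x \<in> {1..2*r} \<and> lab n l x = i"
proof -
  obtain j where j: "i = Suc j" using i by (cases i) auto
  have "x \<in> block (hat n l) i \<longleftrightarrow> ps n l j < x \<and> x \<le> ps n l i"
    by (simp add: block_def ps_def j atLeastLessThanSuc_atLeastAtMost)
  moreover have "ps n l i \<le> 2*r" using ps_mono[of i "2*n+1" n l] ps_half(3)[OF l] i by auto
  ultimately show ?thesis using lab_le_iff[OF l, of x i] lab_le_iff[OF l, of x j] j
    by (cases "x \<le> 2*r") auto
qed

lemma card_lab:
  assumes l: "l \<in> Lam (n+1) r" and i: "i \<in> {1..2*n+1}"
  shows "card {x\<in>{1..2*r}. lab n l x = i} = hat n l i"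
proof -
  obtain j where j: "i = Suc j" using i by (cases i) auto
  have "{x\<in>{1..2*r}. lab n l x = i} = block (hat n l) i" using block_iff[OF l i] by blast
  also have "\<dots> = {ps n l j<..ps n l i}"
    by (auto simp: block_def ps_def j atLeastLessThanSuc_atLeastAtMost)
  finally show ?thesis by (simp add: j ps_Suc)
qed

lemma lab_r_iff:
  assumes l: "l \<in> Lam (n+1) r" and r: "r \<ge> 1"
  shows "lab n l r = lab n l (r+1) \<longleftrightarrow> l (n+1) \<noteq> 0"
proof -
  have m: "lab n l r + lab n l (r+1) = 2*n+2" using lab_mirror[OF l, of r] r by (simp add: Suc_diff_le mult_2)
  have "lab n l r \<le> n \<longleftrightarrow> l (n+1) = 0" using lab_le_iff[OF l, of r n] ps_half(1)[OF l] by auto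
  moreover have "lab n l r \<le> n+1" using lab_le_iff[OF l, of r "n+1"] ps_half(2)[OF l] by auto
  ultimately show ?thesis using m by linarith
qed

lemma lab_le_n:
  assumes l: "l \<in> Lam (n+1) r" and "l (n+1) = 0" and "x \<in> {1..2*r}"
  shows "lab n l x \<le> n \<longleftrightarrow> x \<le> r"
  using lab_le_iff[OF l, of x n] ps_half(1)[OF l] assms by auto

text \<open>The generators of a parabolic subgroup are the adjacent pairs of positions with equal labels. In
  the right half of the labelling nothing new happens, because a step at \<open>k \<le> r\<close> starts from a label
  at most \<open>n\<close>.\<close>

lemma lab_step_iff:
  assumes l: "l \<in> Lam (n+1) r" and k: "k \<in> {1..r}"
  shows "lab n l k = lab n l (k+1) \<longleftrightarrow> k \<notin> {\<Sum>k\<in>{1..i}. l k | i. i \<in> {1..n}}"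
proof
  assume e: "lab n l k = lab n l (k+1)"
  show "k \<notin> {\<Sum>k\<in>{1..i}. l k | i. i \<in> {1..n}}"
  proof
    assume "k \<in> {\<Sum>k\<in>{1..i}. l k | i. i \<in> {1..n}}"
    then obtain i where "i \<in> {1..n}" "k = ps n l i" by (auto simp: ps_low)
    thus False using lab_le_iff[OF l, of k i] lab_le_iff[OF l, of "k+1" i] e k by auto
  qed
next
  assume n: "k \<notin> {\<Sum>k\<in>{1..i}. l k | i. i \<in> {1..n}}"
  show "lab n l k = lab n l (k+1)"
  proof (rule ccontr)
    assume ne: "lab n l k \<noteq> lab n l (k+1)"
    have lab: "labelling r (2*n+2) (lab n l)" using lab_labelling[OF l] .
    have lt: "lab n l k < lab n l (k+1)" using labelling_mono[OF lab, of k "k+1"] ne k by auto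
    define i where "i = lab n l k"
    have ki: "k \<le> ps n l i" "\<not> k + 1 \<le> ps n l i"
      using lab_le_iff[OF l, of k i] lab_le_iff[OF l, of "k+1" i] lt k by (auto simp: i_def)
    have i1: "i \<ge> 1" using lab_range[OF l, of k] k by (auto simp: i_def)
    have "lab n l (k+1) \<le> lab n l (2*r+1-k)" by (rule labelling_mono[OF lab]) (use k in auto)
    hence "i \<le> n" using lab_mirror[OF l, of k] lt k by (auto simp: i_def)
    hence "k = (\<Sum>k\<in>{1..i}. l k)" "i \<in> {1..n}" using ki i1 ps_low[of i n l] by auto
    thus False using n by blast
  qed
qed

lemma Wpar_stab:
  assumes l: "l \<in> Lam (n+1) r"
  shows "Wpar n r l = stab r (lab n l)"
proof -
  have "{j\<in>{1..r}. j \<notin> {\<Sum>k\<in>{1..i}. l k | i. i \<in> {1..n}}} = {k\<in>{1..r}. lab n l k = lab n l (k+1)}"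
    using lab_step_iff[OF l] by blast
  thus ?thesis unfolding Wpar_def using stab_generate[OF lab_labelling[OF l]] by simp
qed

lemma hat_inj:
  assumes "l \<in> Lam (n+1) r" "l' \<in> Lam (n+1) r" "hat n l = hat n l'" shows "l = l'"
proof
  fix i
  consider "i \<in> {1..n}" | "i = n+1" | "i \<notin> {1..n+1}" by fastforce
  thus "l i = l' i"
  proof cases
    case 1 thus ?thesis using fun_cong[OF assms(3), of i] by (simp add: hat_def)
  next
    case 2 thus ?thesis using fun_cong[OF assms(3), of i] by (simp add: hat_def)
  next
    case 3 thus ?thesis using assms(1,2) by (auto simp: Lam_def)
  qed
qed

lemma unhat_hat: "l \<in> Lam (n+1) r \<Longrightarrow> unhat n r (hat n l) = l"
  unfolding unhat_def by (rule the_equality) (use hat_inj in blast)+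

lemma coset_mat_card:
  assumes l: "l \<in> Lam (n+1) r" and m: "m \<in> Lam (n+1) r" and d: "d \<in> WB r"
    and ij: "i \<in> {1..2*n+1}" "j \<in> {1..2*n+1}"
  shows "coset_mat n l d m i j = card {y\<in>{1..2*r}. lab n l (d y) = i \<and> lab n m y = j}"
proof -
  have "block (hat n l) i \<inter> d ` block (hat n m) j = d ` {y\<in>{1..2*r}. lab n l (d y) = i \<and> lab n m y = j}"
    using block_iff[OF l ij(1)] block_iff[OF m ij(2)] WB_in[OF d] by (auto simp del: atLeastAtMost_iff)
  moreover have "inj_on d S" for S using WB_inj[OF d] by (auto intro: inj_onI)
  ultimately show ?thesis using ij by (simp add: coset_mat_def card_image)
qed

lemma coset_mat_outside: "i \<notin> {1..2*n+1} \<or> j \<notin> {1..2*n+1} \<Longrightarrow> coset_mat n l d m i j = 0"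
  by (auto simp: coset_mat_def)

text \<open>The count over positions; in the multiplication formula the row label of a position changes.\<close>

lemma coset_mat_card':
  assumes l: "l \<in> Lam (n+1) r" and m: "m \<in> Lam (n+1) r" and d: "d \<in> WB r"
    and ij: "i \<in> {1..2*n+1}" "j \<in> {1..2*n+1}"
  shows "coset_mat n l d m i j = card {x\<in>{1..2*r}. lab n l x = i \<and> lab n m (inv' d x) = j}"
proof -
  have "{x\<in>{1..2*r}. lab n l x = i \<and> lab n m (inv' d x) = j} = d ` {y\<in>{1..2*r}. lab n l (d y) = i \<and> lab n m y = j}"
    (is "?L = d ` ?R")
  proof (intro equalityI subsetI)
    fix x assume "x \<in> ?L"
    moreover have "x = d (inv' d x)" using d by simp
    ultimately show "x \<in> d ` ?R" using WB_in[OF WB_inv[OF d], of x] by (intro image_eqI[of _ _ "inv' d x"]) auto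
  next
    fix x assume "x \<in> d ` ?R"
    then obtain y where "y \<in> ?R" "x = d y" by blast
    thus "x \<in> ?L" using d WB_in[OF d, of y] by auto
  qed
  moreover have "inj_on d S" for S using WB_inj[OF d] by (auto intro: inj_onI)
  ultimately show ?thesis unfolding coset_mat_card[OF assms] by (simp add: card_image)
qed

lemma card_sum_fibres:
  assumes "finite S" "\<And>x. x \<in> S \<Longrightarrow> f x \<in> J" "finite J"
  shows "(\<Sum>j\<in>J. card {x\<in>S. f x = j}) = card S"
proof -
  have "card S = card (\<Union>j\<in>J. {x\<in>S. f x = j})" using assms(2) by (intro arg_cong[of _ _ card]) auto
  also have "\<dots> = (\<Sum>j\<in>J. card {x\<in>S. f x = j})" using assms by (intro card_UN_disjoint) auto
  finally show ?thesis by simp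
qed

lemma ro_coset_mat:
  assumes l: "l \<in> Lam (n+1) r" and m: "m \<in> Lam (n+1) r" and d: "d \<in> WB r"
  shows "ro n (coset_mat n l d m) = hat n l"
proof
  fix i
  show "ro n (coset_mat n l d m) i = hat n l i"
  proof (cases "i \<in> {1..2*n+1}")
    case True
    let ?S = "{x\<in>{1..2*r}. lab n l x = i}"
    have "ro n (coset_mat n l d m) i = (\<Sum>j\<in>{1..2*n+1}. card {x\<in>?S. lab n m (inv' d x) = j})"
      unfolding ro_def
    proof (rule sum.cong[OF refl])
      fix j assume j: "j \<in> {1..2*n+1}"
      show "coset_mat n l d m i j = card {x\<in>?S. lab n m (inv' d x) = j}"
        unfolding coset_mat_card'[OF assms True j] by (rule arg_cong[of _ _ card]) blast
    qed
    also have "\<dots> = card ?S"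
      by (rule card_sum_fibres) (use lab_range[OF m] WB_in[OF WB_inv[OF d]] in \<open>simp, blast, simp\<close>)
    finally show ?thesis using card_lab[OF l True] by simp
  qed (auto simp: ro_def coset_mat_outside hat_def)
qed

lemma co_coset_mat:
  assumes l: "l \<in> Lam (n+1) r" and m: "m \<in> Lam (n+1) r" and d: "d \<in> WB r"
  shows "co n (coset_mat n l d m) = hat n m"
proof
  fix j
  show "co n (coset_mat n l d m) j = hat n m j"
  proof (cases "j \<in> {1..2*n+1}")
    case True
    let ?S = "{x\<in>{1..2*r}. lab n m x = j}"
    have "co n (coset_mat n l d m) j = (\<Sum>i\<in>{1..2*n+1}. card {x\<in>?S. lab n l (d x) = i})"
      unfolding co_def
    proof (rule sum.cong[OF refl])
      fix i assume i: "i \<in> {1..2*n+1}"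
      show "coset_mat n l d m i j = card {x\<in>?S. lab n l (d x) = i}"
        unfolding coset_mat_card[OF assms i True] by (rule arg_cong[of _ _ card]) blast
    qed
    also have "\<dots> = card ?S"
      by (rule card_sum_fibres) (use lab_range[OF l] WB_in[OF d] in \<open>simp, blast, simp\<close>)
    finally show ?thesis using card_lab[OF m True] by simp
  qed (auto simp: co_def coset_mat_outside hat_def)
qed

lemma coset_mat_right:
  assumes l: "l \<in> Lam (n+1) r" and m: "m \<in> Lam (n+1) r" and d: "d \<in> WB r" and v: "v \<in> stab r (lab n m)"
  shows "coset_mat n l (d \<circ> v) m = coset_mat n l d m"
proof (intro ext)
  fix i j
  have vw: "v \<in> WB r" using v stab_WB by auto
  have e: "inv' (d \<circ> v) x = inv' v (inv' d x)" for x using WB_inv_comp[OF d vw] by simp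
  have "lab n m (inv' (d \<circ> v) x) = lab n m (inv' d x)" if "x \<in> {1..2*r}" for x
    unfolding e by (rule stab_apply[OF stab_inv[OF v]]) (use WB_in[OF WB_inv[OF d]] that in blast)
  hence *: "{x\<in>{1..2*r}. lab n l x = i \<and> lab n m (inv' (d \<circ> v) x) = j} = {x\<in>{1..2*r}. lab n l x = i \<and> lab n m (inv' d x) = j}"
    by (intro Collect_cong) (simp cong: conj_cong del: atLeastAtMost_iff o_apply)
  show "coset_mat n l (d \<circ> v) m i j = coset_mat n l d m i j"
  proof (cases "i \<in> {1..2*n+1} \<and> j \<in> {1..2*n+1}")
    case True
    hence ij: "i \<in> {1..2*n+1}" "j \<in> {1..2*n+1}" by blast+
    show ?thesis unfolding coset_mat_card'[OF l m d ij] coset_mat_card'[OF l m WB_comp[OF d vw] ij] * ..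
  qed (simp add: coset_mat_outside)
qed

lemma coset_mat_left:
  assumes l: "l \<in> Lam (n+1) r" and m: "m \<in> Lam (n+1) r" and d: "d \<in> WB r" and u: "u \<in> stab r (lab n l)"
  shows "coset_mat n l (u \<circ> d) m = coset_mat n l d m"
proof (intro ext)
  fix i j
  have uw: "u \<in> WB r" using u stab_WB by auto
  have "lab n l ((u \<circ> d) y) = lab n l (d y)" if "y \<in> {1..2*r}" for y
    using stab_apply[OF u, of "d y"] WB_in[OF d, of y] that by simp
  hence *: "{y\<in>{1..2*r}. lab n l ((u \<circ> d) y) = i \<and> lab n m y = j} = {y\<in>{1..2*r}. lab n l (d y) = i \<and> lab n m y = j}"
    by (intro Collect_cong) (simp cong: conj_cong del: atLeastAtMost_iff o_apply)
  show "coset_mat n l (u \<circ> d) m i j = coset_mat n l d m i j"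
  proof (cases "i \<in> {1..2*n+1} \<and> j \<in> {1..2*n+1}")
    case True
    hence ij: "i \<in> {1..2*n+1}" "j \<in> {1..2*n+1}" by blast+
    show ?thesis unfolding coset_mat_card[OF l m d ij] coset_mat_card[OF l m WB_comp[OF uw d] ij] * ..
  qed (simp add: coset_mat_outside)
qed

section \<open>Double cosets and matrices\<close>

definition cosetB :: "nat \<Rightarrow> nat \<Rightarrow> (nat \<Rightarrow> nat) \<Rightarrow> (nat \<Rightarrow> nat) \<Rightarrow> (nat \<Rightarrow> nat \<Rightarrow> nat) \<Rightarrow> (nat \<Rightarrow> nat) set" where
  "cosetB n r l m A = {w \<in> WB r. coset_mat n l w m = A}"

lemma cosetB_D: "w \<in> cosetB n r l m A \<Longrightarrow> w \<in> WB r" "w \<in> cosetB n r l m A \<Longrightarrow> coset_mat n l w m = A"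
  by (simp_all add: cosetB_def)

lemma cosetB_right:
  assumes "l \<in> Lam (n+1) r" "m \<in> Lam (n+1) r" "w \<in> cosetB n r l m A" "v \<in> stab r (lab n m)"
  shows "w \<circ> v \<in> cosetB n r l m A"
  using coset_mat_right[OF assms(1,2) cosetB_D(1)[OF assms(3)] assms(4)] cosetB_D[OF assms(3)]
    WB_comp[OF cosetB_D(1)[OF assms(3)] subsetD[OF stab_WB assms(4)]] unfolding cosetB_def by blast

lemma cosetB_left:
  assumes "l \<in> Lam (n+1) r" "m \<in> Lam (n+1) r" "w \<in> cosetB n r l m A" "u \<in> stab r (lab n l)"
  shows "u \<circ> w \<in> cosetB n r l m A"
  using coset_mat_left[OF assms(1,2) cosetB_D(1)[OF assms(3)] assms(4)] cosetB_D[OF assms(3)]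
    WB_comp[OF subsetD[OF stab_WB assms(4)] cosetB_D(1)[OF assms(3)]] unfolding cosetB_def by blast

text \<open>Two elements that are increasing on the blocks on both sides and have the same matrix agree: at
  the first position where they differ, the smaller column label would occur more often for one of
  them, and with equal labels the order within the column block is violated.\<close>

lemma bi_incr_first_difference:
  assumes l: "l \<in> Lam (n+1) r" and m: "m \<in> Lam (n+1) r"
    and d: "d \<in> WB r" and d': "d' \<in> WB r" "incr r (lab n m) d'" "incr r (lab n l) (inv' d')"
    and eq: "coset_mat n l d m = coset_mat n l d' m"
    and x: "x \<in> {1..2*r}" and agree: "\<And>z. z \<in> {1..2*r} \<Longrightarrow> z < x \<Longrightarrow> inv' d z = inv' d' z"
  shows "lab n m (inv' d' x) \<le> lab n m (inv' d x)"
    and "lab n m (inv' d x) = lab n m (inv' d' x) \<Longrightarrow> inv' d' x \<le> inv' d x"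
proof -
  have L: "labelling r (2*n+2) (lab n l)" and M: "labelling r (2*n+2) (lab n m)"
    using lab_labelling l m by auto
  have id: "inv' d z \<in> {1..2*r}" "inv' d' z \<in> {1..2*r}" if "z \<in> {1..2*r}" for z
    using WB_in[OF WB_inv[OF d]] WB_in[OF WB_inv[OF d'(1)]] that by blast+
  show "lab n m (inv' d' x) \<le> lab n m (inv' d x)"
  proof (rule ccontr)
    assume lt: "\<not> lab n m (inv' d' x) \<le> lab n m (inv' d x)"
    define i where "i = lab n l x"
    define j where "j = lab n m (inv' d x)"
    have ij: "i \<in> {1..2*n+1}" "j \<in> {1..2*n+1}"
      unfolding i_def j_def using lab_range[OF l x] lab_range[OF m id(1)[OF x]] .
    let ?S = "\<lambda>d. {z\<in>{1..2*r}. lab n l z = i \<and> lab n m (inv' d z) = j}"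
    have "?S d' \<subseteq> ?S d"
    proof
      fix z assume z: "z \<in> ?S d'"
      hence zr: "z \<in> {1..2*r}" and zl: "lab n l z = i" and zm: "lab n m (inv' d' z) = j" by blast+
      have "z < x"
      proof (rule ccontr)
        assume n: "\<not> z < x"
        have "x \<noteq> z" using zm lt unfolding j_def by auto
        hence "x < z" using n by simp
        hence "inv' d' x < inv' d' z"
          using incr_full[OF L WB_inv[OF d'(1)] d'(3), of x z] x zr zl by (simp add: i_def)
        hence "lab n m (inv' d' x) \<le> lab n m (inv' d' z)"
          using labelling_mono[OF M, of "inv' d' x" "inv' d' z"] id(2)[OF x] id(2)[OF zr] by simp
        thus False using lt zm unfolding j_def by simp
      qed
      from agree[OF zr this] zr zl zm show "z \<in> ?S d" by simp
    qed
    moreover have "x \<in> ?S d" using x by (simp add: i_def j_def)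
    moreover have "x \<notin> ?S d'" using lt by (simp add: j_def)
    ultimately have "?S d' \<subset> ?S d" by blast
    hence "card (?S d') < card (?S d)" by (intro psubset_card_mono) auto
    thus False using coset_mat_card'[OF l m d ij] coset_mat_card'[OF l m d'(1) ij] eq by simp
  qed
  show "inv' d' x \<le> inv' d x" if e: "lab n m (inv' d x) = lab n m (inv' d' x)"
  proof (rule ccontr)
    assume n: "\<not> inv' d' x \<le> inv' d x"
    define z where "z = d' (inv' d x)"
    have "z < d' (inv' d' x)" unfolding z_def
      using incr_full[OF M d'(1,2), of "inv' d x" "inv' d' x"] id[OF x] n e by simp
    hence zx: "z < x" using d' by simp
    have "z \<in> {1..2*r}" unfolding z_def using WB_in[OF d'(1)] id(1)[OF x] by blast
    from agree[OF this zx] have "inv' d z = inv' d x" using d' by (simp add: z_def)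
    hence "z = x" using WB_inj[OF WB_inv[OF d]] by blast
    thus False using zx by simp
  qed
qed

lemma bi_incr_unique:
  assumes l: "l \<in> Lam (n+1) r" and m: "m \<in> Lam (n+1) r"
    and d: "d \<in> WB r" "incr r (lab n m) d" "incr r (lab n l) (inv' d)"
    and d': "d' \<in> WB r" "incr r (lab n m) d'" "incr r (lab n l) (inv' d')"
    and eq: "coset_mat n l d m = coset_mat n l d' m"
  shows "d = d'"
proof -
  have *: "x \<in> {1..2*r} \<Longrightarrow> inv' d x = inv' d' x" for x
  proof (induction x rule: less_induct)
    case (less x)
    have a: "inv' d z = inv' d' z" "inv' d' z = inv' d z" if "z \<in> {1..2*r}" "z < x" for z
      using less that by simp_all
    note 1 = bi_incr_first_difference[OF l m d(1) d' eq less.prems a(1)]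
      and 2 = bi_incr_first_difference[OF l m d'(1) d eq[symmetric] less.prems a(2)]
    show ?case using 1 2 by (simp add: antisym)
  qed
  have "inv' d = inv' d'"
  proof
    fix x show "inv' d x = inv' d' x"
    proof (cases "x \<in> {1..2*r}")
      case False
      show ?thesis unfolding permutes_not_in[OF WB_permutes[OF WB_inv[OF d(1)]] False]
        permutes_not_in[OF WB_permutes[OF WB_inv[OF d'(1)]] False] ..
    qed (rule *)
  qed
  hence "inv' (inv' d) = inv' (inv' d')" by (simp only:)
  thus ?thesis unfolding WB_inv_apply(5)[OF d(1)] WB_inv_apply(5)[OF d'(1)] .
qed

lemma dcosetI: "u \<in> X \<Longrightarrow> v \<in> Y \<Longrightarrow> u \<circ> d \<circ> v \<in> dcoset X d Y"
  unfolding dcoset_def by blast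

lemma dcoset_closed:
  assumes "x \<in> dcoset (stab r \<rho>) w (stab r \<sigma>)"
  shows "v \<in> stab r \<sigma> \<Longrightarrow> x \<circ> v \<in> dcoset (stab r \<rho>) w (stab r \<sigma>)"
    "u \<in> stab r \<rho> \<Longrightarrow> u \<circ> x \<in> dcoset (stab r \<rho>) w (stab r \<sigma>)"
proof -
  obtain a b where ab: "a \<in> stab r \<rho>" "b \<in> stab r \<sigma>" "x = a \<circ> w \<circ> b" using assms by (auto simp: dcoset_def)
  show "x \<circ> v \<in> dcoset (stab r \<rho>) w (stab r \<sigma>)" if "v \<in> stab r \<sigma>"
    using dcosetI[OF ab(1) stab_comp[OF ab(2) that], of w] unfolding ab(3) o_assoc .
  show "u \<circ> x \<in> dcoset (stab r \<rho>) w (stab r \<sigma>)" if "u \<in> stab r \<rho>"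
    using dcosetI[OF stab_comp[OF that ab(1)] ab(2), of w] unfolding ab(3) o_assoc .
qed

lemma dcoset_self: "w \<in> dcoset (stab r \<rho>) w (stab r \<sigma>)"
  using dcosetI[OF stab_id[of r \<rho>] stab_id[of r \<sigma>], of w] by (simp only: id_comp comp_id)

lemma dcoset_WB: "w \<in> WB r \<Longrightarrow> dcoset (stab r \<rho>) w (stab r \<sigma>) \<subseteq> WB r"
  unfolding dcoset_def using stab_WB WB_comp by blast

lemma dcoset_cosetB:
  assumes "l \<in> Lam (n+1) r" "m \<in> Lam (n+1) r" "w \<in> cosetB n r l m A"
  shows "dcoset (stab r (lab n l)) w (stab r (lab n m)) \<subseteq> cosetB n r l m A"
  unfolding dcoset_def using cosetB_left[OF assms(1,2)] cosetB_right[OF assms(1,2)] assms(3) by blast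

lemma min_bi_incr:
  assumes l: "l \<in> Lam (n+1) r" and m: "m \<in> Lam (n+1) r" and w: "w \<in> WB r"
    and d: "d \<in> dcoset (stab r (lab n l)) w (stab r (lab n m))"
      "\<And>x. x \<in> dcoset (stab r (lab n l)) w (stab r (lab n m)) \<Longrightarrow> lenB r d \<le> lenB r x"
  shows "incr r (lab n m) d" "incr r (lab n l) (inv' d)"
proof -
  show "incr r (lab n m) d"
    by (rule min_incr[OF lab_labelling[OF m] d(1) dcoset_WB[OF w] d(2) dcoset_closed(1)])
  show "incr r (lab n l) (inv' d)"
    by (rule min_incr_inv[OF lab_labelling[OF l] d(1) dcoset_WB[OF w] d(2) dcoset_closed(2)])
qed

lemma cosetB_eq_dcoset:
  assumes l: "l \<in> Lam (n+1) r" and m: "m \<in> Lam (n+1) r"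
    and w: "w \<in> cosetB n r l m A" and w': "w' \<in> cosetB n r l m A"
  shows "w' \<in> dcoset (stab r (lab n l)) w (stab r (lab n m))"
proof -
  let ?X = "\<lambda>w. dcoset (stab r (lab n l)) w (stab r (lab n m))"
  have ww: "w \<in> WB r" "w' \<in> WB r" using cosetB_D(1)[OF w] cosetB_D(1)[OF w'] .
  obtain d where d: "d \<in> ?X w" "\<And>x. x \<in> ?X w \<Longrightarrow> lenB r d \<le> lenB r x"
    using exists_min_length[of "?X w" "lenB r"] dcoset_self by blast
  obtain d' where d': "d' \<in> ?X w'" "\<And>x. x \<in> ?X w' \<Longrightarrow> lenB r d' \<le> lenB r x"
    using exists_min_length[of "?X w'" "lenB r"] dcoset_self by blast
  have "d \<in> cosetB n r l m A" "d' \<in> cosetB n r l m A" using d(1) d'(1) dcoset_cosetB[OF l m] w w' by blast+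
  hence "d = d'"
    using bi_incr_unique[OF l m _ min_bi_incr[OF l m ww(1) d] _ min_bi_incr[OF l m ww(2) d']]
    by (simp add: cosetB_def)
  hence "d \<in> ?X w'" using d' by simp
  then obtain u v where uv: "u \<in> stab r (lab n l)" "v \<in> stab r (lab n m)" "d = u \<circ> w' \<circ> v"
    unfolding dcoset_def by blast
  have "u \<in> WB r" "v \<in> WB r" using uv stab_WB by auto
  hence "w' = inv' u \<circ> d \<circ> inv' v"
    unfolding uv(3) by (metis (no_types, lifting) WB_inv_apply(3,4) comp_assoc comp_id id_comp)
  thus ?thesis using dcoset_closed(1)[OF dcoset_closed(2)[OF d(1) stab_inv[OF uv(1)]] stab_inv[OF uv(2)]] by simp
qed

text \<open>An element of least length in its double coset is increasing on blocks on both sides, and the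
  matrix determines the compositions through its row and column sums; hence the minimal representative
  is unique and has the stated properties.\<close>

lemma dmat_spec:
  assumes l: "l \<in> Lam (n+1) r" and m: "m \<in> Lam (n+1) r" and w: "w \<in> cosetB n r l m A"
  shows "dmat n r A \<in> cosetB n r l m A" "incr r (lab n m) (dmat n r A)" "incr r (lab n l) (inv' (dmat n r A))"
    "\<And>d. d \<in> cosetB n r l m A \<Longrightarrow> incr r (lab n m) d \<Longrightarrow> incr r (lab n l) (inv' d) \<Longrightarrow> d = dmat n r A"
proof -
  let ?X = "\<lambda>l m w. dcoset (stab r (lab n l)) w (stab r (lab n m))"
  let ?P = "\<lambda>d. \<exists>l\<in>Lam (n+1) r. \<exists>m\<in>Lam (n+1) r. d \<in> WB r \<and>
     is_min_in r (sB r) (dcoset (Wpar n r l) d (Wpar n r m)) d \<and> A = coset_mat n l d m"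
  have ww: "w \<in> WB r" using cosetB_D(1)[OF w] .
  obtain d where d: "d \<in> ?X l m w" "\<And>x. x \<in> ?X l m w \<Longrightarrow> lenB r d \<le> lenB r x"
    using exists_min_length[of "?X l m w" "lenB r"] dcoset_self by blast
  have dB: "d \<in> cosetB n r l m A" using d(1) dcoset_cosetB[OF l m] w by blast
  hence dw: "d \<in> WB r" "coset_mat n l d m = A" by (simp_all add: cosetB_def)
  have inc: "incr r (lab n m) d" "incr r (lab n l) (inv' d)" using min_bi_incr[OF l m ww d] by auto
  have "?X l m d \<subseteq> ?X l m w"
    using dcoset_closed(1)[OF dcoset_closed(2)[OF d(1)]] unfolding dcoset_def by blast
  hence mn: "is_min_in r (sB r) (?X l m d) d" unfolding is_min_in_def
    using d(2) dcoset_self wlenB(1) dw(1) dcoset_WB[OF dw(1)] by (metis (no_types, lifting) subsetD)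
  have uniq: "d' = d" if P: "?P d'" for d'
  proof -
    obtain l' m' where lm: "l' \<in> Lam (n+1) r" "m' \<in> Lam (n+1) r" "d' \<in> WB r"
      "is_min_in r (sB r) (dcoset (Wpar n r l') d' (Wpar n r m')) d'" "A = coset_mat n l' d' m'"
      using P by blast
    have "hat n l' = hat n l" using ro_coset_mat[OF lm(1-3)] ro_coset_mat[OF l m dw(1)] dw(2) lm(5) by simp
    hence l': "l' = l" using hat_inj[OF lm(1) l] by simp
    have "hat n m' = hat n m" using co_coset_mat[OF lm(1-3)] co_coset_mat[OF l m dw(1)] dw(2) lm(5) by simp
    hence m': "m' = m" using hat_inj[OF lm(2) m] by simp
    have min: "lenB r d' \<le> lenB r x" if "x \<in> ?X l m d'" for x
      using lm(4) that wlenB(1)[OF lm(3)] wlenB(1)[of x r] dcoset_WB[OF lm(3)]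
      unfolding is_min_in_def l' m' Wpar_stab[OF l] Wpar_stab[OF m] by (metis (no_types, lifting) subsetD)
    show ?thesis
      using bi_incr_unique[OF l m lm(3) min_bi_incr[OF l m lm(3) dcoset_self min] dw(1) inc] lm(5) dw(2)
      unfolding l' m' by simp
  qed
  have "?P d" using l m dw mn by (metis Wpar_stab)
  hence e: "dmat n r A = d" unfolding dmat_def using uniq by (rule the_equality)
  show "dmat n r A \<in> cosetB n r l m A" "incr r (lab n m) (dmat n r A)" "incr r (lab n l) (inv' (dmat n r A))"
    unfolding e using dB inc by auto
  show "d' = dmat n r A" if "d' \<in> cosetB n r l m A" "incr r (lab n m) d'" "incr r (lab n l) (inv' d')" for d'
    unfolding e using bi_incr_unique[OF l m _ that(2,3) dw(1) inc] that(1) dw(2) by (simp add: cosetB_def)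
qed

section \<open>Double cosets of type D\<close>

lemma s_sign_WB: "r \<ge> 1 \<Longrightarrow> s_sign r e \<in> WB r"
  using WB_id sB_WB by (cases e) (simp_all add: s_sign_def)

lemma s_sign_invol: "r \<ge> 1 \<Longrightarrow> s_sign r e \<circ> s_sign r e = id"
  using sB_comp_sB[of r r] by (cases e) (simp_all add: s_sign_def)

lemma s_sign_cancel:
  assumes "r \<ge> 1"
  shows "s_sign r e \<circ> (s_sign r e \<circ> w) = w" "w \<circ> s_sign r e \<circ> s_sign r e = w"
  using s_sign_invol[OF assms, of e] by (metis comp_assoc comp_id id_comp)+

lemma s_sign_parity: "r \<ge> 1 \<Longrightarrow> even (neg r (s_sign r e)) \<longleftrightarrow> e = Plus"
  using neg_sB[of r r] neg_id[of r] by (cases e) (simp_all add: s_sign_def)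

lemma s_sign_inv: "r \<ge> 1 \<Longrightarrow> inv' (s_sign r e) = s_sign r e"
  by (rule inv_unique_comp[OF s_sign_invol s_sign_invol])

lemma s_sign_lenD:
  assumes "r \<ge> 1" "w \<in> WB r"
  shows "lenD r (s_sign r e \<circ> w \<circ> s_sign r e') = lenD r w"
proof -
  have "lenD r (v \<circ> s_sign r e') = lenD r v" if "v \<in> WB r" for v
    using lenD_sB_r[OF that assms(1)] by (cases e') (simp_all add: s_sign_def)
  moreover have "lenD r (s_sign r e \<circ> w) = lenD r w"
    using lenD_sB_r_left[OF assms(2,1)] by (cases e) (simp_all add: s_sign_def)
  ultimately show ?thesis using WB_comp[OF s_sign_WB assms(2)] assms(1) by simp
qed

lemma s_sign_conj_parity:
  assumes "r \<ge> 1" "w \<in> WB r"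
  shows "s_sign r e \<circ> w \<circ> s_sign r e' \<in> WB r"
    "even (neg r (s_sign r e \<circ> w \<circ> s_sign r e')) \<longleftrightarrow> (even (neg r w) \<longleftrightarrow> e = e')"
proof -
  have w: "s_sign r e \<circ> w \<in> WB r" using WB_comp[OF s_sign_WB[OF assms(1)] assms(2)] .
  show "s_sign r e \<circ> w \<circ> s_sign r e' \<in> WB r" using WB_comp[OF w s_sign_WB[OF assms(1)]] .
  show "even (neg r (s_sign r e \<circ> w \<circ> s_sign r e')) \<longleftrightarrow> (even (neg r w) \<longleftrightarrow> e = e')"
    using neg_parity[OF w s_sign_WB[OF assms(1)] assms(1)] neg_parity[OF s_sign_WB[OF assms(1)] assms(2,1)]
      s_sign_parity[OF assms(1)] by (cases e; cases e') simp_all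
qed

lemma stab_WD:
  assumes l: "l \<in> Lam (n+1) r" and r: "r \<ge> 1" and 0: "l (n+1) = 0"
  shows "stab r (lab n l) \<subseteq> WD r"
proof
  fix v assume "v \<in> stab r (lab n l)"
  with lab_labelling[OF l] show "v \<in> WD r"
  proof (induction rule: stab_induct)
    case (step v k)
    hence "k \<noteq> r" using lab_r_iff[OF l r] 0 by auto
    hence "sB r k \<in> WD r" using sB_WB neg_sB step by (simp add: WD_iff)
    from WD_comp[OF r step(5) this] show ?case .
  qed (rule WD_id)
qed

lemma s_sign_stab:
  assumes l: "l \<in> Lam (n+1) r" and r: "r \<ge> 1" and "l (n+1) \<noteq> 0"
  shows "s_sign r e \<in> stab r (lab n l)"
  using sB_stab[OF lab_labelling[OF l], of r] lab_r_iff[OF l r] stab_id assms by (cases e) (simp_all add: s_sign_def)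

text \<open>If the middle block is empty, all elements of the stabiliser are even, and the signs act by
  conjugation. Otherwise \<open>s\<^sub>r\<close> lies in the stabiliser, so conjugation by it permutes the even elements;
  this gives one description for all symbols.\<close>

lemma WparD_conj:
  assumes l: "l \<in> Lam (n+1) r" and r: "r \<ge> 1"
  shows "WparD n r (sbracket n l e) = (\<lambda>v. s_sign r e \<circ> v \<circ> s_sign r e) ` {v \<in> stab r (lab n l). even (neg r v)}"
proof (cases "l (n+1) = 0")
  case True
  have "{v \<in> stab r (lab n l). even (neg r v)} = stab r (lab n l)" using stab_WD[OF l r True] by (auto simp: WD_iff)
  thus ?thesis using True Wpar_stab[OF l] by (cases e) (simp_all add: sbracket_def s_sign_def)
next
  case False
  let ?s = "s_sign r e"
  have s: "?s \<in> stab r (lab n l)" using s_sign_stab[OF l r False] .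
  have c: "?s \<circ> v \<circ> ?s \<in> {v \<in> stab r (lab n l). even (neg r v)}" if "v \<in> {v \<in> stab r (lab n l). even (neg r v)}" for v
    using that stab_comp[OF stab_comp[OF s] s, of v] s_sign_conj_parity(2)[OF r, of v e e] stab_WB[of r "lab n l"]
    by blast
  have e: "?s \<circ> (?s \<circ> v \<circ> ?s) \<circ> ?s = v" for v
    using s_sign_cancel[OF r, where e = e] by (simp add: o_assoc[symmetric])
  have "WparD n r (sbracket n l e) = {v \<in> stab r (lab n l). even (neg r v)}"
    using False Wpar_stab[OF l] subsetD[OF stab_WB[of r "lab n l"]] by (auto simp: sbracket_def WD_iff)
  also have "\<dots> = (\<lambda>v. ?s \<circ> v \<circ> ?s) ` {v \<in> stab r (lab n l). even (neg r v)}"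
    using c e by (intro equalityI subsetI) (metis (no_types, lifting) image_eqI, blast)
  finally show ?thesis .
qed

text \<open>The double coset of type D belonging to a matrix with two signs: the elements of the double coset
  of type B that have the right parity, moved by the signs into the group of type D.\<close>

definition cosetD :: "nat \<Rightarrow> nat \<Rightarrow> (nat \<Rightarrow> nat) \<Rightarrow> (nat \<Rightarrow> nat) \<Rightarrow> pm \<Rightarrow> (nat \<Rightarrow> nat \<Rightarrow> nat) \<Rightarrow> pm \<Rightarrow> (nat \<Rightarrow> nat) set" where
  "cosetD n r l m e A e' = (\<lambda>w. s_sign r e \<circ> w \<circ> s_sign r e') ` {w \<in> cosetB n r l m A. even (neg r w) \<longleftrightarrow> e = e'}"

lemma cosetD_WD:
  assumes "r \<ge> 1" shows "cosetD n r l m e A e' \<subseteq> WD r"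
  unfolding cosetD_def
proof clarify
  fix w assume "w \<in> cosetB n r l m A" "even (neg r w) \<longleftrightarrow> e = e'"
  thus "s_sign r e \<circ> w \<circ> s_sign r e' \<in> WD r"
    using s_sign_conj_parity[OF assms cosetB_D(1)] unfolding WD_iff by blast
qed

text \<open>An element with the least length of type D among those of its parity need not be increasing on
  the middle block, but then it becomes so after multiplication by \<open>s\<^sub>r\<close>. That would be the minimal representative,
  which has the same parity by assumption, while \<open>s\<^sub>r\<close> changes the parity.\<close>

lemma min_lenD:
  assumes r: "r \<ge> 2" and l: "l \<in> Lam (n+1) r" and m: "m \<in> Lam (n+1) r" and l0: "l (n+1) = 0"
    and par: "even (neg r (dmat n r A)) \<longleftrightarrow> \<delta>"
    and w: "w \<in> cosetB n r l m A" "even (neg r w) \<longleftrightarrow> \<delta>"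
    and min: "\<And>x. x \<in> cosetB n r l m A \<Longrightarrow> (even (neg r x) \<longleftrightarrow> \<delta>) \<Longrightarrow> lenD r w \<le> lenD r x"
  shows "w = dmat n r A"
proof -
  have r1: "r \<ge> 1" "r \<in> {1..r}" using r by auto
  have ww: "w \<in> WB r" using cosetB_D(1)[OF w(1)] .
  have L: "labelling r (2*n+2) (lab n l)" and M: "labelling r (2*n+2) (lab n m)" using lab_labelling l m by auto
  have par_k: "even (neg r (sB r k))" if "k \<in> {1..<r}" for k using neg_sB[of k r] that by auto
  have up: "w k < w (k+1)" if k: "k \<in> {1..<r}" "lab n m k = lab n m (k+1)" for k
  proof (rule ccontr)
    assume n: "\<not> w k < w (k+1)"
    have k': "k \<in> {1..r}" using k by auto
    have "w \<circ> sB r k \<in> cosetB n r l m A" by (rule cosetB_right[OF l m w(1) sB_stab[OF M k' k(2)]])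
    moreover have "even (neg r (w \<circ> sB r k)) \<longleftrightarrow> \<delta>"
      using neg_parity[OF ww sB_WB[OF k'] r1(1)] par_k[OF k(1)] w(2) by simp
    ultimately show False using min[of "w \<circ> sB r k"] lenD_down[OF ww k(1) n] by simp
  qed
  have up': "inv' w k < inv' w (k+1)" if k: "k \<in> {1..r}" "lab n l k = lab n l (k+1)" for k
  proof (rule ccontr)
    assume n: "\<not> inv' w k < inv' w (k+1)"
    have kr: "k \<noteq> r" using k l0 lab_r_iff[OF l r1(1)] by auto
    hence k': "k \<in> {1..<r}" using k by auto
    have "sB r k \<circ> w \<in> cosetB n r l m A" by (rule cosetB_left[OF l m w(1) sB_stab[OF L k]])
    moreover have "even (neg r (sB r k \<circ> w)) \<longleftrightarrow> \<delta>"
      using neg_parity[OF sB_WB[OF k(1)] ww r1(1)] par_k[OF k'] w(2) by simp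
    moreover have "lenD r (sB r k \<circ> w) = lenD r (inv' w \<circ> sB r k)"
      using lenD_inv[OF WB_comp[OF sB_WB[OF k(1)] ww]] incr_inv_sB[OF k(1) ww] by simp
    ultimately show False
      using min[of "sB r k \<circ> w"] lenD_down[OF WB_inv[OF ww] k' n] lenD_inv[OF ww] by simp
  qed
  show ?thesis
  proof (cases "lab n m r = lab n m (r+1) \<and> \<not> w r < w (r+1)")
    case False
    have "w k < w (k+1)" if "k \<in> {1..r}" "lab n m k = lab n m (k+1)" for k
    proof (cases "k = r")
      case False
      thus ?thesis using up that by auto
    qed (use False that in blast)
    hence "incr r (lab n m) w" unfolding incr_def by blast
    moreover have "incr r (lab n l) (inv' w)" using up' by (simp add: incr_def)
    ultimately show ?thesis by (rule dmat_spec(4)[OF l m w(1) w(1)])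
  next
    case True
    have sr: "sB r r \<in> stab r (lab n m)" using sB_stab[OF M r1(2)] True by blast
    define v where "v = w \<circ> sB r r"
    have v: "v \<in> cosetB n r l m A" "v \<in> WB r"
      using cosetB_right[OF l m w(1) sr] WB_comp[OF ww sB_WB[OF r1(2)]] by (simp_all add: v_def)
    have lt: "v k = w k" if "k < r" for k
      using sB_simps(5)[OF r1(2), of k] that by (auto simp: v_def)
    have vr: "v r = w (r+1)" "v (r+1) = w r" using sB_simps(1,2)[OF r1(2)] by (simp_all only: v_def o_apply)
    have up_r: "w (r-1) < w (r+1)" if k: "lab n m (r-1) = lab n m r"
    proof (rule ccontr)
      assume n: "\<not> w (r-1) < w (r+1)"
      have r2: "r - 1 \<in> {1..r}" "r - 1 \<in> {1..<r}" "r - 1 + 1 = r" using r by auto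
      have "sB r (r-1) \<in> stab r (lab n m)" using sB_stab[OF M r2(1)] k r2(3) by simp
      hence "sD r r \<in> stab r (lab n m)" unfolding sD_r by (intro stab_comp sr)
      hence "w \<circ> sD r r \<in> cosetB n r l m A" by (rule cosetB_right[OF l m w(1)])
      moreover have "even (neg r (w \<circ> sD r r)) \<longleftrightarrow> \<delta>"
        using neg_parity[OF ww _ r1(1), of "sD r r"] sD_WD[OF r1(2) r] w(2) by (simp add: WD_iff)
      ultimately show False using min[of "w \<circ> sD r r"] lenD_sD_r(2)[OF ww r n] by simp
    qed
    have "v k < v (k+1)" if k: "k \<in> {1..r}" "lab n m k = lab n m (k+1)" for k
    proof -
      consider "k = r" | "k = r-1" "k + 1 = r" | "k + 1 < r" using k r by force
      thus ?thesis
      proof cases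
        case 1 thus ?thesis using ascent_sB[OF ww r1(2)] True by (simp add: v_def)
      next
        case 2 thus ?thesis using up_r vr lt[of k] k by simp
      next
        case 3 thus ?thesis using up[of k] lt k by simp
      qed
    qed
    hence "incr r (lab n m) v" by (simp add: incr_def)
    moreover have "inv' v k < inv' v (k+1)" if k: "k \<in> {1..r}" "lab n l k = lab n l (k+1)" for k
    proof -
      \<comment> \<open>\<open>s\<^sub>r\<close> could only reverse the order of the values \<open>r\<close> and \<open>r+1\<close>, which sum to \<open>2r+1\<close>; the
        points \<open>k\<close> and \<open>k+1\<close> do not.\<close>
      have iv: "inv' v x = sB r r (inv' w x)" for x
        using WB_inv_comp[OF ww sB_WB[OF r1(2)]] sB_inv[OF r1(2)] by (simp add: v_def)
      have kr: "k \<noteq> r" using k l0 lab_r_iff[OF l r1(1)] by auto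
      have "\<not> (inv' w k = r \<and> inv' w (k+1) = r+1)"
      proof
        assume "inv' w k = r \<and> inv' w (k+1) = r+1"
        hence "w r = k" "w (r+1) = k+1" using WB_inv_apply(2)[OF ww] by metis+
        thus False using WB_r(1)[OF ww r1(1)] kr by simp
      qed
      moreover have "sB r r x = (if x = r then r+1 else if x = r+1 then r else x)" for x
        using sB_simps[OF r1(2)] by auto
      ultimately show ?thesis using up'[OF k] unfolding iv by auto
    qed
    hence "incr r (lab n l) (inv' v)" by (simp add: incr_def)
    ultimately have "v = dmat n r A" by (rule dmat_spec(4)[OF l m w(1) v(1)])
    moreover have "even (neg r v) \<longleftrightarrow> \<not> even (neg r w)"
      using neg_parity[OF ww sB_WB[OF r1(2)] r1(1)] neg_sB[OF r1(2)] by (simp add: v_def)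
    ultimately show ?thesis using par w(2) by simp
  qed
qed

lemma lab_lower:
  assumes l: "l \<in> Lam (n+1) r" and x: "x \<in> {1..r}" shows "lab n l x \<in> {1..n+1}"
proof -
  have "lab n l x \<le> n+1" using lab_le_iff[OF l, of x "n+1"] ps_half(2)[OF l] x by auto
  thus ?thesis using lab_range[OF l, of x] x by auto
qed

text \<open>For the minimal representative no sign changes occur within the middle block, so that all sign
  changes are counted by the upper right corner of the matrix.\<close>

lemma dmat_parity:
  assumes l: "l \<in> Lam (n+1) r" and m: "m \<in> Lam (n+1) r" and l0: "l (n+1) = 0" and w: "w \<in> cosetB n r l m A"
  shows "even (neg r (dmat n r A)) \<longleftrightarrow> sgn_mat n A = Plus"
proof -
  define d where "d = dmat n r A"
  note spec = dmat_spec[OF l m w, folded d_def]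
  have d: "d \<in> WB r" and dA: "coset_mat n l d m = A" using cosetB_D[OF spec(1)] .
  have M: "labelling r (2*n+2) (lab n m)" using lab_labelling[OF m] .
  let ?Y = "{y\<in>{1..2*r}. lab n l (d y) \<in> {1..n} \<and> lab n m y \<in> {n+2..2*n+1}}"
  have dr: "d y \<in> {1..2*r}" if "y \<in> {1..2*r}" for y using WB_in[OF d] that by blast
  have row: "(\<Sum>j\<in>{n+2..2*n+1}. A i j) = card {y\<in>?Y. lab n l (d y) = i}" if i: "i \<in> {1..n}" for i
  proof -
    have "A i j = card {y\<in>{y\<in>?Y. lab n l (d y) = i}. lab n m y = j}" if j: "j \<in> {n+2..2*n+1}" for j
    proof -
      have ij: "i \<in> {1..2*n+1}" "j \<in> {1..2*n+1}" using i j by auto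
      have "{y\<in>{y\<in>?Y. lab n l (d y) = i}. lab n m y = j} = {y\<in>{1..2*r}. lab n l (d y) = i \<and> lab n m y = j}"
        using i j by blast
      thus ?thesis using coset_mat_card[OF l m d ij] dA by simp
    qed
    hence "(\<Sum>j\<in>{n+2..2*n+1}. A i j) = (\<Sum>j\<in>{n+2..2*n+1}. card {y\<in>{y\<in>?Y. lab n l (d y) = i}. lab n m y = j})"
      by (rule sum.cong[OF refl])
    also have "\<dots> = card {y\<in>?Y. lab n l (d y) = i}" by (rule card_sum_fibres) auto
    finally show ?thesis .
  qed
  have "(\<Sum>i\<in>{1..n}. \<Sum>j\<in>{n+2..2*n+1}. A i j) = (\<Sum>i\<in>{1..n}. card {y\<in>?Y. lab n l (d y) = i})"
    by (rule sum.cong[OF refl row])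
  also have "\<dots> = card ?Y" by (rule card_sum_fibres) auto
  also have "?Y = {y\<in>{r+1..2*r}. d y \<le> r}"
  proof (intro equalityI subsetI)
    fix y assume y: "y \<in> ?Y"
    hence yr: "y \<in> {1..2*r}" by blast
    have "d y \<le> r" using lab_le_n[OF l l0 dr[OF yr]] y by simp
    moreover have "\<not> y \<le> r" using lab_lower[OF m, of y] y by auto
    ultimately show "y \<in> {y\<in>{r+1..2*r}. d y \<le> r}" using yr by simp
  next
    fix y assume y: "y \<in> {y\<in>{r+1..2*r}. d y \<le> r}"
    hence yr: "y \<in> {1..2*r}" and dy: "d y \<le> r" by auto
    have y': "2*r+1-y \<in> {1..r}" "2*r+1-y < y" using y by auto
    have "lab n l (d y) \<in> {1..n}" using lab_le_n[OF l l0 dr[OF yr]] dy lab_range[OF l dr[OF yr]] by simp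
    moreover have "lab n m y \<noteq> n+1"
    proof
      assume e: "lab n m y = n+1"
      hence e': "lab n m (2*r+1-y) = lab n m y" using lab_mirror[OF m yr] by simp
      have "d (2*r+1-y) < d y" using incr_full[OF M d spec(2) _ y'(2) _ e'] y' yr by auto
      thus False using WB_mirror[OF d yr] dy by simp
    qed
    moreover have "lab n m y \<ge> n+1" using lab_lower[OF m y'(1)] lab_mirror[OF m yr] by simp
    ultimately show "y \<in> ?Y" using lab_range[OF m yr] yr by simp
  qed
  also have "card {y\<in>{r+1..2*r}. d y \<le> r} = neg r d" unfolding neg_def
  proof (rule bij_betw_same_card[of "\<lambda>y. 2*r+1-y"], rule bij_betwI[of _ _ _ "\<lambda>y. 2*r+1-y"])
    show "(\<lambda>y. 2*r+1-y) \<in> {y \<in> {r+1..2*r}. d y \<le> r} \<rightarrow> {i \<in> {1..r}. r < d i}"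
    proof
      fix y assume y: "y \<in> {y \<in> {r+1..2*r}. d y \<le> r}"
      hence "y \<in> {1..2*r}" by auto
      from WB_mirror[OF d this] y show "2*r+1-y \<in> {i \<in> {1..r}. r < d i}" by auto
    qed
    show "(\<lambda>y. 2*r+1-y) \<in> {i \<in> {1..r}. r < d i} \<rightarrow> {y \<in> {r+1..2*r}. d y \<le> r}"
    proof
      fix y assume y: "y \<in> {i \<in> {1..r}. r < d i}"
      hence "y \<in> {1..2*r}" by auto
      from WB_mirror[OF d this] y show "2*r+1-y \<in> {y \<in> {r+1..2*r}. d y \<le> r}" by auto
    qed
  qed auto
  finally show ?thesis unfolding sgn_mat_def d_def by simp
qed

text \<open>The inner signs cancel against those of the conjugated parabolic subgroups. What remains to compare
  is parity: the left parabolic subgroup is even, so the parity of the right factor is the one that is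
  prescribed.\<close>

lemma dcoset_cosetD:
  assumes r: "r \<ge> 1" and l: "l \<in> Lam (n+1) r" and m: "m \<in> Lam (n+1) r" and l0: "l (n+1) = 0"
    and d: "d \<in> cosetB n r l m A" "even (neg r d) \<longleftrightarrow> e = e'"
  shows "dcoset (WparD n r (Signed l e)) (s_sign r e \<circ> d \<circ> s_sign r e') (WparD n r (sbracket n m e'))
    = cosetD n r l m e A e'" (is "dcoset ?X ?d ?Y = _")
proof -
  let ?s = "s_sign r e" and ?t = "s_sign r e'"
  have dw: "d \<in> WB r" using cosetB_D(1)[OF d(1)] .
  have X: "?X = (\<lambda>v. ?s \<circ> v \<circ> ?s) ` {v \<in> stab r (lab n l). even (neg r v)}"
    using WparD_conj[OF l r, of e] l0 by (simp add: sbracket_def)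
  have Y: "?Y = (\<lambda>v. ?t \<circ> v \<circ> ?t) ` {v \<in> stab r (lab n m). even (neg r v)}" by (rule WparD_conj[OF m r])
  have prod: "(?s \<circ> u \<circ> ?s) \<circ> (?s \<circ> d \<circ> ?t) \<circ> (?t \<circ> v \<circ> ?t) = ?s \<circ> (u \<circ> d \<circ> v) \<circ> ?t" for u v
    using s_sign_cancel(1)[OF r, of e] s_sign_cancel(1)[OF r, of e'] by (simp only: comp_assoc)
  have par: "even (neg r (u \<circ> d \<circ> v)) \<longleftrightarrow> (even (neg r v) \<longleftrightarrow> e = e')"
    if u: "u \<in> stab r (lab n l)" and v: "v \<in> stab r (lab n m)" for u v
  proof -
    have uv: "u \<in> WB r" "v \<in> WB r" "even (neg r u)"
      using subsetD[OF stab_WB u] subsetD[OF stab_WB v] subsetD[OF stab_WD[OF l r l0] u] by (auto simp: WD_iff)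
    show ?thesis using neg_parity[OF WB_comp[OF uv(1) dw] uv(2) r] neg_parity[OF uv(1) dw r] uv(3) d(2) by blast
  qed
  show ?thesis
  proof (intro equalityI subsetI)
    fix y assume "y \<in> dcoset ?X ?d ?Y"
    then obtain u v where uv: "u \<in> stab r (lab n l)" "v \<in> stab r (lab n m)" "even (neg r v)"
      "y = (?s \<circ> u \<circ> ?s) \<circ> ?d \<circ> (?t \<circ> v \<circ> ?t)" unfolding dcoset_def X Y by blast
    have "y = ?s \<circ> (u \<circ> d \<circ> v) \<circ> ?t" using uv(4) prod by simp
    moreover have "u \<circ> d \<circ> v \<in> cosetB n r l m A" by (rule cosetB_right[OF l m cosetB_left[OF l m d(1) uv(1)] uv(2)])
    moreover have "even (neg r (u \<circ> d \<circ> v)) \<longleftrightarrow> e = e'" using par[OF uv(1,2)] uv(3) by blast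
    ultimately show "y \<in> cosetD n r l m e A e'" unfolding cosetD_def by blast
  next
    fix y assume "y \<in> cosetD n r l m e A e'"
    then obtain w where w: "w \<in> cosetB n r l m A" "even (neg r w) \<longleftrightarrow> e = e'" "y = ?s \<circ> w \<circ> ?t" unfolding cosetD_def by blast
    obtain u v where uv: "u \<in> stab r (lab n l)" "v \<in> stab r (lab n m)" "w = u \<circ> d \<circ> v"
      using cosetB_eq_dcoset[OF l m d(1) w(1)] unfolding dcoset_def by blast
    have v: "even (neg r v)" using par[OF uv(1,2)] w(2) uv(3) by blast
    have u: "even (neg r u)" using subsetD[OF stab_WD[OF l r l0] uv(1)] by (simp add: WD_iff)
    have "y = (?s \<circ> u \<circ> ?s) \<circ> ?d \<circ> (?t \<circ> v \<circ> ?t)" unfolding w(3) uv(3) prod ..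
    moreover have "?s \<circ> u \<circ> ?s \<in> ?X" unfolding X using uv u by blast
    moreover have "?t \<circ> v \<circ> ?t \<in> ?Y" unfolding Y using uv v by blast
    ultimately show "y \<in> dcoset ?X ?d ?Y" using dcosetI by blast
  qed
qed

text \<open>The unique element of least length in the double coset of type D is the minimal representative of
  type B moved by the signs, because \<open>s\<^sub>r\<close> does not affect the length of type D. So \<open>\<phi>\<close> is given by
  this double coset.\<close>

lemma phi_eq:
  assumes r: "r \<ge> 2" and l: "l \<in> Lam (n+1) r" and m: "m \<in> Lam (n+1) r" and l0: "l (n+1) = 0"
    and w: "w \<in> cosetB n r l m A" and sg: "sgn_mat n A = Plus \<longleftrightarrow> e = e'"
  obtains d where "phi n r e A e' = phi_d n r (Signed l e) (sbracket n m e') d"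
    "dcoset (WparD n r (Signed l e)) d (WparD n r (sbracket n m e')) = cosetD n r l m e A e'"
proof -
  define a where "a = dmat n r A"
  define d where "d = s_sign r e \<circ> a \<circ> s_sign r e'"
  have r1: "r \<ge> 1" using r by simp
  have aB: "a \<in> cosetB n r l m A" unfolding a_def by (rule dmat_spec(1)[OF l m w])
  have ap: "even (neg r a) \<longleftrightarrow> e = e'" unfolding a_def using dmat_parity[OF l m l0 w] sg by simp
  have aw: "a \<in> WB r" using cosetB_D(1)[OF aB] .
  have D: "dcoset (WparD n r (Signed l e)) d (WparD n r (sbracket n m e')) = cosetD n r l m e A e'"
    unfolding d_def by (rule dcoset_cosetD[OF r1 l m l0 aB ap])
  let ?D = "cosetD n r l m e A e'"
  have DD: "?D \<subseteq> WD r" by (rule cosetD_WD[OF r1])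
  have len: "wlen r (sD r) y = lenD r y" if "y \<in> ?D" for y using wlenD[OF _ r] that DD by blast
  have dD: "d \<in> ?D" unfolding cosetD_def d_def using aB ap by blast
  have uniq: "y = d" if y: "y \<in> ?D" and min: "\<And>x. x \<in> ?D \<Longrightarrow> lenD r y \<le> lenD r x" for y
  proof -
    obtain v where v: "v \<in> cosetB n r l m A" "even (neg r v) \<longleftrightarrow> e = e'" "y = s_sign r e \<circ> v \<circ> s_sign r e'"
      using y unfolding cosetD_def by blast
    have "v = a" unfolding a_def
    proof (rule min_lenD[OF r l m l0 ap[unfolded a_def] v(1,2)])
      fix x assume x: "x \<in> cosetB n r l m A" "even (neg r x) \<longleftrightarrow> e = e'"
      have "s_sign r e \<circ> x \<circ> s_sign r e' \<in> ?D" unfolding cosetD_def using x by blast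
      from min[OF this] show "lenD r v \<le> lenD r x"
        unfolding v(3) s_sign_lenD[OF r1 cosetB_D(1)[OF v(1)]] s_sign_lenD[OF r1 cosetB_D(1)[OF x(1)]] .
    qed
    thus ?thesis using v(3) d_def by simp
  qed
  have "(THE d. is_min_in r (sD r) ?D d) = d"
  proof (rule the_equality)
    obtain y where y: "y \<in> ?D" "\<And>x. x \<in> ?D \<Longrightarrow> lenD r y \<le> lenD r x"
      using exists_min_length[of ?D "lenD r"] dD by blast
    thus "is_min_in r (sD r) ?D d" using uniq[OF y] len unfolding is_min_in_def by simp
    show "y = d" if "is_min_in r (sD r) ?D y" for y
    proof -
      have y: "y \<in> ?D" using that unfolding is_min_in_def by blast
      show ?thesis by (rule uniq[OF y]) (use that len[OF y] len in \<open>simp add: is_min_in_def\<close>)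
    qed
  qed
  moreover have "ro n A = hat n l" "co n A = hat n m"
    using ro_coset_mat[OF l m cosetB_D(1)[OF w]] co_coset_mat[OF l m cosetB_D(1)[OF w]] cosetB_D(2)[OF w] by simp_all
  moreover have "sbracket n l e = Signed l e" using l0 by (simp add: sbracket_def)
  ultimately have "phi n r e A e' = phi_d n r (Signed l e) (sbracket n m e') d"
    unfolding phi_def Let_def using unhat_hat[OF l] unhat_hat[OF m] D unfolding d_def a_def by simp
  thus ?thesis using that D by blast
qed

section \<open>Every matrix belongs to a double coset\<close>

text \<open>Bijections between the fibres of equal cardinality fit together.\<close>

lemma fibre_bij:
  assumes "finite X" "finite T" and card: "\<And>c. card {x\<in>X. f x = c} = card {t\<in>T. g t = c}"
  obtains \<beta> where "bij_betw \<beta> X T" "\<And>x. x \<in> X \<Longrightarrow> g (\<beta> x) = f x"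
proof -
  have "\<exists>b. bij_betw b {x\<in>X. f x = c} {t\<in>T. g t = c}" for c
    by (rule finite_same_card_bij) (use assms in auto)
  then obtain b where b: "\<And>c. bij_betw (b c) {x\<in>X. f x = c} {t\<in>T. g t = c}" by metis
  define \<beta> where "\<beta> x = b (f x) x" for x
  have g: "\<beta> x \<in> T \<and> g (\<beta> x) = f x" if "x \<in> X" for x
    using bij_betwE[OF b[of "f x"]] that by (auto simp: \<beta>_def)
  have "inj_on \<beta> X"
  proof (rule inj_onI)
    fix x y assume xy: "x \<in> X" "y \<in> X" "\<beta> x = \<beta> y"
    hence f: "f x = f y" using g by metis
    thus "x = y" using bij_betw_imp_inj_on[OF b[of "f x"]] xy by (auto simp: \<beta>_def inj_on_def)
  qed
  moreover have "\<beta> ` X = T"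
  proof (intro equalityI subsetI)
    fix t assume t: "t \<in> T"
    hence "t \<in> b (g t) ` {x\<in>X. f x = g t}" using bij_betw_imp_surj_on[OF b[of "g t"]] by simp
    then obtain x where "x \<in> X" "f x = g t" "b (g t) x = t" by auto
    thus "t \<in> \<beta> ` X" by (intro image_eqI[of _ _ x]) (simp_all add: \<beta>_def)
  qed (use g in auto)
  ultimately show ?thesis using that g by (auto simp: bij_betw_def)
qed

text \<open>A signed permutation is a permutation of \<open>[1,r]\<close> together with a choice of signs; injectivity on
  \<open>[1,2r]\<close> uses that no point is its own mirror image.\<close>

lemma signed_perm:
  assumes b: "bij_betw \<beta> {1..r} {1..r}"
  obtains v where "v \<in> WB r" "\<And>x. x \<in> {1..r} \<Longrightarrow> v x = (if s x then 2*r+1 - \<beta> x else \<beta> x)"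
proof -
  define u where "u x = (if s x then 2*r+1 - \<beta> x else \<beta> x)" for x
  define v where "v x = (if x \<in> {1..r} then u x else if x \<in> {r+1..2*r} then 2*r+1 - u (2*r+1-x) else x)" for x
  have \<beta>: "\<beta> x \<in> {1..r}" if "x \<in> {1..r}" for x using b that by (auto dest: bij_betwE)
  have u: "u x \<in> {1..2*r}" if "x \<in> {1..r}" for x using \<beta>[OF that] by (auto simp: u_def)
  have v: "v x \<in> {1..2*r}" if x: "x \<in> {1..2*r}" for x
  proof (cases "x \<le> r")
    case True thus ?thesis using u[of x] x by (simp add: v_def)
  next
    case False
    hence "2*r+1-x \<in> {1..r}" using x by auto
    from u[OF this] False x show ?thesis by (auto simp: v_def)
  qed
  have mir: "v (2*r+1-x) = 2*r+1 - v x" if x: "x \<in> {1..2*r}" for x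
  proof (cases "x \<le> r")
    case True
    hence "2*r+1-x \<in> {r+1..2*r}" "2*r+1-(2*r+1-x) = x" using x by auto
    thus ?thesis using True x by (auto simp: v_def)
  next
    case False
    hence m: "2*r+1-x \<in> {1..r}" "x \<in> {r+1..2*r}" using x by auto
    show ?thesis using u[OF m(1)] m by (auto simp: v_def)
  qed
  define fold where "fold x = min x (2*r+1-x)" for x :: nat
  have fold: "fold x \<in> {1..r}" "x = fold x \<or> x = 2*r+1 - fold x" if "x \<in> {1..2*r}" for x
    using that by (auto simp: fold_def min_def)
  have fv: "fold (v x) = \<beta> (fold x)" if x: "x \<in> {1..2*r}" for x
  proof -
    have *: "fold (v y) = \<beta> y" if "y \<in> {1..r}" for y
      using \<beta>[OF that] that by (auto simp: v_def u_def fold_def min_def)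
    have "fold (v x) = fold (v (fold x))"
      using fold(2)[OF x] mir[OF x] v[OF x] fold(1)[OF x]
      by (elim disjE) (auto simp: fold_def min_def)
    thus ?thesis using *[OF fold(1)[OF x]] by simp
  qed
  have inj: "inj_on v {1..2*r}"
  proof (rule inj_onI)
    fix x y assume xy: "x \<in> {1..2*r}" "y \<in> {1..2*r}" "v x = v y"
    hence "\<beta> (fold x) = \<beta> (fold y)" using fv by metis
    hence e: "fold x = fold y"
      by (rule inj_onD[OF bij_betw_imp_inj_on[OF b] _ fold(1)[OF xy(1)] fold(1)[OF xy(2)]])
    show "x = y"
    proof (rule ccontr)
      assume "x \<noteq> y"
      moreover obtain z where "z \<in> {1..r}" "x = z \<or> x = 2*r+1-z" "y = z \<or> y = 2*r+1-z"
        using fold[OF xy(1)] fold(2)[OF xy(2)] e by metis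
      ultimately have "y = 2*r+1-x" by auto
      hence "v x = 2*r+1 - v x" using mir[OF xy(1)] xy(3) by simp
      hence "2 * v x = 2*r+1" using v[OF xy(1)] by simp
      thus False by presburger
    qed
  qed
  have "v ` {1..2*r} = {1..2*r}" by (rule endo_inj_surj) (use v inj in auto)
  hence "bij_betw v {1..2*r} {1..2*r}" using inj unfolding bij_betw_def by blast
  hence "v permutes {1..2*r}" by (rule bij_imp_permutes) (auto simp: v_def)
  moreover have "v x + v (2*r+1-x) = 2*r+1" if "x \<in> {1..2*r}" for x
    using mir[OF that] v[OF that] by simp
  ultimately have "v \<in> WB r" unfolding WB_def by blast
  thus ?thesis by (rule that) (simp add: v_def u_def)
qed

text \<open>As the middle row vanishes, the entries of the upper half of the matrix sum to \<open>r\<close>. Matching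
  the units of these entries with the positions by their rows, and with the points by their columns,
  where a column in the right half stands for a sign, gives the inverse of the required element.\<close>

lemma cosetB_nonempty:
  assumes A: "A \<in> Xi n r" and l: "l \<in> Lam (n+1) r" and m: "m \<in> Lam (n+1) r" and l0: "l (n+1) = 0"
    and roA: "ro n A = hat n l" and coA: "co n A = hat n m"
  obtains w where "w \<in> cosetB n r l m A"
proof -
  have out: "A i j = 0" if "i \<notin> {1..2*n+1} \<or> j \<notin> {1..2*n+1}" for i j using A that unfolding Xi_def by blast
  have sym: "A i j = A (2*n+2-i) (2*n+2-j)" if "i \<in> {1..2*n+1}" "j \<in> {1..2*n+1}" for i j
    using A that unfolding Xi_def by blast
  have "(\<Sum>j\<in>{1..2*n+1}. A (n+1) j) = 0" using fun_cong[OF roA, of "n+1"] l0 by (simp add: ro_def hat_def)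
  hence mid: "A (n+1) j = 0" for j using out[of "n+1" j] by (cases "j \<in> {1..2*n+1}") (simp_all del: sum.cl_ivl_Suc)
  \<comment> \<open>The upper half of the matrix, spread out into single points: these correspond to the positions
    \<open>1,\<dots>,r\<close> row by row, and up to signs to the points \<open>1,\<dots>,r\<close> column by column.\<close>
  define T where "T = Sigma {1..n} (\<lambda>i. Sigma {1..2*n+1} (\<lambda>j. {..<A i j}))"
  have finT: "finite T" by (simp add: T_def)
  have Tj: "card {t\<in>T. fst (snd t) = j} = (\<Sum>i\<in>{1..n}. A i j)" for j
  proof (cases "j \<in> {1..2*n+1}")
    case True
    hence "{t\<in>T. fst (snd t) = j} = Sigma {1..n} (\<lambda>i. {j} \<times> {..<A i j})" by (auto simp: T_def)
    thus ?thesis by simp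
  next
    case False
    hence "{t\<in>T. fst (snd t) = j} = {}" by (auto simp: T_def)
    moreover have "(\<Sum>i\<in>{1..n}. A i j) = 0" using out False by simp
    ultimately show ?thesis by (simp only: card.empty)
  qed
  have rows: "card {x\<in>{1..r}. lab n l x = i} = card {t\<in>T. fst t = i}" for i
  proof (cases "i \<in> {1..n}")
    case True
    hence i: "i \<in> {1..2*n+1}" by auto
    have "{x\<in>{1..r}. lab n l x = i} = {x\<in>{1..2*r}. lab n l x = i}" using lab_le_n[OF l l0] True by auto
    hence "card {x\<in>{1..r}. lab n l x = i} = hat n l i" using card_lab[OF l i] by simp
    moreover have "{t\<in>T. fst t = i} = {i} \<times> Sigma {1..2*n+1} (\<lambda>j. {..<A i j})" using True by (auto simp: T_def)
    hence "card {t\<in>T. fst t = i} = ro n A i" by (simp add: ro_def card_cartesian_product)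
    ultimately show ?thesis using roA by simp
  next
    case False
    have "lab n l x \<in> {1..n}" if "x \<in> {1..r}" for x using lab_le_n[OF l l0, of x] lab_lower[OF l that] that by auto
    hence "{x\<in>{1..r}. lab n l x = i} = {}" using False by blast
    moreover have "{t\<in>T. fst t = i} = {}" using False by (auto simp: T_def)
    ultimately show ?thesis by (simp only: card.empty)
  qed
  obtain f where f: "bij_betw f {1..r} T" "\<And>x. x \<in> {1..r} \<Longrightarrow> fst (f x) = lab n l x"
    using fibre_bij[OF _ finT rows] by blast
  define g where "g t = min (fst (snd t)) (2*n+2 - fst (snd t))" for t :: "nat \<times> nat \<times> nat"
  have split: "(\<Sum>i\<in>{1..2*n+1}. A i j) = (\<Sum>i\<in>{1..n}. A i j) + (\<Sum>i\<in>{1..n}. A i (2*n+2-j))"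
    if j: "j \<in> {1..2*n+1}" for j
  proof -
    have "{1..2*n+1} = {1..n} \<union> insert (n+1) {n+2..2*n+1}" by auto
    hence "(\<Sum>i\<in>{1..2*n+1}. A i j) = (\<Sum>i\<in>{1..n} \<union> insert (n+1) {n+2..2*n+1}. A i j)" by (simp only:)
    also have "\<dots> = (\<Sum>i\<in>{1..n}. A i j) + (A (n+1) j + (\<Sum>i\<in>{n+2..2*n+1}. A i j))"
      by (subst sum.union_disjoint) auto
    also have "(\<Sum>i\<in>{n+2..2*n+1}. A i j) = (\<Sum>i\<in>{1..n}. A i (2*n+2-j))"
      by (rule sum.reindex_bij_witness[of _ "\<lambda>i. 2*n+2-i" "\<lambda>i. 2*n+2-i"]) (use sym[OF _ j] in auto)
    finally show ?thesis using mid by simp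
  qed
  have cols: "card {t\<in>T. g t = c} = card {y\<in>{1..r}. lab n m y = c}" for c
  proof -
    consider "c \<in> {1..n}" | "c = n+1" | "c \<notin> {1..n+1}" by fastforce
    thus ?thesis
    proof cases
      case 1
      hence c: "c \<in> {1..2*n+1}" "c \<noteq> 2*n+2-c" by auto
      have "{t\<in>T. g t = c} = {t\<in>T. fst (snd t) = c} \<union> {t\<in>T. fst (snd t) = 2*n+2-c}"
        using 1 by (auto simp: g_def T_def min_def)
      also have "card \<dots> = card {t\<in>T. fst (snd t) = c} + card {t\<in>T. fst (snd t) = 2*n+2-c}"
        using finT c(2) by (intro card_Un_disjoint) auto
      also have "\<dots> = co n A c" unfolding Tj using split[OF c(1)] by (simp add: co_def)
      also have "\<dots> = hat n m c" using coA by simp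
      also have "\<dots> = card {y\<in>{1..2*r}. lab n m y = c}" using card_lab[OF m c(1)] by simp
      also have "{y\<in>{1..2*r}. lab n m y = c} = {y\<in>{1..r}. lab n m y = c}"
      proof -
        have "y \<le> r" if "y \<in> {1..2*r}" "lab n m y = c" for y
          using lab_le_iff[OF m, of y n] ps_half(1)[OF m] that 1 by auto
        thus ?thesis by auto
      qed
      finally show ?thesis .
    next
      case 2
      have "{t\<in>T. g t = c} = {t\<in>T. fst (snd t) = n+1}" using 2 by (auto simp: g_def T_def min_def)
      hence "2 * card {t\<in>T. g t = c} = co n A (n+1)" using split[of "n+1"] by (simp add: Tj co_def)
      also have "\<dots> = 2 * m (n+1)" using coA by (simp add: hat_def)
      finally have "card {t\<in>T. g t = c} = m (n+1)" by simp
      moreover have "{y\<in>{1..r}. lab n m y = c} = {ps n m n<..r}"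
      proof (rule Set.set_eqI)
        fix y
        have "y \<in> {1..r} \<Longrightarrow> lab n m y = c \<longleftrightarrow> \<not> lab n m y \<le> n" using lab_lower[OF m, of y] 2 by auto
        moreover have "y \<in> {1..r} \<Longrightarrow> lab n m y \<le> n \<longleftrightarrow> y \<le> ps n m n" using lab_le_iff[OF m, of y n] by simp
        ultimately show "y \<in> {y\<in>{1..r}. lab n m y = c} \<longleftrightarrow> y \<in> {ps n m n<..r}"
          by (cases "y \<in> {1..r}") auto
      qed
      hence "card {y\<in>{1..r}. lab n m y = c} = m (n+1)" using ps_half(1)[OF m] by simp
      ultimately show ?thesis by simp
    next
      case 3
      have "{t\<in>T. g t = c} = {}" using 3 by (auto simp: g_def T_def min_def)
      moreover have "{y\<in>{1..r}. lab n m y = c} = {}" using 3 lab_lower[OF m] by blast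
      ultimately show ?thesis by (simp only: card.empty)
    qed
  qed
  obtain h where h: "bij_betw h T {1..r}" "\<And>t. t \<in> T \<Longrightarrow> lab n m (h t) = g t"
    using fibre_bij[OF finT _ cols] by blast
  obtain v where v: "v \<in> WB r" "\<And>x. x \<in> {1..r} \<Longrightarrow> v x = (if fst (snd (f x)) \<ge> n+2 then 2*r+1 - (h \<circ> f) x else (h \<circ> f) x)"
    using signed_perm[OF bij_betw_trans[OF f(1) h(1)], of "\<lambda>x. fst (snd (f x)) \<ge> n+2"] by blast
  have fT: "f x \<in> T" if "x \<in> {1..r}" for x using f(1) that by (auto dest: bij_betwE)
  have vl: "lab n m (v x) = fst (snd (f x))" if x: "x \<in> {1..r}" for x
  proof -
    have hx: "h (f x) \<in> {1..2*r}" using bij_betwE[OF h(1)] fT[OF x] by fastforce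
    have j: "fst (snd (f x)) \<in> {1..2*n+1}" using fT[OF x] by (auto simp: T_def)
    show ?thesis using v(2)[OF x] h(2)[OF fT[OF x]] lab_mirror[OF m hx] j by (auto simp: g_def min_def)
  qed
  define w where "w = inv' v"
  have w: "w \<in> WB r" "inv' w = v" using WB_inv[OF v(1)] v(1) by (simp_all add: w_def)
  have top: "coset_mat n l w m i j = A i j" if i: "i \<in> {1..n}" and j: "j \<in> {1..2*n+1}" for i j
  proof -
    have i': "i \<in> {1..2*n+1}" using i by auto
    have e1: "{x\<in>{1..2*r}. lab n l x = i \<and> lab n m (v x) = j} = {x\<in>{1..r}. fst (f x) = i \<and> fst (snd (f x)) = j}"
    proof (rule Set.set_eqI)
      fix x
      have "x \<in> {1..2*r} \<Longrightarrow> lab n l x = i \<Longrightarrow> x \<in> {1..r}" using lab_le_n[OF l l0, of x] i by auto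
      moreover have "x \<in> {1..r} \<Longrightarrow> fst (f x) = lab n l x \<and> fst (snd (f x)) = lab n m (v x)"
        using f(2) vl by simp
      moreover have "x \<in> {1..r} \<Longrightarrow> x \<in> {1..2*r}" by simp
      ultimately show "x \<in> {x\<in>{1..2*r}. lab n l x = i \<and> lab n m (v x) = j}
        \<longleftrightarrow> x \<in> {x\<in>{1..r}. fst (f x) = i \<and> fst (snd (f x)) = j}"
        by (cases "x \<in> {1..r}") auto
    qed
    have e2: "f ` {x\<in>{1..r}. fst (f x) = i \<and> fst (snd (f x)) = j} = {t\<in>T. fst t = i \<and> fst (snd t) = j}"
      using f(1) by (auto simp: bij_betw_def)
    have e3: "inj_on f {x\<in>{1..r}. fst (f x) = i \<and> fst (snd (f x)) = j}"
      by (rule inj_on_subset[OF bij_betw_imp_inj_on[OF f(1)]]) blast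
    have "{t\<in>T. fst t = i \<and> fst (snd t) = j} = {i} \<times> {j} \<times> {..<A i j}" using i j by (auto simp: T_def)
    hence "card {t\<in>T. fst t = i \<and> fst (snd t) = j} = A i j" by simp
    thus ?thesis unfolding coset_mat_card'[OF l m w(1) i' j] w(2) e1 using card_image[OF e3] unfolding e2 by simp
  qed
  have cs: "coset_mat n l w m i j = coset_mat n l w m (2*n+2-i) (2*n+2-j)"
    if ij: "i \<in> {1..2*n+1}" "j \<in> {1..2*n+1}" for i j
  proof -
    have ij': "2*n+2-i \<in> {1..2*n+1}" "2*n+2-j \<in> {1..2*n+1}" using ij by auto
    have vr: "v x \<in> {1..2*r}" if "x \<in> {1..2*r}" for x using WB_in[OF v(1)] that by blast
    have *: "lab n l (2*r+1-x) = 2*n+2 - lab n l x" "lab n m (v (2*r+1-x)) = 2*n+2 - lab n m (v x)"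
      if x: "x \<in> {1..2*r}" for x
      using lab_mirror[OF l x] lab_mirror[OF m vr[OF x]] WB_mirror[OF v(1) x] by simp_all
    show ?thesis unfolding coset_mat_card'[OF l m w(1) ij] coset_mat_card'[OF l m w(1) ij'] w(2)
    proof (rule bij_betw_same_card[of "\<lambda>x. 2*r+1-x"], rule bij_betwI[of _ _ _ "\<lambda>x. 2*r+1-x"])
      show "(\<lambda>x. 2*r+1-x) \<in> {x \<in> {1..2*r}. lab n l x = i \<and> lab n m (v x) = j}
        \<rightarrow> {x \<in> {1..2*r}. lab n l x = 2*n+2-i \<and> lab n m (v x) = 2*n+2-j}"
        using * by auto
      show "(\<lambda>x. 2*r+1-x) \<in> {x \<in> {1..2*r}. lab n l x = 2*n+2-i \<and> lab n m (v x) = 2*n+2-j}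
        \<rightarrow> {x \<in> {1..2*r}. lab n l x = i \<and> lab n m (v x) = j}"
        using * ij by auto
    qed auto
  qed
  have "coset_mat n l w m i j = A i j" for i j
  proof (cases "i \<in> {1..2*n+1} \<and> j \<in> {1..2*n+1}")
    case True
    consider "i \<in> {1..n}" | "i = n+1" | "2*n+2-i \<in> {1..n}" using True by fastforce
    thus ?thesis
    proof cases
      case 1 thus ?thesis using top True by blast
    next
      case 2
      have "(\<Sum>j\<in>{1..2*n+1}. coset_mat n l w m (n+1) j) = 0"
        using fun_cong[OF ro_coset_mat[OF l m w(1)], of "n+1"] l0 by (simp add: ro_def hat_def)
      hence "coset_mat n l w m (n+1) j = 0" using True by (simp del: sum.cl_ivl_Suc)
      thus ?thesis using mid 2 by simp
    next
      case 3
      have "2*n+2-j \<in> {1..2*n+1}" using True by auto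
      from top[OF 3 this] show ?thesis using cs[of i j] sym[of i j] True by simp
    qed
  next
    case False thus ?thesis using out[of i j] coset_mat_outside[of i n j l w m] by auto
  qed
  hence "w \<in> cosetB n r l m A" using w(1) by (simp add: cosetB_def fun_eq_iff)
  thus ?thesis by (rule that)
qed

section \<open>Moving one position between adjacent row blocks\<close>

lemma qint_sum: "qint m = (\<Sum>i<m. qvar ^ i)"
proof -
  have "coeff (qvar - 1) 1 = 1" by (simp add: qvar_def)
  hence "qvar - 1 \<noteq> 0" by force
  moreover have "qvar ^ m - 1 = (qvar - 1) * (\<Sum>i<m. qvar ^ i)"
    using power_diff_1_eq[of qvar m] by simp
  ultimately show ?thesis unfolding qint_def by simp
qed

text \<open>Sublevel sets of a weakly increasing sequence are initial segments, and a fibre is the difference of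
  two of them.\<close>

lemma mono_fibre:
  fixes c :: "nat \<Rightarrow> nat"
  assumes mono: "\<And>s t. s \<le> t \<Longrightarrow> t \<le> M \<Longrightarrow> c s \<le> c t"
    and pos: "\<And>t. t \<le> M \<Longrightarrow> c t \<ge> 1"
  shows "{t. t \<le> M \<and> c t = p} = {(\<Sum>j\<in>{1..<p}. card {t. t \<le> M \<and> c t = j}) ..<
     (\<Sum>j\<in>{1..<p}. card {t. t \<le> M \<and> c t = j}) + card {t. t \<le> M \<and> c t = p}}"
proof -
  have seg: "{t. t \<le> M \<and> c t < p} = {..<card {t. t \<le> M \<and> c t < p}}" for p
  proof -
    let ?X = "{t. t \<le> M \<and> c t < p}"
    have fin: "finite ?X" by (rule finite_subset[of _ "{..M}"]) auto
    show ?thesis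
    proof (cases "?X = {}")
      case False
      have "?X = {..Max ?X}"
      proof (intro equalityI subsetI)
        fix t assume "t \<in> {..Max ?X}"
        moreover have "Max ?X \<in> ?X" using fin False by (rule Max_in)
        ultimately show "t \<in> ?X" using mono[of t "Max ?X"] by auto
      qed (use fin in auto)
      hence "?X = {..<Suc (Max ?X)}" by (simp only: lessThan_Suc_atMost)
      thus ?thesis by (metis card_lessThan)
    next
      case True
      show ?thesis unfolding True by (simp only: card.empty lessThan_0)
    qed
  qed
  let ?s = "\<Sum>j\<in>{1..<p}. card {t. t \<le> M \<and> c t = j}"
  have fin: "finite {t. t \<le> M \<and> P t}" for P by (rule finite_subset[of _ "{..M}"]) auto
  have "(\<Sum>j\<in>{1..<p}. card {t\<in>{t. t \<le> M \<and> c t < p}. c t = j}) = card {t. t \<le> M \<and> c t < p}"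
    by (rule card_sum_fibres) (use pos fin in auto)
  moreover have "{t\<in>{t. t \<le> M \<and> c t < p}. c t = j} = {t. t \<le> M \<and> c t = j}" if "j \<in> {1..<p}" for j
    using that by auto
  ultimately have s: "card {t. t \<le> M \<and> c t < p} = ?s" by simp
  have "{t. t \<le> M \<and> c t < Suc p} = {t. t \<le> M \<and> c t < p} \<union> {t. t \<le> M \<and> c t = p}" by auto
  hence "card {t. t \<le> M \<and> c t < Suc p} = ?s + card {t. t \<le> M \<and> c t = p}"
    using s fin by (simp add: card_Un_disjoint disjoint_iff)
  hence a: "{t. t \<le> M \<and> c t < Suc p} = {..<?s + card {t. t \<le> M \<and> c t = p}}"
    and b: "{t. t \<le> M \<and> c t < p} = {..<?s}" using seg[of "Suc p"] seg[of p] s by simp_all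
  have "{t. t \<le> M \<and> c t = p} = {t. t \<le> M \<and> c t < Suc p} - {t. t \<le> M \<and> c t < p}" by auto
  also have "\<dots> = {..<?s + card {t. t \<le> M \<and> c t = p}} - {..<?s}"
    using a b by (rule arg_cong2[where f = "(-)"])
  also have "\<dots> = {?s..<?s + card {t. t \<le> M \<and> c t = p}}" by auto
  finally show ?thesis .
qed

definition par :: "nat \<Rightarrow> bool \<Rightarrow> (nat \<Rightarrow> nat) set" where
  "par r \<delta> = {w \<in> WB r. even (neg r w) \<longleftrightarrow> \<delta>}"

text \<open>The composition \<open>\<lambda>\<close> arises from \<open>\<mu>\<close> by moving one unit from block \<open>h\<close> to block \<open>h+1\<close>. Both blocks are
  to the left of the middle one, which is empty.\<close>

locale row_move =
  fixes n r h :: nat and lam mu gam :: "nat \<Rightarrow> nat"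
  assumes r: "r \<ge> 2" and h: "1 \<le> h" "h < n"
    and lam: "lam \<in> Lam (n+1) r" "lam (n+1) = 0"
    and mu: "mu \<in> Lam (n+1) r" "mu (n+1) = 0"
    and lam_gam: "\<And>i. lam i = gam i + (if i = h+1 then 1 else 0)"
    and mu_gam: "\<And>i. mu i = gam i + (if i = h then 1 else 0)"
begin

text \<open>The position whose label changes, besides its mirror image: it is the last of block \<open>h\<close> for \<open>\<mu>\<close> and
  the first of block \<open>h+1\<close> for \<open>\<lambda>\<close>, and the latter block has \<open>M+1\<close> positions.\<close>

definition x0 :: nat where "x0 = ps n lam h + 1"
definition M :: nat where "M = gam (h+1)"

lemma ps_mu: "i \<le> n \<Longrightarrow> ps n mu i = ps n lam i + (if i = h then 1 else 0)"
proof (induction i)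
  case (Suc i)
  have "hat n mu (Suc i) + (if Suc i = h+1 then 1 else 0) = hat n lam (Suc i) + (if Suc i = h then 1 else 0)"
    using Suc.prems lam_gam mu_gam by (auto simp: hat_def)
  thus ?case using Suc by (auto simp: ps_Suc split: if_splits)
qed (use h in \<open>simp add: ps_0\<close>)

lemma x0: "x0 \<ge> 1" "x0 + M \<le> r" "ps n lam (h+1) = x0 + M" "ps n lam h = x0 - 1" "ps n mu h = x0"
proof -
  show "x0 \<ge> 1" "ps n lam h = x0 - 1" by (simp_all add: x0_def)
  show e: "ps n lam (h+1) = x0 + M" using h lam_gam by (simp add: ps_Suc hat_def x0_def M_def)
  show "ps n mu h = x0" using ps_mu[of h] h by (simp add: x0_def)
  have "ps n lam n \<le> r" using ps_half(1)[OF lam(1)] by simp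
  thus "x0 + M \<le> r" using ps_mono[of "h+1" n n lam] h e by simp
qed

lemma x0_in: "t \<le> M \<Longrightarrow> x0 + t \<in> {1..r}" "t \<le> M \<Longrightarrow> x0 + t \<in> {1..2*r}"
  using x0 by auto

lemma lab_lam_block:
  assumes "x \<in> {1..2*r}" shows "lab n lam x = h+1 \<longleftrightarrow> x0 \<le> x \<and> x \<le> x0 + M"
  using lab_le_iff[OF lam(1), of x "h+1"] lab_le_iff[OF lam(1), of x h] x0(1,3,4) assms by auto

lemma lab_mu_low:
  assumes x: "x \<in> {1..r}" shows "lab n mu x = (if x = x0 then h else lab n lam x)"
proof -
  have le: "lab n mu x \<le> i \<longleftrightarrow> (if i = h then x \<le> x0 else lab n lam x \<le> i)" if "i \<le> n" for i
    using lab_le_iff[OF mu(1), of x i] lab_le_iff[OF lam(1), of x i] ps_mu[OF that] x0(5) x that by auto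
  have n: "lab n mu x \<le> n" "lab n lam x \<le> n" using lab_le_n[OF mu] lab_le_n[OF lam] x by auto
  show ?thesis
  proof (cases "x = x0")
    case True
    have "lab n mu x \<le> h" using le[of h] True h by simp
    moreover have "\<not> lab n mu x \<le> h - 1"
    proof -
      have "lab n lam x = h+1" using lab_lam_block[of x0] True x0_in(2)[of 0] by simp
      thus ?thesis using le[of "h-1"] h by auto
    qed
    ultimately show ?thesis using True by simp
  next
    case False
    have "lab n mu x \<le> i \<longleftrightarrow> lab n lam x \<le> i" if "i \<le> n" for i
      using le[OF that] lab_le_iff[OF lam(1), of x h] x0(1,4) x False by (auto split: if_splits)
    from this[of "lab n mu x"] this[of "lab n lam x"] n False show ?thesis by simp
  qed
qed

lemma lab_mu:
  assumes x: "x \<in> {1..2*r}"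
  shows "lab n mu x = (if x = x0 then h else if x = 2*r+1-x0 then 2*n+2-h else lab n lam x)"
proof (cases "x \<le> r")
  case True
  hence "x \<noteq> 2*r+1-x0" using x0 by auto
  thus ?thesis using lab_mu_low[of x] True x by simp
next
  case False
  hence x': "2*r+1-x \<in> {1..r}" using x by auto
  have "x \<noteq> x0" using False x0 by auto
  moreover have "2*r+1-x = x0 \<longleftrightarrow> x = 2*r+1-x0" using x x0 by auto
  moreover have "lab n mu x = 2*n+2 - lab n mu (2*r+1-x)" "lab n lam x = 2*n+2 - lab n lam (2*r+1-x)"
    using lab_mirror[OF mu(1) x] lab_mirror[OF lam(1) x] by simp_all
  ultimately show ?thesis using lab_mu_low[OF x'] by simp
qed

lemma E_theta_h: "E_theta n h p i j = (if i = h \<and> j = p then 1 else 0) + (if i = 2*n+2-h \<and> j = 2*n+2-p then 1 else 0)"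
  and E_theta_Suc_h: "E_theta n (h+1) p i j = (if i = h+1 \<and> j = p then 1 else 0) + (if i = 2*n+2-(h+1) \<and> j = 2*n+2-p then 1 else 0)"
  by (simp_all only: E_theta_def E_unit_def)

text \<open>Only the position \<open>x0\<close> and its mirror image count in different rows, so the matrices of one element
  for the two compositions differ by two symmetric matrix units in the column of the label at \<open>x0\<close>.\<close>

lemma coset_mat_move:
  assumes nu: "nu \<in> Lam (n+1) r" and w: "w \<in> WB r" and p: "p = lab n nu (inv' w x0)"
    and ij: "i \<in> {1..2*n+1}" "j \<in> {1..2*n+1}"
  shows "coset_mat n lam w nu i j + E_theta n h p i j = coset_mat n mu w nu i j + E_theta n (h+1) p i j"
proof -
  let ?c = "\<lambda>x. lab n nu (inv' w x)"
  let ?y = "2*r+1-x0"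
  let ?L = "{x\<in>{1..2*r}. lab n lam x = i \<and> ?c x = j}" and ?M = "{x\<in>{1..2*r}. lab n mu x = i \<and> ?c x = j}"
  have y: "?y \<in> {1..2*r}" "x0 \<in> {1..2*r}" "x0 \<noteq> ?y" using x0 by auto
  have iw: "inv' w x0 \<in> {1..2*r}" using WB_in[OF WB_inv[OF w]] y by blast
  have cy: "?c ?y = 2*n+2 - p" using WB_mirror[OF WB_inv[OF w] y(2)] lab_mirror[OF nu iw] p by simp
  have l0: "lab n lam x0 = h+1" using lab_lam_block[OF y(2)] by simp
  have ly: "lab n lam ?y = 2*n+2-(h+1)" using lab_mirror[OF lam(1) y(2)] l0 by simp
  have m0: "lab n mu x0 = h" "lab n mu ?y = 2*n+2-h" using lab_mu[OF y(2)] lab_mu[OF y(1)] y(3) by simp_all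
  have split: "card S = card (S - {x0, ?y}) + (if x0 \<in> S then 1 else 0) + (if ?y \<in> S then 1 else 0)"
    if "finite S" for S :: "nat set"
  proof -
    have "card S = card (S - {x0, ?y}) + card (S \<inter> {x0, ?y})"
      using card_Un_disjoint[of "S - {x0, ?y}" "S \<inter> {x0, ?y}"] that by (simp add: Un_Diff_Int disjoint_iff)
    moreover have "S \<inter> {x0, ?y} = (if x0 \<in> S then {x0} else {}) \<union> (if ?y \<in> S then {?y} else {})" by auto
    ultimately show ?thesis using y(3) by auto
  qed
  have "?L - {x0, ?y} = ?M - {x0, ?y}" using lab_mu by auto
  moreover have "x0 \<in> ?L \<longleftrightarrow> i = h+1 \<and> j = p" "?y \<in> ?L \<longleftrightarrow> i = 2*n+2-(h+1) \<and> j = 2*n+2-p"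
    "x0 \<in> ?M \<longleftrightarrow> i = h \<and> j = p" "?y \<in> ?M \<longleftrightarrow> i = 2*n+2-h \<and> j = 2*n+2-p"
    using y l0 ly m0 p cy by auto
  ultimately have "card ?L + E_theta n h p i j = card ?M + E_theta n (h+1) p i j"
    unfolding E_theta_h E_theta_Suc_h using split[of ?L] split[of ?M] by simp
  thus ?thesis unfolding coset_mat_card'[OF lam(1) nu w ij] coset_mat_card'[OF mu(1) nu w ij] .
qed

lemma theta_disjoint: "E_theta n h p i j > 0 \<Longrightarrow> E_theta n (h+1) p i j = 0" "E_theta n h p i j \<le> 1"
  unfolding E_theta_h E_theta_Suc_h using h by (auto split: if_splits)

lemma theta_outside:
  assumes "p \<in> {1..2*n+1}" "i \<notin> {1..2*n+1} \<or> j \<notin> {1..2*n+1}"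
  shows "E_theta n h p i j = 0" "E_theta n (h+1) p i j = 0"
  using assms h unfolding E_theta_h E_theta_Suc_h by auto

lemma cosetB_move_down:
  assumes nu: "nu \<in> Lam (n+1) r" and w: "w \<in> cosetB n r mu nu A" and p: "p = lab n nu (inv' w x0)"
  shows "w \<in> cosetB n r lam nu (shift_down n h A p)" "A h p > 0"
proof -
  have ww: "w \<in> WB r" and A: "coset_mat n mu w nu = A" using cosetB_D[OF w] .
  have iw: "inv' w x0 \<in> {1..2*r}" using WB_in[OF WB_inv[OF ww]] x0_in(2)[of 0] by simp
  have pr: "p \<in> {1..2*n+1}" unfolding p by (rule lab_range[OF nu iw])
  have mv: "coset_mat n lam w nu i j + E_theta n h p i j = A i j + E_theta n (h+1) p i j" for i j
  proof (cases "i \<in> {1..2*n+1} \<and> j \<in> {1..2*n+1}")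
    case True thus ?thesis using coset_mat_move[OF nu ww p] A by blast
  next
    case False
    thus ?thesis using theta_outside[OF pr, of i j] coset_mat_outside[of i n j] unfolding A[symmetric] by auto
  qed
  have "coset_mat n lam w nu i j = shift_down n h A p i j" for i j
    using mv[of i j] theta_disjoint[of p i j] by (cases "E_theta n h p i j > 0") (auto simp: shift_down_def)
  thus "w \<in> cosetB n r lam nu (shift_down n h A p)" using ww by (simp add: cosetB_def fun_eq_iff)
  show "A h p > 0" using mv[of h p] theta_disjoint(1)[of p h p] E_theta_h[of p h p] by simp
qed

lemma cosetB_move_up:
  assumes nu: "nu \<in> Lam (n+1) r" and w: "w \<in> cosetB n r lam nu (shift_down n h A p)"
    and p: "p = lab n nu (inv' w x0)" and pos: "A h p > 0" "A (2*n+2-h) (2*n+2-p) > 0"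
    and out: "\<And>i j. i \<notin> {1..2*n+1} \<or> j \<notin> {1..2*n+1} \<Longrightarrow> A i j = 0"
  shows "w \<in> cosetB n r mu nu A"
proof -
  have ww: "w \<in> WB r" and A: "coset_mat n lam w nu = shift_down n h A p" using cosetB_D[OF w] .
  have "coset_mat n mu w nu i j = A i j" for i j
  proof (cases "i \<in> {1..2*n+1} \<and> j \<in> {1..2*n+1}")
    case True
    have "A i j \<ge> E_theta n h p i j"
      using theta_disjoint(2)[of p i j] pos unfolding E_theta_h by (auto split: if_splits)
    hence "coset_mat n lam w nu i j + E_theta n h p i j = A i j + E_theta n (h+1) p i j"
      unfolding A shift_down_def by simp
    thus ?thesis using coset_mat_move[OF nu ww p, of i j] True by simp
  next
    case False thus ?thesis using out[of i j] coset_mat_outside[of i n j] by auto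
  qed
  thus ?thesis using ww by (simp add: cosetB_def fun_eq_iff)
qed

lemma shift_down_row: "shift_down n h A p (h+1) j = A (h+1) j + (if j = p then 1 else 0)"
  unfolding shift_down_def E_theta_h E_theta_Suc_h using h by auto

lemma shift_down_inj:
  assumes "shift_down n h A p = shift_down n h A p'" shows "p = p'"
  using shift_down_row[of A p p] shift_down_row[of A p' p] assms by (auto split: if_splits)

section \<open>The symmetrising factor\<close>

abbreviation W :: "(nat \<Rightarrow> nat) set" where "W \<equiv> stab r (lab n lam)"

lemma L: "labelling r (2*n+2) (lab n lam)"
  using lab_labelling[OF lam(1)] .

lemma W_block:
  assumes v: "v \<in> W" and t: "t \<le> M"
  obtains u where "u \<le> M" "v (x0 + t) = x0 + u"
proof -
  have x: "x0 + t \<in> {1..2*r}" using x0_in t by blast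
  have vx: "v (x0 + t) \<in> {1..2*r}" using WB_in[of v r] v stab_WB x by blast
  have "lab n lam (v (x0 + t)) = h+1" using stab_apply[OF v x] lab_lam_block[OF x] t by simp
  hence "x0 \<le> v (x0 + t) \<and> v (x0 + t) \<le> x0 + M" using lab_lam_block[OF vx] by simp
  thus ?thesis using that[of "v (x0 + t) - x0"] by auto
qed

lemma sB_W:
  assumes t: "t < M"
  shows "x0 + t \<in> {1..<r}" "x0 + t \<in> {1..r}" "lab n lam (x0+t) = lab n lam (x0+t+1)" "sB r (x0+t) \<in> W"
proof -
  show a: "x0 + t \<in> {1..<r}" "x0 + t \<in> {1..r}" using x0 t by auto
  show b: "lab n lam (x0+t) = lab n lam (x0+t+1)"
    using lab_lam_block[of "x0+t"] lab_lam_block[of "x0+t+1"] x0_in(2)[of t] x0_in(2)[of "t+1"] t by simp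
  show "sB r (x0+t) \<in> W" by (rule sB_stab[OF L a(2) b])
qed

text \<open>The stabiliser is partitioned by the image of \<open>x0\<close>, and again by the preimage of \<open>x0\<close>. The two
  partitions share the part that fixes \<open>x0\<close>, which is the intersection with the stabiliser for \<open>\<mu>\<close>.\<close>

definition to_x0 :: "nat \<Rightarrow> (nat \<Rightarrow> nat) set" where "to_x0 t = {v \<in> W. v (x0 + t) = x0}"
definition from_x0 :: "nat \<Rightarrow> (nat \<Rightarrow> nat) set" where "from_x0 t = {v \<in> W. v x0 = x0 + t}"

lemma from_x0_step:
  assumes t: "t < M"
  shows "heq r (gen (x0+t) * TS r (from_x0 t)) (TS r (from_x0 (t+1)))"
proof -
  let ?s = "sB r (x0+t)"
  note s = sB_W[OF t] and si = sB_simps[OF sB_W(2)[OF t]]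
  have e: "(\<lambda>w. ?s \<circ> w) ` from_x0 t = from_x0 (t+1)"
  proof (intro equalityI subsetI)
    fix v assume "v \<in> (\<lambda>w. ?s \<circ> w) ` from_x0 t"
    then obtain u where u: "u \<in> W" "u x0 = x0 + t" "v = ?s \<circ> u" by (auto simp: from_x0_def)
    have "v \<in> W" unfolding u(3) by (rule stab_comp[OF s(4) u(1)])
    moreover have "v x0 = x0 + (t+1)" using u si(1) by simp
    ultimately show "v \<in> from_x0 (t+1)" by (simp add: from_x0_def)
  next
    fix v assume "v \<in> from_x0 (t+1)"
    hence v: "v \<in> W" "v x0 = x0 + t + 1" by (simp_all add: from_x0_def)
    have "?s \<circ> v \<in> W" by (rule stab_comp[OF s(4) v(1)])
    moreover have "(?s \<circ> v) x0 = x0 + t" using v si(2) by simp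
    ultimately have "?s \<circ> v \<in> from_x0 t" by (simp add: from_x0_def)
    thus "v \<in> (\<lambda>w. ?s \<circ> w) ` from_x0 t"
      using sB_comp_sB_left[OF s(2), of v] by (metis image_eqI)
  qed
  have "heq r (gen (x0+t) * tw r v) (tw r (?s \<circ> v))" if v: "v \<in> from_x0 t" for v
  proof (rule tw_left[OF r _ s(2)])
    show vw: "v \<in> WB r" using v stab_WB[of r "lab n lam"] by (auto simp: from_x0_def)
    have vW: "v \<in> W" "v x0 = x0 + t" using v by (simp_all add: from_x0_def)
    have a: "inv' v (x0+t) = x0" using WB_inv_apply(1)[OF vw, of x0] vW(2) by simp
    obtain u where u: "u \<le> M" "inv' v (x0 + (t+1)) = x0 + u" using W_block[OF stab_inv[OF vW(1)], of "t+1"] t by auto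
    have "inv' v (x0 + (t+1)) \<noteq> inv' v (x0+t)" using WB_inj[OF WB_inv[OF vw]] by simp
    thus "inv' v (x0+t) < inv' v (x0+t+1)" using a u(2) by simp
  qed
  hence "heq r (gen (x0+t) * TS r (from_x0 t)) (TS r ((\<lambda>w. ?s \<circ> w) ` from_x0 t))"
    by (rule TS_translate_left[OF r FA_gen[OF s(2)] sB_WB[OF s(2)]])
  thus ?thesis unfolding e .
qed

lemma to_x0_step:
  assumes t: "t < M"
  shows "heq r (TS r (to_x0 t) * gen (x0+t)) (TS r (to_x0 (t+1)))"
proof -
  let ?s = "sB r (x0+t)"
  note s = sB_W[OF t] and si = sB_simps[OF sB_W(2)[OF t]]
  have e: "(\<lambda>w. w \<circ> ?s) ` to_x0 t = to_x0 (t+1)"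
  proof (intro equalityI subsetI)
    fix v assume "v \<in> (\<lambda>w. w \<circ> ?s) ` to_x0 t"
    then obtain u where u: "u \<in> W" "u (x0 + t) = x0" "v = u \<circ> ?s" by (auto simp: to_x0_def)
    have "v \<in> W" unfolding u(3) by (rule stab_comp[OF u(1) s(4)])
    moreover have "v (x0 + t + 1) = x0" using u si(2) by simp
    ultimately show "v \<in> to_x0 (t+1)" by (simp add: to_x0_def)
  next
    fix v assume "v \<in> to_x0 (t+1)"
    hence v: "v \<in> W" "v (x0 + t + 1) = x0" by (simp_all add: to_x0_def)
    have "v \<circ> ?s \<in> W" by (rule stab_comp[OF v(1) s(4)])
    moreover have "(v \<circ> ?s) (x0 + t) = x0" using v si(1) by simp
    ultimately have "v \<circ> ?s \<in> to_x0 t" by (simp add: to_x0_def)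
    thus "v \<in> (\<lambda>w. w \<circ> ?s) ` to_x0 t"
      using sB_comp_sB_right[OF s(2), of v] by (metis image_eqI)
  qed
  have "heq r (tw r v * gen (x0+t)) (tw r (v \<circ> ?s))" if v: "v \<in> to_x0 t" for v
  proof (rule tw_right[OF r _ s(2)])
    show vw: "v \<in> WB r" using v stab_WB[of r "lab n lam"] by (auto simp: to_x0_def)
    have vW: "v \<in> W" "v (x0 + t) = x0" using v by (simp_all add: to_x0_def)
    obtain u where u: "u \<le> M" "v (x0 + (t+1)) = x0 + u" using W_block[OF vW(1), of "t+1"] t by auto
    have "v (x0 + (t+1)) \<noteq> v (x0+t)" using WB_inj[OF vw] by simp
    thus "v (x0+t) < v (x0+t+1)" using vW(2) u(2) by simp
  qed
  hence "heq r (TS r (to_x0 t) * gen (x0+t)) (TS r ((\<lambda>w. w \<circ> ?s) ` to_x0 t))"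
    by (rule TS_translate_right[OF r FA_gen[OF s(2)] sB_WB[OF s(2)]])
  thus ?thesis unfolding e .
qed

text \<open>Pairing \<open>v\<close> with \<open>v s\<^sub>k\<close> makes the sum a left multiple of \<open>1 + T\<^sub>k\<close>, which is an eigenvector of \<open>T\<^sub>k\<close> with
  eigenvalue \<open>q\<close> by the quadratic relation.\<close>

lemma TS_W_gen:
  assumes t: "t < M"
  shows "heq r (TS r W * gen (x0+t)) (scal qvar * TS r W)"
proof -
  let ?k = "x0+t"
  let ?s = "sB r ?k"
  note s = sB_W[OF t]
  define U where "U = {v \<in> W. v ?k < v (?k+1)}"
  have UW: "U \<subseteq> WB r" using stab_WB by (auto simp: U_def)
  have img: "(\<lambda>w. w \<circ> ?s) ` U = {v \<in> W. \<not> v ?k < v (?k+1)}"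
  proof (intro equalityI subsetI)
    fix v assume "v \<in> (\<lambda>w. w \<circ> ?s) ` U"
    then obtain u where u: "u \<in> W" "u ?k < u (?k+1)" "v = u \<circ> ?s" by (auto simp: U_def)
    have "v \<in> W" unfolding u(3) by (rule stab_comp[OF u(1) s(4)])
    thus "v \<in> {v \<in> W. \<not> v ?k < v (?k+1)}"
      using ascent_sB[OF _ s(2), of u] u stab_WB[of r "lab n lam"] by blast
  next
    fix v assume "v \<in> {v \<in> W. \<not> v ?k < v (?k+1)}"
    hence v: "v \<in> W" "\<not> v ?k < v (?k+1)" by auto
    have "v \<circ> ?s \<in> U" unfolding U_def
      using stab_comp[OF v(1) s(4)] ascent_sB[OF _ s(2), of v] v stab_WB[of r "lab n lam"] by blast
    thus "v \<in> (\<lambda>w. w \<circ> ?s) ` U" using sB_comp_sB_right[OF s(2), of v] by (metis image_eqI)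
  qed
  have g: "gen ?k \<in> FA r" "TS r U \<in> FA r" using FA_gen[OF s(2)] TS_FA[OF r UW] by auto
  have "heq r (TS r U * gen ?k) (TS r ((\<lambda>w. w \<circ> ?s) ` U))"
    by (rule TS_translate_right[OF r g(1) sB_WB[OF s(2)]], rule tw_right[OF r _ s(2)]) (use UW in \<open>auto simp: U_def\<close>)
  hence "heq r (TS r U + TS r U * gen ?k) (TS r U + TS r ((\<lambda>w. w \<circ> ?s) ` U))"
    by (rule heq_add[OF r heq_refl[OF r g(2)]])
  moreover have "TS r U + TS r ((\<lambda>w. w \<circ> ?s) ` U) = TS r W"
  proof -
    have "W = U \<union> (\<lambda>w. w \<circ> ?s) ` U" unfolding img by (auto simp: U_def)
    moreover have "U \<inter> (\<lambda>w. w \<circ> ?s) ` U = {}" unfolding img by (auto simp: U_def)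
    moreover have "(\<lambda>w. w \<circ> ?s) ` U \<subseteq> WB r" unfolding img using stab_WB by auto
    ultimately show ?thesis using TS_Un[OF UW] by metis
  qed
  ultimately have W: "heq r (TS r W) (TS r U * (1 + gen ?k))" using heq_sym[OF r] by (simp add: distrib_left)
  have "heq r (gen ?k + gen ?k * gen ?k) (gen ?k + (scal (qvar - 1) * gen ?k + scal qvar))"
    by (rule heq_add[OF r heq_refl[OF r g(1)] heq_quadratic[OF r s(1)]])
  hence "heq r ((1 + gen ?k) * gen ?k) (scal qvar * (1 + gen ?k))"
    by (simp add: algebra_simps scal_minus scal_one)
  hence "heq r (TS r U * ((1 + gen ?k) * gen ?k)) (TS r U * (scal qvar * (1 + gen ?k)))"
    by (rule heq_mult_left[OF r g(2)])
  hence "heq r (TS r U * (1 + gen ?k) * gen ?k) (scal qvar * (TS r U * (1 + gen ?k)))"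
    using scal_central[of qvar "TS r U"] by (simp add: mult.assoc) (simp add: mult.assoc[symmetric])
  moreover have "heq r (TS r W * gen ?k) (TS r U * (1 + gen ?k) * gen ?k)"
    by (rule heq_mult_right[OF r g(1) W])
  moreover have "heq r (scal qvar * (TS r U * (1 + gen ?k))) (scal qvar * TS r W)"
    by (rule heq_mult_left[OF r FA_scal heq_sym[OF r W]])
  ultimately show ?thesis using heq_trans[OF r] by blast
qed

text \<open>The factor is the sum of the products \<open>T\<^sub>x\<^sub>0\<^sub>+\<^sub>t\<^sub>-\<^sub>1 \<dots> T\<^sub>x\<^sub>0\<close>, that is, over the minimal representatives of
  the left cosets of the stabiliser of \<open>x0\<close>. So it symmetrises the part that fixes \<open>x0\<close>, and each
  further generator on the right that moves this part on contributes a factor \<open>q\<close>.\<close>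

lemma exists_K:
  obtains K where "K \<in> FA r" "\<And>t. t \<le> M \<Longrightarrow> heq r (K * TS r (to_x0 t)) (scal (qvar ^ t) * TS r W)"
proof -
  have sub: "to_x0 t \<subseteq> WB r" "from_x0 t \<subseteq> WB r" for t using stab_WB by (auto simp: to_x0_def from_x0_def)
  have ft: "from_x0 0 = to_x0 0" by (simp add: from_x0_def to_x0_def)
  have "\<exists>g\<in>FA r. heq r (g * TS r (to_x0 0)) (TS r (from_x0 t))" if "t \<le> M" for t
    using that
  proof (induction t)
    case 0
    show ?case using heq_refl[OF r TS_FA[OF r sub(1)]] ft by (intro bexI[of _ 1] FA_one) simp
  next
    case (Suc t)
    hence t: "t < M" by simp
    from Suc obtain g where g: "g \<in> FA r" "heq r (g * TS r (to_x0 0)) (TS r (from_x0 t))" by auto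
    have gx: "gen (x0+t) \<in> FA r" using FA_gen sB_W[OF t] by blast
    have "heq r (gen (x0+t) * (g * TS r (to_x0 0))) (TS r (from_x0 (Suc t)))"
      using heq_trans[OF r heq_mult_left[OF r gx g(2)] from_x0_step[OF t]] by simp
    thus ?case using FA_mult[OF gx g(1)] by (intro bexI[of _ "gen (x0+t) * g"]) (simp_all add: mult.assoc)
  qed
  then obtain g where g: "\<And>t. t \<le> M \<Longrightarrow> g t \<in> FA r" "\<And>t. t \<le> M \<Longrightarrow> heq r (g t * TS r (to_x0 0)) (TS r (from_x0 t))"
    by metis
  define K where "K = (\<Sum>t\<le>M. g t)"
  have K: "K \<in> FA r" unfolding K_def by (rule FA_sum) (use g in auto)
  have "W = (\<Union>t\<le>M. from_x0 t)"
  proof (intro equalityI subsetI)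
    fix v assume v: "v \<in> W"
    obtain u where "u \<le> M" "v (x0 + 0) = x0 + u" by (rule W_block[OF v, of 0]) simp
    thus "v \<in> (\<Union>t\<le>M. from_x0 t)" using v by (auto simp: from_x0_def)
  qed (auto simp: from_x0_def)
  hence "TS r W = sum (tw r) (\<Union>t\<le>M. from_x0 t)" by (simp only: TS_def)
  also have "\<dots> = (\<Sum>t\<le>M. TS r (from_x0 t))" unfolding TS_def
    by (rule sum.UNION_disjoint) (use finite_subset[OF sub(2) WB_finite] in \<open>auto simp: from_x0_def\<close>)
  finally have "TS r W = (\<Sum>t\<le>M. TS r (from_x0 t))" .
  moreover have "heq r (K * TS r (to_x0 0)) (\<Sum>t\<le>M. TS r (from_x0 t))"
    unfolding K_def sum_distrib_right by (rule heq_sum[OF r]) (use g in auto)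
  ultimately have K0: "heq r (K * TS r (to_x0 0)) (TS r W)" by simp
  have "heq r (K * TS r (to_x0 t)) (scal (qvar ^ t) * TS r W)" if "t \<le> M" for t
    using that
  proof (induction t)
    case 0 thus ?case using K0 by (simp add: scal_one)
  next
    case (Suc t)
    hence t: "t < M" and IH: "heq r (K * TS r (to_x0 t)) (scal (qvar ^ t) * TS r W)" by auto
    have gx: "gen (x0+t) \<in> FA r" using FA_gen sB_W[OF t] by blast
    have "heq r (K * TS r (to_x0 (Suc t))) (K * (TS r (to_x0 t) * gen (x0+t)))"
      using heq_mult_left[OF r K heq_sym[OF r to_x0_step[OF t]]] by simp
    note 1 = heq_trans[OF r this]
    note 2 = heq_mult_right[OF r gx IH, unfolded mult.assoc]
    note 3 = heq_mult_left[OF r FA_scal[of "qvar ^ t"] TS_W_gen[OF t]]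
    have "scal (qvar ^ t) * (scal qvar * TS r W) = scal (qvar ^ Suc t) * TS r W"
      by (simp add: scal_mult[symmetric] mult.assoc[symmetric] mult.commute)
    thus ?case using 1[OF heq_trans[OF r 2 3]] by (simp only:)
  qed
  with K show ?thesis by (rule that)
qed

end

context row_move
begin

section \<open>The multiplication formula in the Hecke algebra\<close>

definition moves :: "(nat \<Rightarrow> nat \<Rightarrow> nat) \<Rightarrow> nat set" where
  "moves A = {p \<in> {1..2*n+1}. A h p > 0}"

text \<open>On a single coset of the parabolic subgroup of the target composition, with representative \<open>w\<close>
  increasing on blocks, the elements with matrix \<open>A\<close> are sorted by the position \<open>x0 + t\<close> of \<open>w\<close> whose
  column label is moved to \<open>x0\<close>. The labels increase with \<open>t\<close>, so that a given label \<open>p\<close> occupies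
  an interval of positions, and the powers of \<open>q\<close> add up to the coefficient of the formula.\<close>

lemma coset_formula:
  assumes K: "K \<in> FA r" "\<And>t. t \<le> M \<Longrightarrow> heq r (K * TS r (to_x0 t)) (scal (qvar ^ t) * TS r W)"
    and nu: "nu \<in> Lam (n+1) r"
    and sym: "\<And>p. p \<in> {1..2*n+1} \<Longrightarrow> A (2*n+2-h) (2*n+2-p) = A h p"
    and out: "\<And>i j. i \<notin> {1..2*n+1} \<or> j \<notin> {1..2*n+1} \<Longrightarrow> A i j = 0"
    and w: "w \<in> WB r" "incr r (lab n lam) (inv' w)"
    and C: "C = (\<lambda>v. v \<circ> w) ` W"
  shows "heq r (K * TS r (C \<inter> cosetB n r mu nu A))
    (\<Sum>p\<in>moves A. scal (gcoef h A p) * TS r (C \<inter> cosetB n r lam nu (shift_down n h A p)))"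
proof -
  define c where "c t = lab n nu (inv' w (x0 + t))" for t
  define A' where "A' = coset_mat n lam w nu"
  define \<tau> where "\<tau> = {t. t \<le> M \<and> A h (c t) > 0 \<and> A' = shift_down n h A (c t)}"
  have CW: "C \<subseteq> WB r" unfolding C using WB_comp[OF _ w(1)] stab_WB by blast
  have matC: "coset_mat n lam y nu = A'" if "y \<in> C" for y
    using that coset_mat_left[OF lam(1) nu w(1)] unfolding C A'_def by blast
  have vw: "inv' (v \<circ> w) x0 = inv' w (inv' v x0)" if "v \<in> W" for v
    using WB_inv_comp[OF subsetD[OF stab_WB that] w(1)] by simp
  have iwr: "inv' w (x0 + t) \<in> {1..2*r}" if "t \<le> M" for t
    using WB_in[OF WB_inv[OF w(1)]] x0_in(2)[OF that] by blast
  have cr: "c t \<in> {1..2*n+1}" if "t \<le> M" for t unfolding c_def by (rule lab_range[OF nu iwr[OF that]])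
  have to: "inv' v x0 = x0 + t" if "v \<in> to_x0 t" for v t
  proof -
    have "v \<in> WB r" "v (x0 + t) = x0" using that stab_WB[of r "lab n lam"] by (auto simp: to_x0_def)
    thus ?thesis using WB_inv_apply(1)[of v r "x0+t"] by simp
  qed
  have S: "C \<inter> cosetB n r mu nu A = (\<Union>t\<in>\<tau>. (\<lambda>v. v \<circ> w) ` to_x0 t)"
  proof (intro equalityI subsetI)
    fix y assume y: "y \<in> C \<inter> cosetB n r mu nu A"
    then obtain v where v: "v \<in> W" "y = v \<circ> w" unfolding C by blast
    obtain t where t: "t \<le> M" "inv' v (x0 + 0) = x0 + t" using W_block[OF stab_inv[OF v(1)], of 0] by blast
    have vB: "v \<in> WB r" using v(1) stab_WB by blast
    have "v (x0 + t) = x0" using WB_inv_apply(2)[OF vB, of x0] t(2) by simp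
    hence vt: "v \<in> to_x0 t" using v(1) by (simp add: to_x0_def)
    have "c t = lab n nu (inv' y x0)" using vw[OF v(1)] t(2) by (simp add: c_def v(2))
    from cosetB_move_down[OF nu _ this, of A] y have "y \<in> cosetB n r lam nu (shift_down n h A (c t))" "A h (c t) > 0" by blast+
    hence "t \<in> \<tau>" using t(1) matC[of y] y cosetB_D(2)[of y] by (simp add: \<tau>_def)
    thus "y \<in> (\<Union>t\<in>\<tau>. (\<lambda>v. v \<circ> w) ` to_x0 t)" using vt v(2) by blast
  next
    fix y assume "y \<in> (\<Union>t\<in>\<tau>. (\<lambda>v. v \<circ> w) ` to_x0 t)"
    then obtain t v where t: "t \<in> \<tau>" and v: "v \<in> to_x0 t" "y = v \<circ> w" by blast
    have vW: "v \<in> W" using v by (simp add: to_x0_def)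
    have yC: "y \<in> C" unfolding C v(2) using vW by blast
    have tt: "t \<le> M" "A h (c t) > 0" "A' = shift_down n h A (c t)" using t by (simp_all add: \<tau>_def)
    have a: "y \<in> cosetB n r lam nu (shift_down n h A (c t))" using matC[OF yC] tt(3) CW yC by (auto simp: cosetB_def)
    have b: "c t = lab n nu (inv' y x0)" using vw[OF vW] to[OF v(1)] by (simp add: c_def v(2))
    have "A (2*n+2-h) (2*n+2-c t) > 0" using sym[OF cr[OF tt(1)]] tt(2) by simp
    hence "y \<in> cosetB n r mu nu A" by (rule cosetB_move_up[OF nu a b tt(2)]) (rule out)
    thus "y \<in> C \<inter> cosetB n r mu nu A" using yC by blast
  qed
  have fin\<tau>: "finite \<tau>" by (rule finite_subset[of _ "{..M}"]) (auto simp: \<tau>_def)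
  have tsub: "to_x0 t \<subseteq> W" "(\<lambda>v. v \<circ> w) ` to_x0 t \<subseteq> WB r" for t
    using WB_comp[OF _ w(1)] stab_WB[of r "lab n lam"] by (auto simp: to_x0_def)
  have twF: "tw r w \<in> FA r" by (rule tw_FA[OF r w(1)])
  have Ttrans: "heq r (TS r X * tw r w) (TS r ((\<lambda>v. v \<circ> w) ` X))" if "X \<subseteq> W" for X
    by (rule TS_translate_right[OF r twF w(1)]) (use tw_stab_left[OF r L w] that in blast)
  have part: "heq r (K * TS r ((\<lambda>v. v \<circ> w) ` to_x0 t)) (scal (qvar ^ t) * TS r C)" if t: "t \<in> \<tau>" for t
  proof -
    have tM: "t \<le> M" using t by (simp add: \<tau>_def)
    note 1 = heq_mult_left[OF r K(1) heq_sym[OF r Ttrans[OF tsub(1)]]]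
    note 2 = heq_mult_right[OF r twF K(2)[OF tM], unfolded mult.assoc]
    have 3: "heq r (scal (qvar ^ t) * (TS r W * tw r w)) (scal (qvar ^ t) * TS r C)"
      unfolding C by (rule heq_mult_left[OF r FA_scal Ttrans[OF subset_refl]])
    show ?thesis by (rule heq_trans[OF r 1 heq_trans[OF r 2 3]])
  qed
  have disj: "(\<lambda>v. v \<circ> w) ` to_x0 s \<inter> (\<lambda>v. v \<circ> w) ` to_x0 t = {}" if "s \<noteq> t" for s t
  proof (rule ccontr)
    assume "(\<lambda>v. v \<circ> w) ` to_x0 s \<inter> (\<lambda>v. v \<circ> w) ` to_x0 t \<noteq> {}"
    then obtain u v where uv: "u \<in> to_x0 s" "v \<in> to_x0 t" "u \<circ> w = v \<circ> w" by blast
    have uv': "u \<in> W" "v \<in> W" using uv by (auto simp: to_x0_def)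
    have "inv' w (x0 + s) = inv' w (x0 + t)"
      using vw[OF uv'(1)] vw[OF uv'(2)] to[OF uv(1)] to[OF uv(2)] uv(3) by simp
    hence "x0 + s = x0 + t" using WB_inj[OF WB_inv[OF w(1)]] by blast
    thus False using that by simp
  qed
  have finX: "finite X" if "X \<subseteq> WB r" for X using finite_subset[OF that WB_finite] .
  have "TS r (C \<inter> cosetB n r mu nu A) = (\<Sum>t\<in>\<tau>. TS r ((\<lambda>v. v \<circ> w) ` to_x0 t))"
    unfolding S TS_def by (rule sum.UNION_disjoint) (use fin\<tau> finX[OF tsub(2)] disj in blast)+
  hence "K * TS r (C \<inter> cosetB n r mu nu A) = (\<Sum>t\<in>\<tau>. K * TS r ((\<lambda>v. v \<circ> w) ` to_x0 t))"
    by (simp add: sum_distrib_left)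
  moreover have "heq r (\<Sum>t\<in>\<tau>. K * TS r ((\<lambda>v. v \<circ> w) ` to_x0 t)) (\<Sum>t\<in>\<tau>. scal (qvar ^ t) * TS r C)"
    by (rule heq_sum[OF r part])
  ultimately have lhs: "heq r (K * TS r (C \<inter> cosetB n r mu nu A)) (scal (\<Sum>t\<in>\<tau>. qvar ^ t) * TS r C)"
    by (simp add: scal_sum sum_distrib_right)
  have CB: "C \<inter> cosetB n r lam nu B = (if B = A' then C else {})" for B
    using matC CW by (auto simp: cosetB_def)
  have "(\<Sum>p\<in>moves A. scal (gcoef h A p) * TS r (C \<inter> cosetB n r lam nu (shift_down n h A p)))
     = (\<Sum>p\<in>moves A. if shift_down n h A p = A' then scal (gcoef h A p) * TS r C else 0)"
    by (rule sum.cong[OF refl]) (simp add: CB TS_def)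
  also have "\<dots> = scal (\<Sum>t\<in>\<tau>. qvar ^ t) * TS r C"
  proof (cases "\<exists>p\<in>moves A. shift_down n h A p = A'")
    case False
    have "c t \<in> moves A" if "t \<in> \<tau>" for t using that cr by (simp add: \<tau>_def moves_def)
    hence "\<tau> = {}" using False by (auto simp: \<tau>_def)
    moreover have "(\<Sum>p\<in>moves A. if shift_down n h A p = A' then scal (gcoef h A p) * TS r C else 0) = 0"
      by (rule sum.neutral) (use False in auto)
    ultimately show ?thesis by (simp add: scal_zero)
  next
    case True
    then obtain p where p: "p \<in> moves A" "shift_down n h A p = A'" by blast
    have uniq: "shift_down n h A p' = A' \<longleftrightarrow> p' = p" for p' using shift_down_inj p(2) by blast
    have finm: "finite (moves A)" by (simp add: moves_def)
    have "(\<Sum>p'\<in>moves A. if shift_down n h A p' = A' then scal (gcoef h A p') * TS r C else 0)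
      = scal (gcoef h A p) * TS r C"
      unfolding uniq using sum.delta[OF finm, of p "\<lambda>p'. scal (gcoef h A p') * TS r C"] p(1) by simp
    moreover have "(\<Sum>t\<in>\<tau>. qvar ^ t) = gcoef h A p"
    proof -
      have pp: "p \<in> {1..2*n+1}" "A h p > 0" using p(1) by (simp_all add: moves_def)
      have "A' = shift_down n h A p' \<longleftrightarrow> p' = p" for p' using uniq[of p'] by auto
      hence \<tau>: "\<tau> = {t. t \<le> M \<and> c t = p}" using pp(2) by (auto simp: \<tau>_def)
      have cnt: "card {t. t \<le> M \<and> c t = j} = A (h+1) j + (if j = p then 1 else 0)" if j: "j \<in> {1..2*n+1}" for j
      proof -
        have h1: "h+1 \<in> {1..2*n+1}" using h by simp
        have "A' (h+1) j = card {x\<in>{1..2*r}. lab n lam x = h+1 \<and> lab n nu (inv' w x) = j}"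
          unfolding A'_def by (rule coset_mat_card'[OF lam(1) nu w(1) h1 j])
        also have "{x\<in>{1..2*r}. lab n lam x = h+1 \<and> lab n nu (inv' w x) = j} = (\<lambda>t. x0 + t) ` {t. t \<le> M \<and> c t = j}"
        proof (intro equalityI subsetI)
          fix x assume "x \<in> {x\<in>{1..2*r}. lab n lam x = h+1 \<and> lab n nu (inv' w x) = j}"
          hence x: "x \<in> {1..2*r}" "lab n lam x = h+1" "lab n nu (inv' w x) = j" by blast+
          have "x0 \<le> x \<and> x \<le> x0 + M" using lab_lam_block[OF x(1)] x(2) by simp
          thus "x \<in> (\<lambda>t. x0 + t) ` {t. t \<le> M \<and> c t = j}" using x(3)
            by (intro image_eqI[of _ _ "x - x0"]) (auto simp: c_def)
        next
          fix x assume "x \<in> (\<lambda>t. x0 + t) ` {t. t \<le> M \<and> c t = j}"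
          then obtain t where t: "t \<le> M" "c t = j" "x = x0 + t" by blast
          have "lab n lam x = h+1" using lab_lam_block[OF x0_in(2)[OF t(1)]] t by simp
          thus "x \<in> {x\<in>{1..2*r}. lab n lam x = h+1 \<and> lab n nu (inv' w x) = j}"
            using x0_in(2)[OF t(1)] t(2,3) by (simp add: c_def)
        qed
        also have "card \<dots> = card {t. t \<le> M \<and> c t = j}" by (rule card_image) simp
        finally show ?thesis using shift_down_row[of A p j] p(2) by simp
      qed
      have mono: "c s \<le> c t" if "s \<le> t" "t \<le> M" for s t
      proof (cases "s = t")
        case False
        hence st: "s < t" using that by simp
        have x: "x0 + s \<in> {1..2*r}" "x0 + t \<in> {1..2*r}" using x0_in(2) that by simp_all
        have e: "lab n lam (x0 + s) = lab n lam (x0 + t)" using lab_lam_block[OF x(1)] lab_lam_block[OF x(2)] that by simp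
        have "inv' w (x0 + s) < inv' w (x0 + t)"
          using incr_full[OF L WB_inv[OF w(1)] w(2), of "x0+s" "x0+t"] st x e by simp
        moreover have "inv' w (x0 + s) \<in> {1..2*r}" "inv' w (x0 + t) \<in> {1..2*r}" using iwr that by simp_all
        ultimately show ?thesis unfolding c_def
          using labelling_mono[OF lab_labelling[OF nu], of "inv' w (x0+s)" "inv' w (x0+t)"] by simp
      qed simp
      have s: "(\<Sum>j\<in>{1..<p}. card {t. t \<le> M \<and> c t = j}) = (\<Sum>j\<in>{1..<p}. A (h+1) j)"
        by (rule sum.cong[OF refl]) (use cnt pp(1) in auto)
      have "\<tau> = {(\<Sum>j\<in>{1..<p}. A (h+1) j) ..< (\<Sum>j\<in>{1..<p}. A (h+1) j) + (A (h+1) p + 1)}"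
        unfolding \<tau> using mono_fibre[of M c p, OF mono] cr cnt[OF pp(1)] unfolding s by simp
      hence "(\<Sum>t\<in>\<tau>. qvar ^ t) = (\<Sum>i<A (h+1) p + 1. qvar ^ (i + (\<Sum>j\<in>{1..<p}. A (h+1) j)))"
        using sum.shift_bounds_nat_ivl[of "\<lambda>t. qvar ^ t" 0 "\<Sum>j\<in>{1..<p}. A (h+1) j" "A (h+1) p + 1"]
        by (simp add: lessThan_atLeast0 add.commute)
      also have "\<dots> = gcoef h A p"
        using pp(2) by (simp add: gcoef_def qint_sum power_add sum_distrib_right mult.commute del: sum.lessThan_Suc)
      finally show ?thesis .
    qed
    ultimately show ?thesis by simp
  qed
  finally show ?thesis using lhs by simp
qed

text \<open>Both sides are additive over the right cosets contained in \<open>X\<close>. The case of interest is the set of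
  all elements of one parity.\<close>

lemma row_move_formula:
  assumes K: "K \<in> FA r" "\<And>t. t \<le> M \<Longrightarrow> heq r (K * TS r (to_x0 t)) (scal (qvar ^ t) * TS r W)"
    and nu: "nu \<in> Lam (n+1) r"
    and sym: "\<And>p. p \<in> {1..2*n+1} \<Longrightarrow> A (2*n+2-h) (2*n+2-p) = A h p"
    and out: "\<And>i j. i \<notin> {1..2*n+1} \<or> j \<notin> {1..2*n+1} \<Longrightarrow> A i j = 0"
    and X: "X \<subseteq> WB r" "\<And>x v. x \<in> X \<Longrightarrow> v \<in> W \<Longrightarrow> v \<circ> x \<in> X"
  shows "heq r (K * TS r (X \<inter> cosetB n r mu nu A))
    (\<Sum>p\<in>moves A. scal (gcoef h A p) * TS r (X \<inter> cosetB n r lam nu (shift_down n h A p)))"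
proof (rule peel_left[where Y = W and X = X and P = "\<lambda>X. heq r (K * TS r (X \<inter> cosetB n r mu nu A))
    (\<Sum>p\<in>moves A. scal (gcoef h A p) * TS r (X \<inter> cosetB n r lam nu (shift_down n h A p)))"])
  show "heq r (K * TS r ({} \<inter> cosetB n r mu nu A))
    (\<Sum>p\<in>moves A. scal (gcoef h A p) * TS r ({} \<inter> cosetB n r lam nu (shift_down n h A p)))"
    by (simp add: TS_def heq_refl[OF r FA_zero])
next
  fix x :: "nat \<Rightarrow> nat" and Z
  let ?C = "(\<lambda>y. y \<circ> x) ` W"
  assume a: "x \<in> WB r" "Z \<subseteq> WB r" "?C \<inter> Z = {}"
    "heq r (K * TS r (Z \<inter> cosetB n r mu nu A))
      (\<Sum>p\<in>moves A. scal (gcoef h A p) * TS r (Z \<inter> cosetB n r lam nu (shift_down n h A p)))"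
  obtain v where v: "v \<in> W" "incr r (lab n lam) (inv' (v \<circ> x))" using exists_incr_left[OF L a(1)] by blast
  have vx: "v \<circ> x \<in> WB r" using v(1) stab_WB WB_comp[OF _ a(1)] by blast
  have C: "?C = (\<lambda>u. u \<circ> (v \<circ> x)) ` W" using coset_rebase_left[OF stab_grp v(1), of x] by simp
  have CW: "?C \<subseteq> WB r" using stab_WB WB_comp[OF _ a(1)] by blast
  have un: "TS r ((?C \<union> Z) \<inter> B) = TS r (?C \<inter> B) + TS r (Z \<inter> B)" for B
  proof -
    have "(?C \<union> Z) \<inter> B = (?C \<inter> B) \<union> (Z \<inter> B)" by blast
    moreover have "TS r ((?C \<inter> B) \<union> (Z \<inter> B)) = TS r (?C \<inter> B) + TS r (Z \<inter> B)"
      by (rule TS_Un) (use CW a in blast)+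
    ultimately show ?thesis by simp
  qed
  show "heq r (K * TS r ((?C \<union> Z) \<inter> cosetB n r mu nu A))
    (\<Sum>p\<in>moves A. scal (gcoef h A p) * TS r ((?C \<union> Z) \<inter> cosetB n r lam nu (shift_down n h A p)))"
    unfolding un distrib_left sum.distrib
    by (rule heq_add[OF r coset_formula[where K = K and nu = nu and A = A and w = "v \<circ> x" and C = ?C, OF K nu sym out vx v(2) C] a(4)])
qed (use X stab_grp in blast)+

lemma par_closed: "x \<in> par r \<delta> \<Longrightarrow> v \<in> W \<Longrightarrow> v \<circ> x \<in> par r \<delta>"
proof -
  assume x: "x \<in> par r \<delta>" and v: "v \<in> W"
  have r1: "r \<ge> 1" using r by simp
  have vD: "v \<in> WB r" "even (neg r v)" using subsetD[OF stab_WD[OF lam(1) r1 lam(2)] v] by (simp_all add: WD_iff)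
  thus "v \<circ> x \<in> par r \<delta>" using x WB_comp[OF vD(1)] neg_parity[OF vD(1) _ r1] by (simp add: par_def)
qed

text \<open>The stabiliser itself is the double coset of a diagonal matrix. Applied to it, the formula has a
  single term with coefficient one, and identifies the factor as the one that gives the double coset of
  \<open>C\<close>.\<close>

lemma cosetB_diag: "cosetB n r mu mu (diag_mat (hat n mu)) = stab r (lab n mu)"
proof (intro equalityI subsetI)
  fix w assume "w \<in> cosetB n r mu mu (diag_mat (hat n mu))"
  hence w: "w \<in> WB r" "coset_mat n mu w mu = diag_mat (hat n mu)" by (simp_all add: cosetB_def)
  have "lab n mu (w x) = lab n mu x" if x: "x \<in> {1..2*r}" for x
  proof (rule ccontr)
    assume ne: "lab n mu (w x) \<noteq> lab n mu x"
    have wx: "w x \<in> {1..2*r}" using WB_in[OF w(1)] x by blast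
    let ?S = "{y\<in>{1..2*r}. lab n mu (w y) = lab n mu (w x) \<and> lab n mu y = lab n mu x}"
    have "card ?S = 0"
      using coset_mat_card[OF mu(1) mu(1) w(1) lab_range[OF mu(1) wx] lab_range[OF mu(1) x]] w(2) ne
      by (simp add: diag_mat_def)
    moreover have "finite ?S" "x \<in> ?S" using x by auto
    ultimately show False using card_0_eq[of ?S] by blast
  qed
  thus "w \<in> stab r (lab n mu)" using w(1) by (simp add: stab_def)
next
  fix w assume w: "w \<in> stab r (lab n mu)"
  have "coset_mat n mu id mu i j = diag_mat (hat n mu) i j" for i j
  proof (cases "i \<in> {1..2*n+1} \<and> j \<in> {1..2*n+1}")
    case True
    hence ij: "i \<in> {1..2*n+1}" "j \<in> {1..2*n+1}" by blast+
    show ?thesis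
    proof (cases "i = j")
      case True
      hence "{y\<in>{1..2*r}. lab n mu (id y) = i \<and> lab n mu y = j} = {y\<in>{1..2*r}. lab n mu y = i}" by auto
      thus ?thesis unfolding coset_mat_card[OF mu(1) mu(1) WB_id ij]
        using card_lab[OF mu(1) ij(1)] True by (simp only: diag_mat_def simp_thms if_True)
    next
      case False
      hence "{y\<in>{1..2*r}. lab n mu (id y) = i \<and> lab n mu y = j} = {}" by auto
      thus ?thesis unfolding coset_mat_card[OF mu(1) mu(1) WB_id ij]
        using False by (simp only: diag_mat_def if_False card.empty)
    qed
  next
    case False
    thus ?thesis using coset_mat_outside[of i n j] by (auto simp: diag_mat_def hat_def)
  qed
  hence "id \<in> cosetB n r mu mu (diag_mat (hat n mu))" using WB_id by (simp add: cosetB_def fun_eq_iff)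
  from cosetB_left[OF mu(1) mu(1) this w] show "w \<in> cosetB n r mu mu (diag_mat (hat n mu))" by (simp only: comp_id)
qed

lemma shift_diag: "shift_down n h (diag_mat (hat n mu)) h = (\<lambda>i j. E_theta n (h+1) h i j + diag_mat (hat n gam) i j)"
proof (intro ext)
  fix i j
  have "hat n mu i = hat n gam i + (if i = h then 1 else 0) + (if i = 2*n+2-h then 1 else 0)"
  proof -
    consider "i \<in> {1..n}" | "i = n+1" | "i \<in> {n+2..2*n+1}" | "i \<notin> {1..2*n+1}" by fastforce
    thus ?thesis
    proof cases
      case 3
      hence "2*n+2-i = h \<longleftrightarrow> i = 2*n+2-h" "i \<noteq> h" using h by auto
      thus ?thesis using 3 mu_gam[of "2*n+2-i"] by (simp add: hat_def)
    next
      case 1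
      hence "i \<noteq> 2*n+2-h" using h by auto
      thus ?thesis using 1 mu_gam[of i] by (simp add: hat_def)
    next
      case 2
      hence "i \<noteq> 2*n+2-h" "i \<noteq> h" using h by auto
      thus ?thesis using 2 mu_gam[of i] by (simp add: hat_def)
    next
      case 4
      hence "i \<noteq> 2*n+2-h" "i \<noteq> h" "i \<notin> {1..n}" "i \<noteq> n+1" "i \<notin> {n+2..2*n+1}" using h by auto
      thus ?thesis by (simp only: hat_def if_False add_0)
    qed
  qed
  hence "diag_mat (hat n mu) i j = diag_mat (hat n gam) i j + E_theta n h h i j"
    unfolding E_theta_h diag_mat_def by (cases "i = j") simp_all
  thus "shift_down n h (diag_mat (hat n mu)) h i j = E_theta n (h+1) h i j + diag_mat (hat n gam) i j"
    by (simp add: shift_down_def)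
qed

lemma diag_formula:
  assumes K: "K \<in> FA r" "\<And>t. t \<le> M \<Longrightarrow> heq r (K * TS r (to_x0 t)) (scal (qvar ^ t) * TS r W)"
  shows "heq r (K * TS r (stab r (lab n mu)))
    (TS r (par r True \<inter> cosetB n r lam mu (\<lambda>i j. E_theta n (h+1) h i j + diag_mat (hat n gam) i j)))"
proof -
  let ?A = "diag_mat (hat n mu)"
  have r1: "r \<ge> 1" using r by simp
  have "par r True \<inter> stab r (lab n mu) = stab r (lab n mu)"
    using stab_WD[OF mu(1) r1 mu(2)] by (auto simp: par_def WD_iff)
  hence X: "par r True \<inter> cosetB n r mu mu ?A = stab r (lab n mu)" unfolding cosetB_diag .
  have hm: "hat n mu h = mu h" "mu h \<ge> 1" using h mu_gam[of h] by (auto simp: hat_def)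
  hence m: "moves ?A = {h}" using h by (auto simp: moves_def diag_mat_def)
  have "qint 1 = 1" by (simp add: qint_sum)
  hence g: "gcoef h ?A h = 1" using hm by (simp add: gcoef_def diag_mat_def)
  have "heq r (K * TS r (par r True \<inter> cosetB n r mu mu ?A))
    (\<Sum>p\<in>moves ?A. scal (gcoef h ?A p) * TS r (par r True \<inter> cosetB n r lam mu (shift_down n h ?A p)))"
  proof (rule row_move_formula[OF K mu(1)])
    show "?A (2*n+2-h) (2*n+2-p) = ?A h p" if "p \<in> {1..2*n+1}" for p
      using that h hat_sym[of h n mu] by (auto simp: diag_mat_def)
    show "?A i j = 0" if "i \<notin> {1..2*n+1} \<or> j \<notin> {1..2*n+1}" for i j
      using that by (auto simp: diag_mat_def hat_def)
    show "par r True \<subseteq> WB r" by (auto simp: par_def)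
  qed (assumption | (rule par_closed; assumption))+
  thus ?thesis unfolding X m by (simp add: g scal_one shift_diag)
qed

end

section \<open>Homomorphisms between the permutation modules\<close>

lemma finite_Lam: "finite (Lam k m)"
proof (rule finite_subset)
  show "Lam k m \<subseteq> {f. \<forall>x. (x \<in> {1..k} \<longrightarrow> f x \<in> {..m}) \<and> (x \<notin> {1..k} \<longrightarrow> f x = 0)}"
  proof (clarsimp simp: Lam_def simp del: atLeastAtMost_iff One_nat_def)
    fix f :: "nat \<Rightarrow> nat" and x assume "x \<in> {1..k}"
    thus "f x \<le> sum f {1..k}" by (intro member_le_sum) auto
  qed
  show "finite {f. \<forall>x. (x \<in> {1..k} \<longrightarrow> f x \<in> {..m}) \<and> (x \<notin> {1..k} \<longrightarrow> f x = (0::nat))}"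
    by (rule finite_set_of_finite_funs) auto
qed

lemma finite_LamD: "finite (LamD n r)"
proof -
  have "finite (UNIV :: pm set)"
    by (rule finite_subset[of _ "{Plus, Minus}"]) (auto intro: pm.exhaust)
  hence "finite (Bullet ` Lam (n+1) r \<union> (\<lambda>(l,e). Signed l e) ` (Lam (n+1) r \<times> UNIV))"
    using finite_Lam by simp
  thus ?thesis by (rule rev_finite_subset) (auto simp: LamD_def)
qed

lemma LamD_sbracket: "l \<in> Lam (n+1) r \<Longrightarrow> sbracket n l e \<in> LamD n r"
  by (auto simp: LamD_def sbracket_def)

lemma LamD_cases:
  assumes "a \<in> LamD n r" obtains l e where "l \<in> Lam (n+1) r" "a = sbracket n l e"
  using assms that by (auto simp: LamD_def sbracket_def)

lemma WparD_WB:
  assumes r: "r \<ge> 1" and a: "a \<in> LamD n r" shows "WparD n r a \<subseteq> WB r"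
proof -
  obtain l e where l: "l \<in> Lam (n+1) r" "a = sbracket n l e" using LamD_cases[OF a] .
  show ?thesis unfolding l(2) WparD_conj[OF l(1) r] using s_sign_conj_parity(1)[OF r] stab_WB by blast
qed

definition xrep :: "nat \<Rightarrow> nat \<Rightarrow> dsym \<Rightarrow> falg" where
  "xrep n r a = TS r (WparD n r a)"

text \<open>The modules \<open>x\<^sub>\<alpha> H\<close> are handled through representatives in the free algebra.\<close>

locale qschur =
  fixes n r :: nat assumes r: "r \<ge> 2"
begin

abbreviation H where "H \<equiv> hecke r"
abbreviation MM where "MM \<equiv> tensorD n r"

lemma r1: "r \<ge> 1" using r by simp

lemma xrep_FA: "a \<in> LamD n r \<Longrightarrow> xrep n r a \<in> FA r"
  unfolding xrep_def by (rule TS_FA[OF r WparD_WB[OF r1]])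

lemma xD_xrep: "a \<in> LamD n r \<Longrightarrow> xD n r a = cls r (xrep n r a)"
  unfolding xD_def xrep_def by (rule Tsum_TS[OF r WparD_WB[OF r1]])

lemma MM_iff: "v \<in> MM \<longleftrightarrow> v \<in> extensional (LamD n r) \<and>
   (\<forall>a\<in>LamD n r. \<exists>y\<in>FA r. cls r y \<in> heckeD r \<and> v a = cls r (xrep n r a * y))"
proof -
  have "(\<lambda>h. xD n r a \<otimes>\<^bsub>H\<^esub> h) ` heckeD r = {cls r (xrep n r a * y) | y. y \<in> FA r \<and> cls r y \<in> heckeD r}"
    if a: "a \<in> LamD n r" for a
  proof (intro equalityI subsetI)
    fix z assume "z \<in> (\<lambda>h. xD n r a \<otimes>\<^bsub>H\<^esub> h) ` heckeD r"
    then obtain h where h: "h \<in> heckeD r" "z = xD n r a \<otimes>\<^bsub>H\<^esub> h" by blast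
    obtain y where "y \<in> FA r" "h = cls r y" using heckeD_FA[OF r h(1)] by blast
    thus "z \<in> {cls r (xrep n r a * y) | y. y \<in> FA r \<and> cls r y \<in> heckeD r}"
      using h hecke_mult[OF r xrep_FA[OF a]] xD_xrep[OF a] by auto
  next
    fix z assume "z \<in> {cls r (xrep n r a * y) | y. y \<in> FA r \<and> cls r y \<in> heckeD r}"
    then obtain y where y: "z = cls r (xrep n r a * y)" "y \<in> FA r" "cls r y \<in> heckeD r" by blast
    thus "z \<in> (\<lambda>h. xD n r a \<otimes>\<^bsub>H\<^esub> h) ` heckeD r"
      using hecke_mult[OF r xrep_FA[OF a] y(2)] xD_xrep[OF a] by (intro image_eqI[OF _ y(3)]) simp
  qed
  hence "v a \<in> (\<lambda>h. xD n r a \<otimes>\<^bsub>H\<^esub> h) ` heckeD r \<longleftrightarrow>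
    (\<exists>y\<in>FA r. cls r y \<in> heckeD r \<and> v a = cls r (xrep n r a * y))" if "a \<in> LamD n r" for a
    using that by (simp only: mem_Collect_eq) blast
  thus ?thesis unfolding tensorD_def PiE_iff by blast
qed

lemma MM_comp:
  assumes "v \<in> MM" "a \<in> LamD n r"
  obtains y where "y \<in> FA r" "cls r y \<in> heckeD r" "v a = cls r (xrep n r a * y)"
  using assms unfolding MM_iff by blast

lemma MM_carrier:
  assumes "v \<in> MM" "a \<in> LamD n r" obtains z where "z \<in> FA r" "v a = cls r z"
proof -
  obtain y where "y \<in> FA r" "v a = cls r (xrep n r a * y)" using MM_comp[OF assms] by blast
  thus ?thesis using that[of "xrep n r a * y"] FA_mult[OF xrep_FA[OF assms(2)]] by blast
qed

lemma MM_ext: "u \<in> MM \<Longrightarrow> v \<in> MM \<Longrightarrow> (\<And>a. a \<in> LamD n r \<Longrightarrow> u a = v a) \<Longrightarrow> u = v"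
  unfolding MM_iff by (blast intro: extensionalityI)

definition vzero :: "dsym \<Rightarrow> falg set" where "vzero = (\<lambda>a\<in>LamD n r. cls r 0)"

lemma vzero_MM: "vzero \<in> MM"
  unfolding MM_iff vzero_def using FA_zero heckeD_zero by (auto intro!: bexI[of _ 0])

lemma vadd_MM:
  assumes "u \<in> MM" "v \<in> MM" shows "vadd n r u v \<in> MM"
  unfolding MM_iff
proof (intro conjI ballI)
  fix a assume a: "a \<in> LamD n r"
  obtain y where y: "y \<in> FA r" "cls r y \<in> heckeD r" "u a = cls r (xrep n r a * y)" using MM_comp[OF assms(1) a] .
  obtain z where z: "z \<in> FA r" "cls r z \<in> heckeD r" "v a = cls r (xrep n r a * z)" using MM_comp[OF assms(2) a] .
  have "vadd n r u v a = cls r (xrep n r a * (y + z))"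
    using hecke_add[OF r] y z a FA_mult xrep_FA[OF a] by (simp add: vadd_def distrib_left)
  moreover have "cls r (y + z) \<in> heckeD r" using heckeD_add[OF y(2) z(2)] hecke_add[OF r y(1) z(1)] by simp
  ultimately show "\<exists>y\<in>FA r. cls r y \<in> heckeD r \<and> vadd n r u v a = cls r (xrep n r a * y)"
    using FA_add[OF y(1) z(1)] by blast
qed (simp add: vadd_def)

lemma vact_MM:
  assumes "v \<in> MM" "h \<in> heckeD r" shows "vact n r v h \<in> MM"
  unfolding MM_iff
proof (intro conjI ballI)
  fix a assume a: "a \<in> LamD n r"
  obtain y where y: "y \<in> FA r" "cls r y \<in> heckeD r" "v a = cls r (xrep n r a * y)" using MM_comp[OF assms(1) a] .
  obtain z where z: "z \<in> FA r" "h = cls r z" using heckeD_FA[OF r assms(2)] by blast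
  have "vact n r v h a = cls r (xrep n r a * (y * z))"
    using hecke_mult[OF r] y z a FA_mult xrep_FA[OF a] by (simp add: vact_def mult.assoc)
  moreover have "cls r (y * z) \<in> heckeD r"
    using heckeD_mult[OF y(2) assms(2)] hecke_mult[OF r y(1) z(1)] z(2) by simp
  ultimately show "\<exists>y\<in>FA r. cls r y \<in> heckeD r \<and> vact n r v h a = cls r (xrep n r a * y)"
    using FA_mult[OF y(1) z(1)] by blast
qed (simp add: vact_def)

lemma vadd_apply: "a \<in> LamD n r \<Longrightarrow> vadd n r u v a = u a \<oplus>\<^bsub>H\<^esub> v a"
  by (simp add: vadd_def)

lemma vact_apply: "a \<in> LamD n r \<Longrightarrow> vact n r v h a = v a \<otimes>\<^bsub>H\<^esub> h"
  by (simp add: vact_def)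

lemma MM_in_carrier: "v \<in> MM \<Longrightarrow> a \<in> LamD n r \<Longrightarrow> v a \<in> carrier H"
  using MM_carrier hecke_carrier by (metis image_eqI)

lemma heckeD_carrier: "h \<in> heckeD r \<Longrightarrow> h \<in> carrier H"
  using heckeD_subset[OF r] by blast

sublocale H: ring "hecke r" by (rule ring_hecke[OF r])

lemma vadd_comm: "u \<in> MM \<Longrightarrow> v \<in> MM \<Longrightarrow> vadd n r u v = vadd n r v u"
  by (rule MM_ext) (auto simp: vadd_MM vadd_apply MM_in_carrier H.a_comm)

lemma vadd_assoc: "u \<in> MM \<Longrightarrow> v \<in> MM \<Longrightarrow> w \<in> MM \<Longrightarrow> vadd n r (vadd n r u v) w = vadd n r u (vadd n r v w)"
  by (rule MM_ext) (auto simp: vadd_MM vadd_apply MM_in_carrier H.a_assoc)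

lemma vadd_zero:
  assumes v: "v \<in> MM" shows "vadd n r vzero v = v"
  by (rule MM_ext[OF vadd_MM[OF vzero_MM v] v]) (simp add: vadd_apply MM_in_carrier[OF v] vzero_def hecke_zero[symmetric])

lemma vadd_swap:
  assumes "u \<in> MM" "v \<in> MM" "u' \<in> MM" "v' \<in> MM"
  shows "vadd n r (vadd n r u v) (vadd n r u' v') = vadd n r (vadd n r u u') (vadd n r v v')"
  by (rule MM_ext) (use assms in \<open>simp_all add: vadd_MM vadd_apply MM_in_carrier H.a_ac\<close>)

lemma vact_vadd: "u \<in> MM \<Longrightarrow> v \<in> MM \<Longrightarrow> h \<in> heckeD r \<Longrightarrow> vact n r (vadd n r u v) h = vadd n r (vact n r u h) (vact n r v h)"
  by (rule MM_ext) (auto simp: vadd_MM vact_MM vadd_apply vact_apply MM_in_carrier heckeD_carrier H.l_distr)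

lemma inj_at_apply: "c \<in> LamD n r \<Longrightarrow> inj_at n r a X c = (if c = a then X else cls r 0)"
  by (simp add: inj_at_def hecke_zero)

lemma inj_at_MM:
  assumes "a \<in> LamD n r" "y \<in> FA r" "cls r y \<in> heckeD r"
  shows "inj_at n r a (cls r (xrep n r a * y)) \<in> MM"
  unfolding MM_iff
proof (intro conjI ballI)
  fix c assume c: "c \<in> LamD n r"
  show "\<exists>y'\<in>FA r. cls r y' \<in> heckeD r \<and> inj_at n r a (cls r (xrep n r a * y)) c = cls r (xrep n r c * y')"
  proof (cases "c = a")
    case True
    thus ?thesis using assms c by (auto simp: inj_at_apply)
  next
    case False
    thus ?thesis using FA_zero heckeD_zero c by (auto simp: inj_at_apply intro!: bexI[of _ 0])
  qed
qed (simp add: inj_at_def)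

text \<open>Left multiplication by \<open>K\<close>, from the component \<open>b\<close> to the component \<open>a\<close>. It is a
  homomorphism as soon as the image of the generator lies in the right ideal.\<close>

definition Op :: "dsym \<Rightarrow> dsym \<Rightarrow> falg \<Rightarrow> (dsym \<Rightarrow> falg set) \<Rightarrow> (dsym \<Rightarrow> falg set)" where
  "Op a b K = (\<lambda>v\<in>MM. inj_at n r a (cls r K \<otimes>\<^bsub>H\<^esub> v b))"

definition maps_gen :: "dsym \<Rightarrow> dsym \<Rightarrow> falg \<Rightarrow> bool" where
  "maps_gen a b K \<longleftrightarrow> a \<in> LamD n r \<and> b \<in> LamD n r \<and> K \<in> FA r \<and>
     (\<exists>K'\<in>FA r. cls r K' \<in> heckeD r \<and> heq r (K * xrep n r b) (xrep n r a * K'))"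

lemma Op_apply:
  assumes "b \<in> LamD n r" "K \<in> FA r" "v \<in> MM" "y \<in> FA r" "v b = cls r (xrep n r b * y)"
  shows "Op a b K v = inj_at n r a (cls r (K * xrep n r b * y))"
  using assms hecke_mult[OF r assms(2) FA_mult[OF xrep_FA[OF assms(1)] assms(4)]]
  by (simp add: Op_def mult.assoc)

text \<open>The component \<open>b\<close> consists of the multiples of its generator, so the image of the generator determines
  the operator.\<close>

lemma Op_cong:
  assumes b: "b \<in> LamD n r" and e: "heq r (K * xrep n r b) (K' * xrep n r b)" and K: "K \<in> FA r" "K' \<in> FA r"
  shows "Op a b K = Op a b K'"
proof
  fix v
  show "Op a b K v = Op a b K' v"
  proof (cases "v \<in> MM")
    case True
    obtain y where y: "y \<in> FA r" "v b = cls r (xrep n r b * y)" using MM_comp[OF True b] by blast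
    have "cls r (K * xrep n r b * y) = cls r (K' * xrep n r b * y)"
      using heq_mult_right[OF r y(1) e] cls_eq_iff[OF r] heq_FA by blast
    thus ?thesis using Op_apply[OF b _ True y] K by simp
  qed (simp add: Op_def)
qed

lemma Op_MM:
  assumes "maps_gen a b K" "v \<in> MM" shows "Op a b K v \<in> MM"
proof -
  obtain K' where K: "a \<in> LamD n r" "b \<in> LamD n r" "K \<in> FA r" "K' \<in> FA r" "cls r K' \<in> heckeD r"
    "heq r (K * xrep n r b) (xrep n r a * K')" using assms(1) unfolding maps_gen_def by blast
  obtain y where y: "y \<in> FA r" "cls r y \<in> heckeD r" "v b = cls r (xrep n r b * y)" using MM_comp[OF assms(2) K(2)] .
  have "heq r (K * xrep n r b * y) (xrep n r a * (K' * y))"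
    using heq_mult_right[OF r y(1) K(6)] by (simp add: mult.assoc)
  hence "cls r (K * xrep n r b * y) = cls r (xrep n r a * (K' * y))" using cls_eq_iff[OF r] heq_FA by blast
  moreover have "cls r (K' * y) \<in> heckeD r" using heckeD_mult[OF K(5) y(2)] hecke_mult[OF r K(4) y(1)] by simp
  ultimately show ?thesis
    using Op_apply[OF K(2,3) assms(2) y(1,3)] inj_at_MM[OF K(1) FA_mult[OF K(4) y(1)]] by simp
qed

lemma SD_simps:
  "f \<in> carrier (SD n r) \<longleftrightarrow> f \<in> MM \<rightarrow>\<^sub>E MM \<and> (\<forall>u\<in>MM. \<forall>v\<in>MM. f (vadd n r u v) = vadd n r (f u) (f v))
     \<and> (\<forall>v\<in>MM. \<forall>h\<in>heckeD r. f (vact n r v h) = vact n r (f v) h)"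
  "f \<otimes>\<^bsub>SD n r\<^esub> g = compose MM f g"
  "f \<oplus>\<^bsub>SD n r\<^esub> g = (\<lambda>v\<in>MM. vadd n r (f v) (g v))"
  "\<zero>\<^bsub>SD n r\<^esub> = (\<lambda>v\<in>MM. vzero)"
  "c \<odot>\<^bsub>SD n r\<^esub> f = (\<lambda>v\<in>MM. \<lambda>a\<in>LamD n r. c \<odot>\<^bsub>H\<^esub> f v a)"
  by (simp_all add: SD_def Let_def vzero_def hecke_zero)

lemma SD_D:
  assumes "f \<in> carrier (SD n r)"
  shows "v \<in> MM \<Longrightarrow> f v \<in> MM" "u \<in> MM \<Longrightarrow> v \<in> MM \<Longrightarrow> f (vadd n r u v) = vadd n r (f u) (f v)"
    "v \<in> MM \<Longrightarrow> h \<in> heckeD r \<Longrightarrow> f (vact n r v h) = vact n r (f v) h" "v \<notin> MM \<Longrightarrow> f v = undefined"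
  using assms unfolding SD_simps(1) by (blast, blast, blast, blast dest: PiE_arb)

lemma Op_SD:
  assumes "maps_gen a b K" shows "Op a b K \<in> carrier (SD n r)"
  unfolding SD_simps(1)
proof (intro conjI ballI)
  have ab: "a \<in> LamD n r" "b \<in> LamD n r" "K \<in> FA r" using assms by (auto simp: maps_gen_def)
  have Kc: "cls r K \<in> carrier H" using ab by (simp add: hecke_carrier)
  show "Op a b K \<in> MM \<rightarrow>\<^sub>E MM" using Op_MM[OF assms] by (auto simp: Op_def)
  fix u assume u: "u \<in> MM"
  show "Op a b K (vact n r u h) = vact n r (Op a b K u) h" if h: "h \<in> heckeD r" for h
  proof (rule MM_ext)
    fix c assume c: "c \<in> LamD n r"
    show "Op a b K (vact n r u h) c = vact n r (Op a b K u) h c"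
      using u h c ab Kc MM_in_carrier[OF u ab(2)] heckeD_carrier[OF h]
      by (simp add: Op_def vact_MM inj_at_apply vact_apply H.m_assoc hecke_zero[symmetric])
  qed (use Op_MM[OF assms] vact_MM u h in auto)
  fix v assume v: "v \<in> MM"
  show "Op a b K (vadd n r u v) = vadd n r (Op a b K u) (Op a b K v)"
  proof (rule MM_ext)
    fix c assume c: "c \<in> LamD n r"
    show "Op a b K (vadd n r u v) c = vadd n r (Op a b K u) (Op a b K v) c"
      using u v c ab Kc MM_in_carrier[OF u ab(2)] MM_in_carrier[OF v ab(2)]
      by (simp add: Op_def vadd_MM inj_at_apply vadd_apply H.r_distr hecke_zero[symmetric])
  qed (use Op_MM[OF assms] vadd_MM u v in auto)
qed

text \<open>A homomorphism is determined by its values on single components, which generate the direct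
  sum.\<close>

lemma SD_eqI:
  assumes f: "f \<in> carrier (SD n r)" and g: "g \<in> carrier (SD n r)" and ne: "LamD n r \<noteq> {}"
    and e: "\<And>c y. c \<in> LamD n r \<Longrightarrow> y \<in> FA r \<Longrightarrow> cls r y \<in> heckeD r \<Longrightarrow>
      f (inj_at n r c (cls r (xrep n r c * y))) = g (inj_at n r c (cls r (xrep n r c * y)))"
  shows "f = g"
proof
  fix v
  show "f v = g v"
  proof (cases "v \<in> MM")
    case v: True
    let ?p = "\<lambda>S. \<lambda>c\<in>LamD n r. if c \<in> S then v c else cls r 0"
    have pM: "?p S \<in> MM" for S
      unfolding MM_iff
    proof (intro conjI ballI)
      fix a assume a: "a \<in> LamD n r"
      obtain y where y: "y \<in> FA r" "cls r y \<in> heckeD r" "v a = cls r (xrep n r a * y)" using MM_comp[OF v a] .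
      show "\<exists>y\<in>FA r. cls r y \<in> heckeD r \<and> ?p S a = cls r (xrep n r a * y)"
      proof (cases "a \<in> S")
        case True thus ?thesis using a y by auto
      next
        case False thus ?thesis using a FA_zero heckeD_zero by (intro bexI[of _ 0]) simp_all
      qed
    qed simp
    have fin: "f (?p S) = g (?p S)" if "finite S" "S \<subseteq> LamD n r" for S
      using that
    proof (induction S)
      case empty
      obtain c where c: "c \<in> LamD n r" using ne by blast
      have "?p {} = inj_at n r c (cls r (xrep n r c * 0))"
        unfolding inj_at_def hecke_zero by (rule restrict_ext) simp
      thus ?case using e[OF c FA_zero heckeD_zero] by simp
    next
      case (insert c S)
      have c: "c \<in> LamD n r" using insert.prems by blast
      obtain y where y: "y \<in> FA r" "cls r y \<in> heckeD r" "v c = cls r (xrep n r c * y)" using MM_comp[OF v c] .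
      have iM: "inj_at n r c (v c) \<in> MM" using inj_at_MM[OF c y(1,2)] y(3) by simp
      have e1: "?p (insert c S) = vadd n r (?p S) (inj_at n r c (v c))"
      proof (rule MM_ext[OF pM vadd_MM[OF pM iM]])
        fix a assume a: "a \<in> LamD n r"
        show "?p (insert c S) a = vadd n r (?p S) (inj_at n r c (v c)) a"
          using a c insert.hyps(2) MM_in_carrier[OF v] by (auto simp: vadd_apply inj_at_apply hecke_zero[symmetric])
      qed
      have e2: "f (inj_at n r c (v c)) = g (inj_at n r c (v c))" using e[OF c y(1,2)] y(3) by simp
      have e3: "f (?p S) = g (?p S)" using insert by blast
      show ?case unfolding e1 SD_D(2)[OF f pM iM] SD_D(2)[OF g pM iM] e2 e3 ..
    qed
    have "?p (LamD n r) = v" by (rule MM_ext[OF pM v]) simp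
    thus ?thesis using fin[OF finite_LamD subset_refl] by simp
  next
    case False
    thus ?thesis using SD_D(4)[OF f] SD_D(4)[OF g] by simp
  qed
qed

text \<open>Any \<open>K\<close> that sends the generator to the double coset sum represents \<open>\<phi>\<close>.\<close>

lemma phi_d_Op:
  assumes m: "maps_gen a b K" and D: "dcoset (WparD n r a) d (WparD n r b) \<subseteq> WB r"
    "heq r (K * xrep n r b) (TS r (dcoset (WparD n r a) d (WparD n r b)))"
  shows "phi_d n r a b d = Op a b K"
proof -
  let ?D = "dcoset (WparD n r a) d (WparD n r b)"
  let ?P = "\<lambda>f. f \<in> carrier (SD n r) \<and> (\<forall>c\<in>LamD n r. \<forall>h\<in>heckeD r.
        f (inj_at n r c (xD n r c \<otimes>\<^bsub>hecke r\<^esub> h)) =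
        inj_at n r a (if c = b then Tsum r ?D \<otimes>\<^bsub>hecke r\<^esub> h else \<zero>\<^bsub>hecke r\<^esub>))"
  have ab: "a \<in> LamD n r" "b \<in> LamD n r" "K \<in> FA r" using m by (auto simp: maps_gen_def)
  have val: "Op a b K (inj_at n r c (xD n r c \<otimes>\<^bsub>hecke r\<^esub> h)) =
      inj_at n r a (if c = b then Tsum r ?D \<otimes>\<^bsub>hecke r\<^esub> h else \<zero>\<^bsub>hecke r\<^esub>)"
    if c: "c \<in> LamD n r" and h: "h \<in> heckeD r" for c h
  proof -
    obtain y where y: "y \<in> FA r" "h = cls r y" using heckeD_FA[OF r h] by blast
    have xy: "xD n r c \<otimes>\<^bsub>hecke r\<^esub> h = cls r (xrep n r c * y)"
      using xD_xrep[OF c] hecke_mult[OF r xrep_FA[OF c] y(1)] y(2) by simp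
    have iM: "inj_at n r c (cls r (xrep n r c * y)) \<in> MM" using inj_at_MM[OF c y(1)] h y(2) by simp
    show ?thesis
    proof (cases "c = b")
      case True
      have "cls r (K * xrep n r b * y) = cls r (TS r ?D * y)"
        using heq_mult_right[OF r y(1) D(2)] cls_eq_iff[OF r] heq_FA by blast
      also have "\<dots> = Tsum r ?D \<otimes>\<^bsub>hecke r\<^esub> h"
        using Tsum_TS[OF r D(1)] hecke_mult[OF r TS_FA[OF r D(1)] y(1)] y(2) by simp
      finally show ?thesis unfolding xy using Op_apply[OF ab(2,3) iM y(1)] True ab(2) by (simp add: inj_at_apply)
    next
      case False
      have "inj_at n r c (cls r (xrep n r c * y)) b = cls r (xrep n r b * 0)" using False ab(2) by (simp add: inj_at_apply)
      from Op_apply[OF ab(2,3) iM FA_zero this] show ?thesis unfolding xy using False by (simp add: hecke_zero)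
    qed
  qed
  have "?P (Op a b K)" using val Op_SD[OF m] by blast
  moreover have "f = Op a b K" if P: "?P f" for f
  proof (rule SD_eqI)
    fix c y assume cy: "c \<in> LamD n r" "y \<in> FA r" "cls r y \<in> heckeD r"
    have xy: "xD n r c \<otimes>\<^bsub>hecke r\<^esub> cls r y = cls r (xrep n r c * y)"
      using xD_xrep[OF cy(1)] hecke_mult[OF r xrep_FA[OF cy(1)] cy(2)] by simp
    show "f (inj_at n r c (cls r (xrep n r c * y))) = Op a b K (inj_at n r c (cls r (xrep n r c * y)))"
      using val[OF cy(1,3)] P cy unfolding xy[symmetric] by metis
  qed (use P ab Op_SD[OF m] in blast)+
  ultimately show ?thesis unfolding phi_d_def by (rule the_equality)
qed

section \<open>Sums and products of left multiplications\<close>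

lemma Op_comp:
  assumes K: "maps_gen a b K" and K': "maps_gen b c K'"
  shows "Op a b K \<otimes>\<^bsub>SD n r\<^esub> Op b c K' = Op a c (K * K')"
  unfolding SD_simps(2)
proof
  fix v
  have abc: "b \<in> LamD n r" "c \<in> LamD n r" "K \<in> FA r" "K' \<in> FA r" using K K' by (auto simp: maps_gen_def)
  show "compose MM (Op a b K) (Op b c K') v = Op a c (K * K') v"
  proof (cases "v \<in> MM")
    case True
    have "Op a b K (Op b c K' v) = inj_at n r a (cls r K \<otimes>\<^bsub>H\<^esub> Op b c K' v b)"
      using Op_MM[OF K' True] by (simp add: Op_def)
    also have "Op b c K' v b = cls r K' \<otimes>\<^bsub>H\<^esub> v c" using True abc by (simp add: Op_def inj_at_apply)
    also have "cls r K \<otimes>\<^bsub>H\<^esub> (cls r K' \<otimes>\<^bsub>H\<^esub> v c) = cls r (K * K') \<otimes>\<^bsub>H\<^esub> v c"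
      using H.m_assoc[of "cls r K" "cls r K'" "v c"] hecke_mult[OF r abc(3,4)] abc MM_in_carrier[OF True abc(2)]
      by (simp add: hecke_carrier)
    also have "inj_at n r a \<dots> = Op a c (K * K') v" using True by (simp add: Op_def)
    finally show ?thesis using True by (simp add: compose_def)
  qed (simp add: compose_def Op_def)
qed

lemma maps_gen_add:
  assumes "maps_gen a b K" "maps_gen a b L" shows "maps_gen a b (K + L)"
proof -
  obtain K' where K: "a \<in> LamD n r" "b \<in> LamD n r" "K \<in> FA r" "K' \<in> FA r" "cls r K' \<in> heckeD r"
    "heq r (K * xrep n r b) (xrep n r a * K')" using assms(1) unfolding maps_gen_def by blast
  obtain L' where L: "L \<in> FA r" "L' \<in> FA r" "cls r L' \<in> heckeD r"
    "heq r (L * xrep n r b) (xrep n r a * L')" using assms(2) unfolding maps_gen_def by blast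
  have "heq r ((K + L) * xrep n r b) (xrep n r a * (K' + L'))"
    unfolding distrib_left distrib_right by (rule heq_add[OF r K(6) L(4)])
  moreover have "cls r (K' + L') \<in> heckeD r" using heckeD_add[OF K(5) L(3)] hecke_add[OF r K(4) L(2)] by simp
  ultimately show ?thesis unfolding maps_gen_def using K L FA_add by blast
qed

lemma maps_gen_zero: "a \<in> LamD n r \<Longrightarrow> b \<in> LamD n r \<Longrightarrow> maps_gen a b 0"
  unfolding maps_gen_def using FA_zero heckeD_zero heq_refl[OF r FA_zero] by (auto intro!: bexI[of _ 0])

lemma maps_gen_scal:
  assumes "maps_gen a b K" shows "maps_gen a b (scal c * K)"
proof -
  obtain K' where K: "a \<in> LamD n r" "b \<in> LamD n r" "K \<in> FA r" "K' \<in> FA r" "cls r K' \<in> heckeD r"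
    "heq r (K * xrep n r b) (xrep n r a * K')" using assms(1) unfolding maps_gen_def by blast
  have "heq r (scal c * K * xrep n r b) (xrep n r a * (scal c * K'))"
  proof -
    have "xrep n r a * (scal c * K') = scal c * (xrep n r a * K')" by (metis mult.assoc scal_central)
    thus ?thesis using heq_mult_left[OF r FA_scal[of c] K(6)] by (simp only: mult.assoc)
  qed
  moreover have "cls r (scal c * K') \<in> heckeD r"
    using heckeD_mult[OF heckeD_scal K(5)] hecke_mult[OF r FA_scal K(4)] by simp
  ultimately show ?thesis unfolding maps_gen_def using K FA_mult[OF FA_scal] by blast
qed

lemma Op_add:
  assumes "maps_gen a b K" "maps_gen a b L"
  shows "Op a b K \<oplus>\<^bsub>SD n r\<^esub> Op a b L = Op a b (K + L)"
  unfolding SD_simps(3)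
proof
  fix v
  have ab: "a \<in> LamD n r" "b \<in> LamD n r" "K \<in> FA r" "L \<in> FA r" using assms by (auto simp: maps_gen_def)
  have KL: "cls r K \<in> carrier H" "cls r L \<in> carrier H" using ab by (simp_all add: hecke_carrier)
  show "(\<lambda>v\<in>MM. vadd n r (Op a b K v) (Op a b L v)) v = Op a b (K + L) v"
  proof (cases "v \<in> MM")
    case v: True
    have "vadd n r (Op a b K v) (Op a b L v) = Op a b (K + L) v"
    proof (rule MM_ext)
      fix c assume c: "c \<in> LamD n r"
      show "vadd n r (Op a b K v) (Op a b L v) c = Op a b (K + L) v c"
        using c v ab KL MM_in_carrier[OF v ab(2)] hecke_add[OF r ab(3,4), symmetric]
        by (simp add: Op_def vadd_apply inj_at_apply H.l_distr hecke_zero[symmetric])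
    qed (use Op_MM assms maps_gen_add vadd_MM v in auto)
    thus ?thesis using v by simp
  qed (simp add: Op_def)
qed

lemma Op_zero:
  assumes "a \<in> LamD n r" "b \<in> LamD n r" shows "\<zero>\<^bsub>SD n r\<^esub> = Op a b 0"
  unfolding SD_simps(4)
proof
  fix v show "(\<lambda>v\<in>MM. vzero) v = Op a b 0 v"
  proof (cases "v \<in> MM")
    case True
    have "cls r 0 \<otimes>\<^bsub>H\<^esub> v b = cls r 0"
      using H.l_null[OF MM_in_carrier[OF True assms(2)]] by (simp add: hecke_zero)
    hence "vzero = inj_at n r a (cls r 0 \<otimes>\<^bsub>H\<^esub> v b)"
      unfolding vzero_def inj_at_def hecke_zero by (intro restrict_ext) simp
    thus ?thesis using True by (simp add: Op_def)
  qed (simp add: Op_def)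
qed

lemma Op_smult:
  assumes "maps_gen a b K" shows "c \<odot>\<^bsub>SD n r\<^esub> Op a b K = Op a b (scal c * K)"
  unfolding SD_simps(5)
proof
  fix v
  have ab: "a \<in> LamD n r" "b \<in> LamD n r" "K \<in> FA r" using assms by (auto simp: maps_gen_def)
  show "(\<lambda>v\<in>MM. \<lambda>a'\<in>LamD n r. c \<odot>\<^bsub>H\<^esub> Op a b K v a') v = Op a b (scal c * K) v"
  proof (cases "v \<in> MM")
    case v: True
    obtain z where z: "z \<in> FA r" "v b = cls r z" using MM_carrier[OF v ab(2)] .
    have "(if d \<in> LamD n r then c \<odot>\<^bsub>H\<^esub> Op a b K v d else undefined) = Op a b (scal c * K) v d" for d
      using v z ab hecke_mult[OF r _ z(1)] hecke_smult[OF r] FA_mult[OF FA_scal[of c r] ab(3)] FA_mult[OF ab(3) z(1)]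
      by (simp add: Op_def inj_at_def hecke_zero FA_zero mult.assoc)
    thus ?thesis using v by (simp add: restrict_def fun_eq_iff)
  qed (simp add: Op_def)
qed

lemma abelian_monoid_SD: "abelian_monoid (SD n r)"
proof (rule abelian_monoidI)
  fix f g assume fg: "f \<in> carrier (SD n r)" "g \<in> carrier (SD n r)"
  note F = SD_D[OF fg(1)] and G = SD_D[OF fg(2)]
  show "f \<oplus>\<^bsub>SD n r\<^esub> g \<in> carrier (SD n r)"
    unfolding SD_simps(1,3)
  proof (intro conjI ballI)
    show "(\<lambda>v\<in>MM. vadd n r (f v) (g v)) \<in> MM \<rightarrow>\<^sub>E MM" using F(1) G(1) vadd_MM by auto
  next
    fix u v assume "u \<in> MM" "v \<in> MM"
    thus "(\<lambda>v\<in>MM. vadd n r (f v) (g v)) (vadd n r u v)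
      = vadd n r ((\<lambda>v\<in>MM. vadd n r (f v) (g v)) u) ((\<lambda>v\<in>MM. vadd n r (f v) (g v)) v)"
      using F G by (simp add: vadd_MM vadd_swap)
  next
    fix v h assume "v \<in> MM" "h \<in> heckeD r"
    thus "(\<lambda>v\<in>MM. vadd n r (f v) (g v)) (vact n r v h) = vact n r ((\<lambda>v\<in>MM. vadd n r (f v) (g v)) v) h"
      using F G by (simp add: vact_MM vact_vadd)
  qed
  show "f \<oplus>\<^bsub>SD n r\<^esub> g = g \<oplus>\<^bsub>SD n r\<^esub> f"
    unfolding SD_simps(3) using F(1) G(1) vadd_comm by (auto intro!: restrict_ext)
  show "\<zero>\<^bsub>SD n r\<^esub> \<oplus>\<^bsub>SD n r\<^esub> f = f"
    unfolding SD_simps(3,4)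
  proof
    fix v show "(\<lambda>v\<in>MM. vadd n r ((\<lambda>v\<in>MM. vzero) v) (f v)) v = f v"
      using F(1,4) vadd_zero by (cases "v \<in> MM") simp_all
  qed
  fix k assume k: "k \<in> carrier (SD n r)"
  show "f \<oplus>\<^bsub>SD n r\<^esub> g \<oplus>\<^bsub>SD n r\<^esub> k = f \<oplus>\<^bsub>SD n r\<^esub> (g \<oplus>\<^bsub>SD n r\<^esub> k)"
    unfolding SD_simps(3) using F(1) G(1) SD_D(1)[OF k] vadd_assoc by (auto intro!: restrict_ext)
next
  show "\<zero>\<^bsub>SD n r\<^esub> \<in> carrier (SD n r)"
    unfolding SD_simps(1,4)
  proof (intro conjI ballI)
    fix v h assume v: "v \<in> MM" and h: "h \<in> heckeD r"
    have "vact n r vzero h = vzero"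
      unfolding vact_def vzero_def using heckeD_carrier[OF h] by (intro restrict_ext) (simp add: hecke_zero[symmetric])
    thus "(\<lambda>v\<in>MM. vzero) (vact n r v h) = vact n r ((\<lambda>v\<in>MM. vzero) v) h" using v h by (simp add: vact_MM)
  qed (auto simp: vzero_MM vadd_MM vadd_zero)
qed

lemma Op_finsum:
  assumes "finite I" "a \<in> LamD n r" "b \<in> LamD n r" "\<And>p. p \<in> I \<Longrightarrow> maps_gen a b (K p)"
  shows "(\<Oplus>\<^bsub>SD n r\<^esub>p\<in>I. Op a b (K p)) = Op a b (\<Sum>p\<in>I. K p) \<and> maps_gen a b (\<Sum>p\<in>I. K p)"
proof -
  interpret abelian_monoid "SD n r" by (rule abelian_monoid_SD)
  show ?thesis using assms(1,4)
  proof (induction I)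
    case empty
    show ?case using Op_zero[OF assms(2,3)] maps_gen_zero[OF assms(2,3)] by simp
  next
    case (insert p I)
    thus ?case using Op_SD Op_add maps_gen_add by simp
  qed
qed

end

section \<open>The double coset sums of type D\<close>

definition Tsign :: "nat \<Rightarrow> pm \<Rightarrow> falg" where
  "Tsign r e = (case e of Plus \<Rightarrow> 1 | Minus \<Rightarrow> gen r)"

context qschur
begin

lemma Tsign_FA: "Tsign r e \<in> FA r"
  using FA_one FA_gen[of r r] r by (cases e) (simp_all add: Tsign_def)

lemma Tsign_square: "heq r (Tsign r e * Tsign r e) 1"
  using heq_refl[OF r FA_one] heq_r[OF r] by (cases e) (simp_all add: Tsign_def)

lemma Tsign_right: "w \<in> WB r \<Longrightarrow> heq r (tw r w * Tsign r e) (tw r (w \<circ> s_sign r e))"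
  using heq_refl[OF r tw_FA[OF r]] tw_r_right[OF r] by (cases e) (simp_all add: Tsign_def s_sign_def)

lemma Tsign_left: "w \<in> WB r \<Longrightarrow> heq r (Tsign r e * tw r w) (tw r (s_sign r e \<circ> w))"
  using heq_refl[OF r tw_FA[OF r]] tw_r_left[OF r] by (cases e) (simp_all add: Tsign_def s_sign_def)

lemma Tsign_cancel_mid:
  assumes "a \<in> FA r" "b \<in> FA r" shows "heq r (a * Tsign r e * (Tsign r e * b)) (a * b)"
  using heq_mult_left[OF r assms(1) heq_mult_right[OF r assms(2) Tsign_square[of e]]] by (simp add: mult.assoc)

lemma TS_conj:
  assumes X: "X \<subseteq> WB r"
  shows "heq r (TS r ((\<lambda>w. s_sign r e \<circ> w \<circ> s_sign r e') ` X)) (Tsign r e * TS r X * Tsign r e')"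
proof -
  let ?Y = "(\<lambda>w. s_sign r e \<circ> w) ` X"
  have Y: "?Y \<subseteq> WB r" using WB_comp[OF s_sign_WB[OF r1]] X by blast
  have "heq r (Tsign r e * TS r X) (TS r ?Y)"
    by (rule TS_translate_left[OF r Tsign_FA s_sign_WB[OF r1]]) (use Tsign_left X in blast)
  note 1 = heq_mult_right[OF r Tsign_FA this]
  have 2: "heq r (TS r ?Y * Tsign r e') (TS r ((\<lambda>w. w \<circ> s_sign r e') ` ?Y))"
    by (rule TS_translate_right[OF r Tsign_FA s_sign_WB[OF r1]]) (use Tsign_right Y in blast)
  show ?thesis using heq_sym[OF r heq_trans[OF r 1 2]] by (simp only: image_image)
qed

text \<open>Every coset has a representative \<open>u\<close> with \<open>T\<^sub>u T\<^sub>y = T\<^sub>u\<^sub>y\<close> for all \<open>y\<close> in the subgroup. For the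
  stabiliser this is the element increasing on blocks. The signs and the restriction to even elements
  only bring in factors \<open>T\<^sub>r\<close>, which multiply without a condition.\<close>

lemma right_rep:
  assumes m: "m \<in> Lam (n+1) r" and x: "x \<in> WB r"
  shows "\<exists>v\<in>WparD n r (sbracket n m e). \<forall>y\<in>WparD n r (sbracket n m e).
    heq r (tw r (x \<circ> v) * tw r y) (tw r (x \<circ> v \<circ> y))"
proof -
  let ?s = "s_sign r e" and ?S = "stab r (lab n m)"
  define x' where "x' = x \<circ> ?s"
  have M: "labelling r (2*n+2) (lab n m)" by (rule lab_labelling[OF m])
  have sw: "?s \<in> WB r" by (rule s_sign_WB[OF r1])
  have x': "x' \<in> WB r" unfolding x'_def by (rule WB_comp[OF x sw])
  obtain v0 where v0: "v0 \<in> ?S" "incr r (lab n m) (x' \<circ> v0)" using exists_incr_right[OF M x'] by blast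
  have v0w: "v0 \<in> WB r" using v0 stab_WB by blast
  have u: "x' \<circ> v0 \<in> WB r" by (rule WB_comp[OF x' v0w])
  have good0: "heq r (tw r (x' \<circ> v0) * tw r v) (tw r (x' \<circ> v0 \<circ> v))" if "v \<in> ?S" for v
    by (rule tw_stab_right[OF r M u v0(2) that])
  \<comment> \<open>An odd representative is corrected by \<open>s\<^sub>r\<close>, which then lies in the parabolic subgroup.\<close>
  have "\<exists>v1\<in>?S. even (neg r v1) \<and> (\<forall>v\<in>?S. heq r (tw r (x' \<circ> v1) * tw r v) (tw r (x' \<circ> v1 \<circ> v)))"
  proof (cases "even (neg r v0)")
    case True thus ?thesis using v0(1) good0 by blast
  next
    case False
    have "m (n+1) \<noteq> 0"
    proof
      assume "m (n+1) = 0"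
      hence "v0 \<in> WD r" using stab_WD[OF m r1] v0(1) by blast
      thus False using False by (simp add: WD_iff)
    qed
    hence sr: "sB r r \<in> ?S" using s_sign_stab[OF m r1, of Minus] by (simp add: s_sign_def)
    have srw: "sB r r \<in> WB r" using sr stab_WB by blast
    have "heq r (tw r (x' \<circ> (v0 \<circ> sB r r)) * tw r v) (tw r (x' \<circ> (v0 \<circ> sB r r) \<circ> v))" if v: "v \<in> ?S" for v
    proof -
      have vw: "v \<in> WB r" using v stab_WB by blast
      have 1: "heq r (tw r (x' \<circ> v0 \<circ> sB r r) * tw r v) (tw r (x' \<circ> v0) * gen r * tw r v)"
        by (rule heq_mult_right[OF r tw_FA[OF r vw] heq_sym[OF r tw_r_right[OF r u]]])
      have 2: "heq r (tw r (x' \<circ> v0) * gen r * tw r v) (tw r (x' \<circ> v0) * tw r (sB r r \<circ> v))"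
        using heq_mult_left[OF r tw_FA[OF r u] tw_r_left[OF r vw]] by (simp only: mult.assoc)
      have 3: "heq r (tw r (x' \<circ> v0) * tw r (sB r r \<circ> v)) (tw r (x' \<circ> v0 \<circ> (sB r r \<circ> v)))"
        by (rule good0[OF stab_comp[OF sr v]])
      show ?thesis using heq_trans[OF r 1 heq_trans[OF r 2 3]] by (simp only: comp_assoc)
    qed
    moreover have "even (neg r (v0 \<circ> sB r r))" using neg_parity[OF v0w srw r1] neg_sB[of r r] r1 False by simp
    ultimately show ?thesis using stab_comp[OF v0(1) sr] by blast
  qed
  then obtain v1 where v1: "v1 \<in> ?S" "even (neg r v1)"
    and good: "\<And>v. v \<in> ?S \<Longrightarrow> heq r (tw r (x' \<circ> v1) * tw r v) (tw r (x' \<circ> v1 \<circ> v))" by blast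
  define z where "z = x' \<circ> v1"
  have zw: "z \<in> WB r" unfolding z_def using WB_comp[OF x'] v1(1) stab_WB by blast
  have Y: "WparD n r (sbracket n m e) = (\<lambda>v. ?s \<circ> v \<circ> ?s) ` {v \<in> ?S. even (neg r v)}" by (rule WparD_conj[OF m r1])
  have xz: "x \<circ> (?s \<circ> v1 \<circ> ?s) = z \<circ> ?s" by (simp only: z_def x'_def comp_assoc)
  have "heq r (tw r (z \<circ> ?s) * tw r (?s \<circ> v \<circ> ?s)) (tw r ((z \<circ> ?s) \<circ> (?s \<circ> v \<circ> ?s)))" if v: "v \<in> ?S" for v
  proof -
    have vw: "v \<in> WB r" using v stab_WB by blast
    have vs: "v \<circ> ?s \<in> WB r" by (rule WB_comp[OF vw sw])
    have 1: "heq r (tw r (z \<circ> ?s) * tw r (?s \<circ> v \<circ> ?s)) (tw r z * Tsign r e * (Tsign r e * (tw r v * Tsign r e)))"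
    proof (rule heq_mult[OF r heq_sym[OF r Tsign_right[OF zw]]])
      have "heq r (Tsign r e * (tw r v * Tsign r e)) (tw r (?s \<circ> (v \<circ> ?s)))"
        by (rule heq_trans[OF r heq_mult_left[OF r Tsign_FA Tsign_right[OF vw]] Tsign_left[OF vs]])
      thus "heq r (tw r (?s \<circ> v \<circ> ?s)) (Tsign r e * (tw r v * Tsign r e))" unfolding comp_assoc by (rule heq_sym[OF r])
    qed
    have 2: "heq r (tw r z * Tsign r e * (Tsign r e * (tw r v * Tsign r e))) (tw r z * (tw r v * Tsign r e))"
      by (rule Tsign_cancel_mid[OF tw_FA[OF r zw] FA_mult[OF tw_FA[OF r vw] Tsign_FA]])
    have 3: "heq r (tw r z * (tw r v * Tsign r e)) (tw r (z \<circ> v) * Tsign r e)"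
      using heq_mult_right[OF r Tsign_FA good[OF v, folded z_def]] by (simp only: mult.assoc)
    have 4: "heq r (tw r (z \<circ> v) * Tsign r e) (tw r (z \<circ> v \<circ> ?s))" by (rule Tsign_right[OF WB_comp[OF zw vw]])
    have "z \<circ> v \<circ> ?s = (z \<circ> ?s) \<circ> (?s \<circ> v \<circ> ?s)" using s_sign_cancel(1)[OF r1, of e] by (simp only: comp_assoc)
    thus ?thesis using heq_trans[OF r 1 heq_trans[OF r 2 heq_trans[OF r 3 4]]] by simp
  qed
  thus ?thesis unfolding Y using v1 xz by (intro bexI[of _ "?s \<circ> v1 \<circ> ?s"]) auto
qed

lemma left_rep:
  assumes l: "l \<in> Lam (n+1) r" "l (n+1) = 0" and x: "x \<in> WB r"
  shows "\<exists>v\<in>WparD n r (Signed l e). \<forall>y\<in>WparD n r (Signed l e).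
    heq r (tw r y * tw r (v \<circ> x)) (tw r (y \<circ> (v \<circ> x)))"
proof -
  let ?s = "s_sign r e" and ?S = "stab r (lab n l)"
  define x' where "x' = ?s \<circ> x"
  have L: "labelling r (2*n+2) (lab n l)" by (rule lab_labelling[OF l(1)])
  have sw: "?s \<in> WB r" by (rule s_sign_WB[OF r1])
  have x': "x' \<in> WB r" unfolding x'_def by (rule WB_comp[OF sw x])
  obtain v1 where v1: "v1 \<in> ?S" "incr r (lab n l) (inv' (v1 \<circ> x'))" using exists_incr_left[OF L x'] by blast
  define z where "z = v1 \<circ> x'"
  have zw: "z \<in> WB r" unfolding z_def using WB_comp[OF _ x'] v1(1) stab_WB by blast
  have good: "heq r (tw r v * tw r z) (tw r (v \<circ> z))" if "v \<in> ?S" for v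
    by (rule tw_stab_left[OF r L zw v1(2)[folded z_def] that])
  have ev: "even (neg r v)" if "v \<in> ?S" for v using stab_WD[OF l(1) r1 l(2)] that by (auto simp: WD_iff)
  have Y: "WparD n r (Signed l e) = (\<lambda>v. ?s \<circ> v \<circ> ?s) ` {v \<in> ?S. even (neg r v)}"
    using WparD_conj[OF l(1) r1, of e] l(2) by (simp add: sbracket_def)
  have xz: "(?s \<circ> v1 \<circ> ?s) \<circ> x = ?s \<circ> z" by (simp only: z_def x'_def comp_assoc)
  have "heq r (tw r (?s \<circ> v \<circ> ?s) * tw r (?s \<circ> z)) (tw r ((?s \<circ> v \<circ> ?s) \<circ> (?s \<circ> z)))" if v: "v \<in> ?S" for v
  proof -
    have vw: "v \<in> WB r" using v stab_WB by blast
    have sv: "?s \<circ> v \<in> WB r" by (rule WB_comp[OF sw vw])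
    have 1: "heq r (tw r (?s \<circ> v \<circ> ?s) * tw r (?s \<circ> z)) (Tsign r e * tw r v * Tsign r e * (Tsign r e * tw r z))"
    proof (rule heq_mult[OF r _ heq_sym[OF r Tsign_left[OF zw]]])
      show "heq r (tw r (?s \<circ> v \<circ> ?s)) (Tsign r e * tw r v * Tsign r e)"
        by (rule heq_sym[OF r heq_trans[OF r heq_mult_right[OF r Tsign_FA Tsign_left[OF vw]] Tsign_right[OF sv]]])
    qed
    have 2: "heq r (Tsign r e * tw r v * Tsign r e * (Tsign r e * tw r z)) (Tsign r e * tw r v * tw r z)"
      by (rule Tsign_cancel_mid[OF FA_mult[OF Tsign_FA tw_FA[OF r vw]] tw_FA[OF r zw]])
    have 3: "heq r (Tsign r e * tw r v * tw r z) (Tsign r e * tw r (v \<circ> z))"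
      using heq_mult_left[OF r Tsign_FA good[OF v]] by (simp only: mult.assoc)
    have 4: "heq r (Tsign r e * tw r (v \<circ> z)) (tw r (?s \<circ> (v \<circ> z)))" by (rule Tsign_left[OF WB_comp[OF vw zw]])
    have "?s \<circ> (v \<circ> z) = (?s \<circ> v \<circ> ?s) \<circ> (?s \<circ> z)" using s_sign_cancel(1)[OF r1, of e] by (simp only: comp_assoc)
    thus ?thesis using heq_trans[OF r 1 heq_trans[OF r 2 heq_trans[OF r 3 4]]] by simp
  qed
  thus ?thesis unfolding Y using v1 ev xz by (intro bexI[of _ "?s \<circ> v1 \<circ> ?s"]) auto
qed

lemma WparD_grp:
  fixes e :: pm
  assumes m: "m \<in> Lam (n+1) r"
  defines "Y \<equiv> WparD n r (sbracket n m e)"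
  shows "Y \<subseteq> WB r \<and> id \<in> Y \<and> (\<forall>x\<in>Y. \<forall>y\<in>Y. x \<circ> y \<in> Y) \<and> (\<forall>x\<in>Y. inv' x \<in> Y)" "Y \<subseteq> WD r"
proof -
  let ?s = "s_sign r e" and ?E = "{v \<in> stab r (lab n m). even (neg r v)}"
  have Y: "Y = (\<lambda>v. ?s \<circ> v \<circ> ?s) ` ?E" unfolding Y_def by (rule WparD_conj[OF m r1])
  have ED: "v \<in> WB r" if "v \<in> ?E" for v using that stab_WB by blast
  have sub: "?s \<circ> v \<circ> ?s \<in> WD r" if "v \<in> ?E" for v
    using s_sign_conj_parity[OF r1 ED[OF that], of e e] that by (simp add: WD_iff)
  show YD: "Y \<subseteq> WD r" unfolding Y using sub by blast
  have "id \<in> Y" unfolding Y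
  proof (rule image_eqI[of _ _ id])
    show "id = ?s \<circ> id \<circ> ?s" using s_sign_invol[OF r1, of e] by simp
    show "id \<in> ?E" using stab_id by simp
  qed
  moreover have "x \<circ> y \<in> Y" if xy: "x \<in> Y" "y \<in> Y" for x y
  proof -
    obtain u v where uv: "u \<in> ?E" "x = ?s \<circ> u \<circ> ?s" "v \<in> ?E" "y = ?s \<circ> v \<circ> ?s" using xy unfolding Y by blast
    have "x \<circ> y = ?s \<circ> (u \<circ> v) \<circ> ?s" unfolding uv using s_sign_cancel(1)[OF r1, of e] by (simp only: comp_assoc)
    moreover have "u \<circ> v \<in> ?E" using stab_comp neg_parity[OF ED[OF uv(1)] ED[OF uv(3)] r1] uv by blast
    ultimately show ?thesis unfolding Y by blast
  qed
  moreover have "inv' x \<in> Y" if x: "x \<in> Y" for x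
  proof -
    obtain u where u: "u \<in> ?E" "x = ?s \<circ> u \<circ> ?s" using x unfolding Y by blast
    have sw: "?s \<in> WB r" by (rule s_sign_WB[OF r1])
    have "inv' x = ?s \<circ> inv' u \<circ> ?s"
      unfolding u(2) using WB_inv_comp[OF WB_comp[OF sw ED[OF u(1)]] sw] WB_inv_comp[OF sw ED[OF u(1)]] s_sign_inv[OF r1, of e]
      by (simp only: comp_assoc)
    moreover have "inv' u \<in> ?E" using stab_inv neg_inv[OF ED[OF u(1)]] u(1) by simp
    ultimately show ?thesis unfolding Y by blast
  qed
  ultimately show "Y \<subseteq> WB r \<and> id \<in> Y \<and> (\<forall>x\<in>Y. \<forall>y\<in>Y. x \<circ> y \<in> Y) \<and> (\<forall>x\<in>Y. inv' x \<in> Y)"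
    using YD WD_iff by blast
qed

text \<open>The double coset sum is a left multiple of the generator on the right, and a right multiple, by an
  element of the subalgebra of type D, of the generator on the left. The first gives the operator, the
  second shows that it maps into the right ideal.\<close>

lemma phi_Op:
  assumes l: "l \<in> Lam (n+1) r" "l (n+1) = 0" and m: "m \<in> Lam (n+1) r"
    and w: "w \<in> cosetB n r l m A" and sg: "sgn_mat n A = Plus \<longleftrightarrow> e = e'"
  shows "\<exists>K\<in>FA r. heq r (K * xrep n r (sbracket n m e')) (TS r (cosetD n r l m e A e'))"
    and "\<And>K. K \<in> FA r \<Longrightarrow> heq r (K * xrep n r (sbracket n m e')) (TS r (cosetD n r l m e A e')) \<Longrightarrow>
      phi n r e A e' = Op (Signed l e) (sbracket n m e') K \<and> maps_gen (Signed l e) (sbracket n m e') K"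
proof -
  let ?a = "Signed l e" and ?b = "sbracket n m e'" and ?D = "cosetD n r l m e A e'"
  have sa: "sbracket n l e = ?a" using l(2) by (simp add: sbracket_def)
  obtain d where d: "phi n r e A e' = phi_d n r ?a ?b d" "dcoset (WparD n r ?a) d (WparD n r ?b) = ?D"
    by (rule phi_eq[OF r l(1) m l(2) w sg])
  have DD: "?D \<subseteq> WD r" by (rule cosetD_WD[OF r1])
  hence DB: "?D \<subseteq> WB r" using WD_iff by blast
  note ga = WparD_grp[OF l(1), of e, unfolded sa] and gb = WparD_grp[OF m, of e']
  have cr: "x \<circ> y \<in> ?D" if x: "x \<in> ?D" and y: "y \<in> WparD n r ?b" for x y
  proof -
    obtain u v where uv: "u \<in> WparD n r ?a" "v \<in> WparD n r ?b" "x = u \<circ> d \<circ> v" using x unfolding d(2)[symmetric] dcoset_def by blast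
    have "x \<circ> y = u \<circ> d \<circ> (v \<circ> y)" unfolding uv(3) by (simp only: comp_assoc)
    moreover have "v \<circ> y \<in> WparD n r ?b" using gb(1) uv(2) y by blast
    ultimately show ?thesis unfolding d(2)[symmetric] using dcosetI[OF uv(1)] by simp
  qed
  have cl: "y \<circ> x \<in> ?D" if x: "x \<in> ?D" and y: "y \<in> WparD n r ?a" for x y
  proof -
    obtain u v where uv: "u \<in> WparD n r ?a" "v \<in> WparD n r ?b" "x = u \<circ> d \<circ> v" using x unfolding d(2)[symmetric] dcoset_def by blast
    have "y \<circ> x = (y \<circ> u) \<circ> d \<circ> v" unfolding uv(3) by (simp only: comp_assoc)
    moreover have "y \<circ> u \<in> WparD n r ?a" using ga(1) uv(1) y by blast
    ultimately show ?thesis unfolding d(2)[symmetric] using dcosetI[OF _ uv(2)] by simp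
  qed
  show "\<exists>K\<in>FA r. heq r (K * xrep n r ?b) (TS r ?D)"
    unfolding xrep_def by (rule right_factor[OF r gb(1) right_rep[OF m] DB cr])
  obtain K' where K': "K' \<in> FA r" "cls r K' \<in> heckeD r" "heq r (xrep n r ?a * K') (TS r ?D)"
    using left_factor[OF r ga(1) ga(2) left_rep[OF l] DB cl] DD unfolding xrep_def by blast
  show "phi n r e A e' = Op ?a ?b K \<and> maps_gen ?a ?b K"
    if K: "K \<in> FA r" "heq r (K * xrep n r ?b) (TS r ?D)" for K
  proof -
    have ab: "?a \<in> LamD n r" "?b \<in> LamD n r" using LamD_sbracket[OF l(1), of e] LamD_sbracket[OF m, of e'] sa by simp_all
    have "heq r (K * xrep n r ?b) (xrep n r ?a * K')" by (rule heq_trans[OF r K(2) heq_sym[OF r K'(3)]])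
    hence mg: "maps_gen ?a ?b K" unfolding maps_gen_def using ab K(1) K'(1,2) by blast
    have "phi_d n r ?a ?b d = Op ?a ?b K" by (rule phi_d_Op[OF mg]) (use d(2) DB K(2) in simp_all)
    thus ?thesis using d(1) mg by simp
  qed
qed

text \<open>Signs become outer factors \<open>T\<^sub>r\<close>, since these multiply without a condition.\<close>

lemma TS_cosetD: "heq r (TS r (cosetD n r l m e A e')) (Tsign r e * TS r (par r (e = e') \<inter> cosetB n r l m A) * Tsign r e')"
proof -
  have "{w \<in> cosetB n r l m A. even (neg r w) \<longleftrightarrow> e = e'} = par r (e = e') \<inter> cosetB n r l m A"
    using cosetB_D(1) by (auto simp: par_def)
  thus ?thesis unfolding cosetD_def using TS_conj[of "par r (e = e') \<inter> cosetB n r l m A" e e'] by (simp add: par_def subset_iff)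
qed

lemma xrep_Signed:
  assumes l: "l \<in> Lam (n+1) r" "l (n+1) = 0"
  shows "heq r (xrep n r (Signed l e)) (Tsign r e * TS r (stab r (lab n l)) * Tsign r e)"
proof -
  have "{v \<in> stab r (lab n l). even (neg r v)} = stab r (lab n l)" using stab_WD[OF l(1) r1 l(2)] by (auto simp: WD_iff)
  hence "WparD n r (Signed l e) = (\<lambda>v. s_sign r e \<circ> v \<circ> s_sign r e) ` stab r (lab n l)"
    using WparD_conj[OF l(1) r1, of e] l(2) by (simp add: sbracket_def)
  thus ?thesis unfolding xrep_def using TS_conj[OF stab_WB] by simp
qed

lemma Tsign_conj_mult:
  assumes "a \<in> FA r" "b \<in> FA r"
  shows "heq r (Tsign r e * a * Tsign r e * (Tsign r e * b * Tsign r e')) (Tsign r e * (a * b) * Tsign r e')"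
  using heq_mult_right[OF r Tsign_FA[of e'] Tsign_cancel_mid[OF FA_mult[OF Tsign_FA[of e] assms(1)] assms(2), of e]]
  by (simp only: mult.assoc)

end

section \<open>The multiplication formula\<close>

context row_move
begin

text \<open>For equal outer signs the inner factors \<open>T\<^sub>r\<close> cancel, so that both formulas follow from the one
  identity in the Hecke algebra.\<close>

lemma phi_product:
  assumes nu: "nu \<in> Lam (n+1) r" and A: "A \<in> Xi n r" "ro n A = hat n mu" "co n A = hat n nu"
    and C: "C = (\<lambda>i j. E_theta n (h+1) h i j + diag_mat (hat n gam) i j)"
    and sg: "sgn_mat n A = Plus \<longleftrightarrow> e = e'"
  shows "phi n r e C e \<otimes>\<^bsub>SD n r\<^esub> phi n r e A e' = (\<Oplus>\<^bsub>SD n r\<^esub>p\<in>{1..2*n+1}. gterm n r h e A e' p)"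
proof -
  interpret qschur n r by unfold_locales (rule r)
  let ?a = "Signed lam e" and ?m = "Signed mu e" and ?b = "sbracket n nu e'"
  have sm: "sbracket n mu e = ?m" and sa: "sbracket n lam e = ?a" using mu(2) lam(2) by (simp_all add: sbracket_def)
  have bL: "?b \<in> LamD n r" and aL: "?a \<in> LamD n r"
    using LamD_sbracket[OF nu, of e'] LamD_sbracket[OF lam(1), of e] sa by simp_all
  obtain K where K: "K \<in> FA r" "\<And>t. t \<le> M \<Longrightarrow> heq r (K * TS r (to_x0 t)) (scal (qvar ^ t) * TS r W)"
    using exists_K by blast
  define Ke where "Ke = Tsign r e * K * Tsign r e"
  have KeF: "Ke \<in> FA r" unfolding Ke_def by (intro FA_mult Tsign_FA K(1))
  have symA: "A i j = A (2*n+2-i) (2*n+2-j)" if "i \<in> {1..2*n+1}" "j \<in> {1..2*n+1}" for i j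
    using A(1) that unfolding Xi_def by blast
  have out: "A i j = 0" if "i \<notin> {1..2*n+1} \<or> j \<notin> {1..2*n+1}" for i j
    using A(1) that unfolding Xi_def by blast
  have sym: "A (2*n+2-h) (2*n+2-p) = A h p" if "p \<in> {1..2*n+1}" for p using symA[of h p] that h by simp

  \<comment> \<open>The diagonal case, conjugated by the sign, shows that \<open>Ke\<close> represents \<open>\<phi>\<close> for \<open>C\<close>.\<close>
  have "id \<in> cosetB n r mu mu (diag_mat (hat n mu))" unfolding cosetB_diag by (rule stab_id)
  moreover have "h = lab n mu (inv' id x0)" using lab_mu[OF x0_in(2)[of 0]] by (simp add: inv_id)
  ultimately have idC: "id \<in> cosetB n r lam mu C"
    using cosetB_move_down(1)[OF mu(1)] shift_diag unfolding C by metis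
  have "(\<Sum>i\<in>{1..n}. \<Sum>j\<in>{n+2..2*n+1}. C i j) = 0"
    unfolding C using h by (intro sum.neutral ballI) (auto simp: E_theta_def E_unit_def diag_mat_def)
  hence sgC: "sgn_mat n C = Plus \<longleftrightarrow> e = e" by (simp add: sgn_mat_def)
  have WF: "TS r (stab r (lab n mu)) \<in> FA r" by (rule TS_FA[OF r stab_WB])
  have "heq r (Ke * xrep n r ?m) (Ke * (Tsign r e * TS r (stab r (lab n mu)) * Tsign r e))"
    by (rule heq_mult_left[OF r KeF xrep_Signed[OF mu]])
  moreover have "heq r (Ke * (Tsign r e * TS r (stab r (lab n mu)) * Tsign r e)) (Tsign r e * (K * TS r (stab r (lab n mu))) * Tsign r e)"
    unfolding Ke_def by (rule Tsign_conj_mult[OF K(1) WF])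
  moreover have "heq r (Tsign r e * (K * TS r (stab r (lab n mu))) * Tsign r e) (Tsign r e * TS r (par r True \<inter> cosetB n r lam mu C) * Tsign r e)"
    unfolding C by (intro heq_mult_right[OF r Tsign_FA] heq_mult_left[OF r Tsign_FA] diag_formula K)
  moreover have "heq r (Tsign r e * TS r (par r True \<inter> cosetB n r lam mu C) * Tsign r e) (TS r (cosetD n r lam mu e C e))"
    using heq_sym[OF r TS_cosetD[of lam mu e C e]] by simp
  ultimately have KeX: "heq r (Ke * xrep n r (sbracket n mu e)) (TS r (cosetD n r lam mu e C e))"
    unfolding sm using heq_trans[OF r] by blast
  have phiC: "phi n r e C e = Op ?a ?m Ke" "maps_gen ?a ?m Ke"
    using phi_Op(2)[OF lam mu(1) idC sgC KeF KeX] unfolding sm by auto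

  obtain w where w: "w \<in> cosetB n r mu nu A" by (rule cosetB_nonempty[OF A(1) mu(1) nu mu(2) A(2,3)])
  obtain KA where KA: "KA \<in> FA r" "heq r (KA * xrep n r ?b) (TS r (cosetD n r mu nu e A e'))"
    using phi_Op(1)[OF mu nu w sg] by blast
  have phiA: "phi n r e A e' = Op ?m ?b KA" "maps_gen ?m ?b KA" using phi_Op(2)[OF mu nu w sg KA] by auto

  \<comment> \<open>The shifted matrices belong to double cosets because some position in row
    \<open>h\<close> with column label \<open>p\<close> can be brought to the position that moves.\<close>
  let ?A = "shift_down n h A"
  have "\<exists>Kp\<in>FA r. heq r (Kp * xrep n r ?b) (TS r (cosetD n r lam nu e (?A p) e'))
      \<and> phi n r e (?A p) e' = Op ?a ?b Kp \<and> maps_gen ?a ?b Kp" if p: "p \<in> moves A" for p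
  proof -
    have pp: "p \<in> {1..2*n+1}" "A h p > 0" using p by (simp_all add: moves_def)
    obtain w' where w': "w' \<in> cosetB n r lam nu (?A p)"
    proof -
      have ww: "w \<in> WB r" "coset_mat n mu w nu = A" using cosetB_D[OF w] .
      have h1: "h \<in> {1..2*n+1}" using h by simp
      have "card {x\<in>{1..2*r}. lab n mu x = h \<and> lab n nu (inv' w x) = p} > 0"
        using coset_mat_card'[OF mu(1) nu ww(1) h1 pp(1)] ww(2) pp(2) by simp
      hence "{x\<in>{1..2*r}. lab n mu x = h \<and> lab n nu (inv' w x) = p} \<noteq> {}"
        by (rule card_gt_0_iff[THEN iffD1, THEN conjunct1])
      then obtain x where x: "x \<in> {1..2*r}" "lab n mu x = h" "lab n nu (inv' w x) = p" by blast
      have xr: "x \<in> {1..r}" using lab_le_n[OF mu x(1)] x h by simp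
      have x0r: "x0 \<in> {1..r}" "lab n mu x0 = h" using x0_in[of 0] lab_mu[of x0] by simp_all
      obtain v where v: "v \<in> WB r" "\<And>y. y \<in> {1..r} \<Longrightarrow> v y = (if False then 2*r+1 - transpose x x0 y else transpose x x0 y)"
        using signed_perm[of "transpose x x0" r "\<lambda>_. False"] permutes_imp_bij[OF permutes_swap_id[OF xr x0r(1)]] by blast
      have low: "lab n mu (v y) = lab n mu y" if "y \<in> {1..r}" for y
        using v(2)[OF that] x(2) x0r(2) by (auto simp: transpose_def)
      have "lab n mu (v y) = lab n mu y" if y: "y \<in> {1..2*r}" for y
      proof (cases "y \<le> r")
        case False
        hence y': "2*r+1-y \<in> {1..r}" using y by auto
        have vy: "v y \<in> {1..2*r}" using WB_in[OF v(1)] y by blast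
        show ?thesis using low[OF y'] WB_mirror[OF v(1) y] lab_mirror[OF mu(1) y] lab_mirror[OF mu(1) vy] by simp
      qed (use low y in simp)
      hence vs: "v \<in> stab r (lab n mu)" using v(1) by (simp add: stab_def)
      have vx: "v x = x0" using v(2)[OF xr] by simp
      have iv: "inv' (v \<circ> w) x0 = inv' w x"
        using WB_inv_comp[OF v(1) ww(1)] WB_inv_apply(1)[OF v(1), of x] vx by simp
      have "v \<circ> w \<in> cosetB n r mu nu A" by (rule cosetB_left[OF mu(1) nu w vs])
      from cosetB_move_down(1)[OF nu this, of p] show ?thesis using that iv x(3) by simp
    qed
    have "(\<Sum>i\<in>{1..n}. \<Sum>j\<in>{n+2..2*n+1}. ?A p i j) = (\<Sum>i\<in>{1..n}. \<Sum>j\<in>{n+2..2*n+1}. A i j)"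
    proof -
      have "(\<Sum>i\<in>{1..n}. ?A p i j) = (\<Sum>i\<in>{1..n}. A i j)" if "j \<in> {n+2..2*n+1}" for j
      proof -
        have row: "?A p i j + (if i = h then (if j = p then 1 else 0) else 0)
          = A i j + (if i = h+1 then (if j = p then 1 else 0) else 0)" if i: "i \<in> {1..n}" for i
        proof -
          have "i \<noteq> 2*n+2-h" "i \<noteq> 2*n+2-(h+1)" using i h by auto
          thus ?thesis using pp(2) unfolding shift_down_def E_theta_h E_theta_Suc_h by (cases "i = h") simp_all
        qed
        have "(\<Sum>i\<in>{1..n}. ?A p i j) + (\<Sum>i\<in>{1..n}. if i = h then (if j = p then 1 else 0) else 0)
          = (\<Sum>i\<in>{1..n}. A i j) + (\<Sum>i\<in>{1..n}. if i = h+1 then (if j = p then 1 else 0) else 0)"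
          unfolding sum.distrib[symmetric] by (rule sum.cong[OF refl row])
        thus ?thesis using h by (simp add: sum.delta)
      qed
      thus ?thesis by (subst (1 2) sum.swap) (rule sum.cong[OF refl])
    qed
    hence sgp: "sgn_mat n (?A p) = Plus \<longleftrightarrow> e = e'" using sg by (simp add: sgn_mat_def)
    obtain Kp where Kp: "Kp \<in> FA r" "heq r (Kp * xrep n r ?b) (TS r (cosetD n r lam nu e (?A p) e'))"
      using phi_Op(1)[OF lam nu w' sgp] by blast
    thus ?thesis using phi_Op(2)[OF lam nu w' sgp Kp] by blast
  qed
  then obtain KK where KK: "\<And>p. p \<in> moves A \<Longrightarrow> KK p \<in> FA r"
    "\<And>p. p \<in> moves A \<Longrightarrow> heq r (KK p * xrep n r ?b) (TS r (cosetD n r lam nu e (?A p) e'))"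
    "\<And>p. p \<in> moves A \<Longrightarrow> phi n r e (?A p) e' = Op ?a ?b (KK p)"
    "\<And>p. p \<in> moves A \<Longrightarrow> maps_gen ?a ?b (KK p)" by metis
  define L where "L p = (if p \<in> moves A then scal (gcoef h A p) * KK p else 0)" for p
  have Lm: "maps_gen ?a ?b (L p)" for p using KK(4) maps_gen_scal maps_gen_zero[OF aL bL] by (simp add: L_def)
  have gt: "gterm n r h e A e' p = Op ?a ?b (L p)" if "p \<in> {1..2*n+1}" for p
    using that KK(3) Op_smult[OF KK(4)] Op_zero[OF aL bL] by (simp add: gterm_def L_def moves_def)
  interpret S: abelian_monoid "SD n r" by (rule abelian_monoid_SD)
  have "(\<Oplus>\<^bsub>SD n r\<^esub>p\<in>{1..2*n+1}. gterm n r h e A e' p) = (\<Oplus>\<^bsub>SD n r\<^esub>p\<in>{1..2*n+1}. Op ?a ?b (L p))"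
    by (rule S.finsum_cong') (use gt Op_SD[OF Lm] in auto)
  also have "\<dots> = Op ?a ?b (\<Sum>p\<in>{1..2*n+1}. L p)"
    by (rule conjunct1[OF Op_finsum[where K = L, OF finite_atLeastAtMost aL bL Lm]])
  also have "(\<Sum>p\<in>{1..2*n+1}. L p) = (\<Sum>p\<in>moves A. scal (gcoef h A p) * KK p)"
    by (rule sum.mono_neutral_cong_right) (auto simp: moves_def L_def)
  finally have rhs: "(\<Oplus>\<^bsub>SD n r\<^esub>p\<in>{1..2*n+1}. gterm n r h e A e' p) = Op ?a ?b (\<Sum>p\<in>moves A. scal (gcoef h A p) * KK p)" .
  have lhs: "phi n r e C e \<otimes>\<^bsub>SD n r\<^esub> phi n r e A e' = Op ?a ?b (Ke * KA)"
    unfolding phiC(1) phiA(1) by (rule Op_comp[OF phiC(2) phiA(2)])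

  \<comment> \<open>The operators on both sides are determined by the images of the generator, which remain to be
    compared.\<close>
  let ?X = "par r (e = e')"
  have XW: "?X \<subseteq> WB r" by (auto simp: par_def)
  have TF: "TS r (?X \<inter> cosetB n r mu nu A) \<in> FA r" by (rule TS_FA[OF r]) (use XW in blast)
  have 1: "heq r (Ke * KA * xrep n r ?b) (Ke * TS r (cosetD n r mu nu e A e'))"
    using heq_mult_left[OF r KeF KA(2)] by (simp only: mult.assoc)
  have 2: "heq r (Ke * TS r (cosetD n r mu nu e A e')) (Ke * (Tsign r e * TS r (?X \<inter> cosetB n r mu nu A) * Tsign r e'))"
    by (rule heq_mult_left[OF r KeF TS_cosetD])
  have 3: "heq r (Ke * (Tsign r e * TS r (?X \<inter> cosetB n r mu nu A) * Tsign r e')) (Tsign r e * (K * TS r (?X \<inter> cosetB n r mu nu A)) * Tsign r e')"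
    unfolding Ke_def by (rule Tsign_conj_mult[OF K(1) TF])
  have "heq r (K * TS r (?X \<inter> cosetB n r mu nu A)) (\<Sum>p\<in>moves A. scal (gcoef h A p) * TS r (?X \<inter> cosetB n r lam nu (?A p)))"
    by (rule row_move_formula[where K = K and A = A and nu = nu, OF K nu sym out XW par_closed])
  hence 4: "heq r (Tsign r e * (K * TS r (?X \<inter> cosetB n r mu nu A)) * Tsign r e')
     (Tsign r e * (\<Sum>p\<in>moves A. scal (gcoef h A p) * TS r (?X \<inter> cosetB n r lam nu (?A p))) * Tsign r e')"
    by (rule heq_mult_right[OF r Tsign_FA heq_mult_left[OF r Tsign_FA]])
  have "Tsign r e * (scal c * T) * Tsign r e' = scal c * (Tsign r e * T * Tsign r e')" for c T
    using scal_central[of c "Tsign r e"] by (metis mult.assoc)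
  hence e5: "Tsign r e * (\<Sum>p\<in>moves A. scal (gcoef h A p) * TS r (?X \<inter> cosetB n r lam nu (?A p))) * Tsign r e'
     = (\<Sum>p\<in>moves A. scal (gcoef h A p) * (Tsign r e * TS r (?X \<inter> cosetB n r lam nu (?A p)) * Tsign r e'))"
    by (simp add: sum_distrib_left sum_distrib_right)
  have 5: "heq r (\<Sum>p\<in>moves A. scal (gcoef h A p) * (Tsign r e * TS r (?X \<inter> cosetB n r lam nu (?A p)) * Tsign r e'))
     (\<Sum>p\<in>moves A. scal (gcoef h A p) * (KK p * xrep n r ?b))"
  proof (rule heq_sum[OF r])
    fix p assume p: "p \<in> moves A"
    show "heq r (scal (gcoef h A p) * (Tsign r e * TS r (?X \<inter> cosetB n r lam nu (?A p)) * Tsign r e')) (scal (gcoef h A p) * (KK p * xrep n r ?b))"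
      by (rule heq_mult_left[OF r FA_scal heq_sym[OF r heq_trans[OF r KK(2)[OF p] TS_cosetD]]])
  qed
  have e6: "(\<Sum>p\<in>moves A. scal (gcoef h A p) * (KK p * xrep n r ?b)) = (\<Sum>p\<in>moves A. scal (gcoef h A p) * KK p) * xrep n r ?b"
    by (simp add: sum_distrib_right mult.assoc)
  have "heq r (Ke * KA * xrep n r ?b) ((\<Sum>p\<in>moves A. scal (gcoef h A p) * KK p) * xrep n r ?b)"
    using heq_trans[OF r 1 heq_trans[OF r 2 heq_trans[OF r 3 heq_trans[OF r 4[unfolded e5] 5]]]] unfolding e6 .
  hence "Op ?a ?b (Ke * KA) = Op ?a ?b (\<Sum>p\<in>moves A. scal (gcoef h A p) * KK p)"
    by (rule Op_cong[OF bL]) (use KeF KA(1) KK(1) in \<open>auto intro!: FA_mult FA_sum FA_scal\<close>)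
  thus ?thesis unfolding lhs rhs .
qed

end

theorem theorem7p2:
  fixes n r h :: nat
    and A C :: "nat \<Rightarrow> nat \<Rightarrow> nat"
    and gam lam mu nu :: "nat \<Rightarrow> nat"
    and \<epsilon> :: pm
  assumes "n \<ge> 1" and "r \<ge> 4" and "h \<in> {1..n}"
    and "A \<in> Xi n r" and "C \<in> Xi n r"
    and "gam \<in> Lam (n+1) (r-1)"
    and "C = (\<lambda>i j. E_theta n (h+1) h i j + diag_mat (hat n gam) i j)"
    and "lam \<in> Lam (n+1) r" and "mu \<in> Lam (n+1) r" and "nu \<in> Lam (n+1) r"
    and "ro n C = hat n lam" and "co n C = hat n mu"
    and "ro n A = hat n mu" and "co n A = hat n nu"
    and "\<epsilon> = sgn_mat n A"
    and "C \<in> Xi_ooo n r"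
  shows "h < n \<and>
    (A \<in> Xi_oob n r \<union> Xi_ooo n r \<longrightarrow>
      phi n r Plus C Plus \<otimes>\<^bsub>SD n r\<^esub> phi n r Plus A \<epsilon>
        = (\<Oplus>\<^bsub>SD n r\<^esub>p\<in>{1..2*n+1}. gterm n r h Plus A \<epsilon> p) \<and>
      phi n r Minus C Minus \<otimes>\<^bsub>SD n r\<^esub> phi n r Minus A (- \<epsilon>)
        = (\<Oplus>\<^bsub>SD n r\<^esub>p\<in>{1..2*n+1}. gterm n r h Minus A (- \<epsilon>) p))"
proof -
  obtain l' m' where lm': "l' \<in> Lam (n+1) r" "m' \<in> Lam (n+1) r" "ro n C = hat n l'" "co n C = hat n m'"
    "l' (n+1) = 0" "m' (n+1) = 0" using assms(16) unfolding Xi_ooo_def by blast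
  have lam0: "lam (n+1) = 0" using hat_inj[OF lm'(1) assms(8)] lm'(3,5) assms(11) by simp
  have mu0: "mu (n+1) = 0" using hat_inj[OF lm'(2) assms(9)] lm'(4,6) assms(12) by simp
  \<comment> \<open>For \<open>h = n\<close> the entry at \<open>(n+1,n)\<close> would make the middle row sum nonzero.\<close>
  have hn: "h \<noteq> n"
  proof
    assume e: "h = n"
    have "C (n+1) n \<le> ro n C (n+1)" unfolding ro_def by (rule member_le_sum) (use assms(1) in auto)
    moreover have "C (n+1) n \<ge> 1" unfolding assms(7) e by (simp add: E_theta_def E_unit_def)
    ultimately show False using assms(11) lam0 by (simp add: hat_def)
  qed
  hence h: "1 \<le> h" "h < n" using assms(3) by auto
  have E: "E_theta n (h+1) h i j = (if i = h+1 \<and> j = h then 1 else 0) + (if i = 2*n+2-(h+1) \<and> j = 2*n+2-h then 1 else 0)" for i j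
    by (simp only: E_theta_def E_unit_def)
  have row: "(\<Sum>j\<in>{1..2*n+1}. C i j) = hat n gam i + (if i = h+1 then 1 else 0)" if i: "i \<in> {1..n}" for i
  proof -
    have "C i j = (if j = h then (if i = h+1 then 1 else 0) else 0) + (if j = i then hat n gam i else 0)" for j
      unfolding assms(7) E diag_mat_def using i h by auto
    thus ?thesis using i h by (simp add: sum.distrib)
  qed
  have col: "(\<Sum>i\<in>{1..2*n+1}. C i j) = hat n gam j + (if j = h then 1 else 0)" if j: "j \<in> {1..n}" for j
  proof -
    have "C i j = (if i = h+1 then (if j = h then 1 else 0) else 0) + (if i = j then hat n gam j else 0)" for i
      unfolding assms(7) E diag_mat_def using j h by auto
    thus ?thesis using j h by (simp add: sum.distrib)
  qed
  have mid: "gam (n+1) = 0"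
  proof -
    have "C (n+1) (n+1) \<le> ro n C (n+1)" unfolding ro_def by (rule member_le_sum) auto
    thus ?thesis using assms(11) lam0 unfolding assms(7) by (simp add: hat_def diag_mat_def)
  qed
  have gout: "gam i = 0" "lam i = 0" "mu i = 0" if "i \<notin> {1..n+1}" for i
    using assms(6,8,9) that unfolding Lam_def by blast+
  have lg: "lam i = gam i + (if i = h+1 then 1 else 0)" and mg: "mu i = gam i + (if i = h then 1 else 0)" for i
  proof -
    consider "i \<in> {1..n}" | "i = n+1" | "i \<notin> {1..n+1}" by fastforce
    hence "lam i = gam i + (if i = h+1 then 1 else 0) \<and> mu i = gam i + (if i = h then 1 else 0)"
    proof cases
      case 1
      have "hat n lam i = lam i" "hat n mu i = mu i" "hat n gam i = gam i" using 1 by (simp_all add: hat_def)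
      thus ?thesis using row[OF 1] col[OF 1] fun_cong[OF assms(11), of i] fun_cong[OF assms(12), of i]
        by (simp add: ro_def co_def)
    next
      case 2 thus ?thesis using mid lam0 mu0 h by simp
    next
      case 3
      hence "i \<noteq> h" "i \<noteq> h+1" using h by auto
      thus ?thesis using gout[OF 3] by simp
    qed
    thus "lam i = gam i + (if i = h+1 then 1 else 0)" "mu i = gam i + (if i = h then 1 else 0)" by blast+
  qed
  interpret row_move n r h lam mu gam
    by unfold_locales (use assms(2) h assms(8,9) lam0 mu0 lg mg in auto)
  note P = phi_product[OF assms(10,4,13,14,7)]
  have "sgn_mat n A = Plus \<longleftrightarrow> Plus = \<epsilon>" "sgn_mat n A = Plus \<longleftrightarrow> Minus = - \<epsilon>"
    unfolding assms(15) by (cases "sgn_mat n A"; simp)+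
  from P[OF this(1)] P[OF this(2)] h(2) show ?thesis by blast
qed

end
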